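(* Let $g:\mathbb{R}^d\to\mathbb{R}$ satisfy: (g-i) $g$ is continuously differentiable and non-negative; (g-ii) $\|\nabla g(\theta)-\nabla g(\theta')\|\le L\|\theta-\theta'\|$ for all $\theta,\theta'\in\mathbb{R}^d$; (g-iii) there exists $\eta>0$ such that $\liminf_{\|\theta\|\to+\infty}\|\nabla g(\theta)\|^2>\eta$; (g-iv) $g$ is coercive: $\lim_{\|\theta\|\to+\infty}g(\theta)=+\infty$; (g-v) the critical value set $\{g(\theta)\mid\nabla g(\theta)=0\}$ is nowhere dense in $\mathbb{R}$. Let $\{\theta_n\}_{n\ge1}$ be generated by AdaGrad-Norm, and suppose that for all $n\ge 1$: (n-i) $\mathbb{E}[\nabla g(\theta_n,\xi_n)\mid\mathscr{F}_{n-1}]=\nabla g(\theta_n)$; (n-ii) $\mathbb{E}[\|\nabla g(\theta_n,\xi_n)\|^2\mid\mathscr{F}_{n-1}]\le\sigma_0\|\nabla g(\theta_n)\|^2+\sigma_1$ for some constants $\sigma_0,\sigma_1\ge0$; (n-iii) for some constants $D_0,D_1>0$, for any $\theta_n$ satisfying $\|\nabla g(\theta_n)\|^2<D_0$ one has $\|\nabla g(\theta_n,\xi_n)\|^2<D_1$ almost surely. Then for any initial point $\theta_1\in\mathbb{R}^d$ and any $S_0>0$, $$\lim_{n\to\infty}\mathbb{E}\|\nabla g(\theta_n)\|^2=0.$$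
   Context: AdaGrad-Norm: given an initial point $\theta_1\in\mathbb{R}^d$ and constants $S_0>0$, $\alpha_0>0$, for $n\ge1$ $$S_n=S_{n-1}+\|\nabla g(\theta_n,\xi_n)\|^2,\qquad \theta_{n+1}=\theta_n-\frac{\alpha_0}{\sqrt{S_n}}\nabla g(\theta_n,\xi_n).$$ Here $\{\xi_n\}_{n\ge1}$ is a sequence of independent random variables and $\nabla g(\theta_n,\xi_n)\in\mathbb{R}^d$ is the random vector (stochastic gradient) returned by a stochastic first-order oracle at $\theta_n$ with noise $\xi_n$. The filtration is $\mathscr{F}_n=\sigma\{\theta_1,\xi_1,\dots,\xi_n\}$ for $n\ge1$ and $\mathscr{F}_0=\{\emptyset,\Omega\}$. *)

theory Defs
  imports "HOL-Probability.Probability"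
begin

text \<open>
  The \<sigma>-algebra generated by \<open>\<theta>\<^sub>1, \<xi> 1, \<dots>, \<xi> n\<close>.  The initial point is
  deterministic, so its preimages contribute only the empty set and the whole space.
\<close>

definition oracle_filtration ::
    "'w measure \<Rightarrow> 'e measure \<Rightarrow> 'a::topological_space \<Rightarrow> (nat \<Rightarrow> 'w \<Rightarrow> 'e) \<Rightarrow> nat \<Rightarrow> 'w measure"
  where
    "oracle_filtration M N \<theta>\<^sub>1 \<xi> n =
       sigma (space M)
         ({(\<lambda>_. \<theta>\<^sub>1) -` B \<inter> space M | B. B \<in> sets borel} \<union>
          (\<Union>i\<in>{1..n}. {\<xi> i -` A \<inter> space M | A. A \<in> sets N}))"

lemma sets_oracle_filtration_0:
  "sets (oracle_filtration M N \<theta>\<^sub>1 \<xi> 0) = {{}, space M}"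
proof -
  have "{} \<in> {(\<lambda>_. \<theta>\<^sub>1) -` B \<inter> space M | B. B \<in> sets borel}"
    by (rule CollectI, rule exI[of _ "{}"]) simp
  moreover have "space M \<in> {(\<lambda>_. \<theta>\<^sub>1) -` B \<inter> space M | B. B \<in> sets borel}"
    by (rule CollectI, rule exI[of _ UNIV]) simp
  moreover have "{(\<lambda>_. \<theta>\<^sub>1) -` B \<inter> space M | B. B \<in> sets borel} \<subseteq> {{}, space M}"
    by (auto simp: vimage_const split: if_splits)
  ultimately have gen: "{(\<lambda>_. \<theta>\<^sub>1) -` B \<inter> space M | B. B \<in> sets borel} = {{}, space M}"
    by blast
  show ?thesis
    unfolding oracle_filtration_def gen
    by (simp add: sigma_algebra.sigma_sets_eq[OF sigma_algebra_trivial])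
qed

text \<open>The conditional expectation of a random vector, taken coordinatewise.\<close>

definition vec_cond_exp ::
    "'w measure \<Rightarrow> 'w measure \<Rightarrow> ('w \<Rightarrow> real ^ 'd) \<Rightarrow> 'w \<Rightarrow> real ^ 'd"
  where "vec_cond_exp M F X \<omega> = (\<chi> i. real_cond_exp M F (\<lambda>\<omega>'. X \<omega>' $ i) \<omega>)"

text \<open>
  The recursion is required only at indices \<open>n \<ge> 1\<close>, so \<open>\<theta> 0\<close> is unconstrained and
  plays no role.
\<close>

definition adagrad_norm ::
    "(real ^ 'd \<Rightarrow> 'e \<Rightarrow> real ^ 'd) \<Rightarrow> real \<Rightarrow> real \<Rightarrow> real ^ 'd \<Rightarrow>
     (nat \<Rightarrow> 'e) \<Rightarrow> (nat \<Rightarrow> real) \<Rightarrow> (nat \<Rightarrow> real ^ 'd) \<Rightarrow> bool"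
  where
    "adagrad_norm G \<alpha>\<^sub>0 S\<^sub>0 \<theta>\<^sub>1 \<xi> S \<theta> \<longleftrightarrow>
       \<theta> 1 = \<theta>\<^sub>1 \<and> S 0 = S\<^sub>0 \<and>
       (\<forall>n\<ge>1. S n = S (n - 1) + (norm (G (\<theta> n) (\<xi> n)))\<^sup>2 \<and>
              \<theta> (n + 1) = \<theta> n - (\<alpha>\<^sub>0 / sqrt (S n)) *\<^sub>R G (\<theta> n) (\<xi> n))"

definition nowhere_dense :: "'a::topological_space set \<Rightarrow> bool"
  where "nowhere_dense A \<longleftrightarrow> interior (closure A) = {}"

end

theory Submission
  imports Defs
begin

text \<open>
Write \<open>w = 1 + g\<close> and let \<open>v\<close> be the norm of the gradient at the current point, \<open>H\<close> the
stochastic gradient, \<open>S\<close> and \<open>S'\<close> the accumulated squares before and after the step.  The step has length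
at most \<open>\<alpha>\<close>, so after \<open>n\<close> steps the iterate stays in a fixed ball and all weights below are bounded for
each fixed \<open>n\<close>.  Taylor expansion of \<open>g\<close> along a step produces the wanted decrease \<open>\<alpha> v\<^sup>2 / sqrt S\<close> and two
errors: a second order term \<open>\<Gamma> = |H|\<^sup>2 / S'\<close>, and a correlation term, because the step size \<open>\<alpha> / sqrt S'\<close>
depends on the same \<open>H\<close>.  The sum of \<open>\<Gamma>\<close> grows like \<open>ln S\<close> and is in general infinite, whereas the decay
\<open>D = 1 / sqrt S - 1 / sqrt S'\<close> telescopes.  The proof bounds every occurrence of \<open>\<Gamma>\<close> either by \<open>D\<close> or by noise that is summable in expectation.

\<^bold>\<open>A weighted energy estimate.\<close>  Dividing \<open>w\<^sup>3\<close> by \<open>sqrt S\<close> turns \<open>\<Gamma>\<close> into \<open>\<Gamma> / sqrt S \<le> 2 D\<close>, and the division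
itself releases \<open>- w\<^sup>3 D\<close>, which absorbs every error of the form \<open>C w\<^sup>2 D\<close>.  What remains of the correlation
is \<open>\<sigma>0 w\<^sup>2 v\<^sup>2 D / sqrt S\<close>; it is dominated by the decay of the potential \<open>w\<^sup>2 v\<^sup>2 / S\<close>, which is therefore
added to the Lyapunov function (\<open>lyapunov_step\<close>).  The result is that the expectations of \<open>w\<^sup>2 v\<^sup>2 / S\<close> are summable
(\<open>expected_descent_sum\<close>).  By the affine variance bound the expectations of \<open>w\<^sup>2 |H|\<^sup>2 / S\<close>, restricted to
the times at which \<open>v\<^sup>2 \<ge> \<nu>\<close>, are summable for every \<open>\<nu> > 0\<close>: away from critical points the noise is square
summable, and non-summable noise occurs only where the gradient is small, so that the noise is bounded by hypothesis.

\<^bold>\<open>Uniform integrability.\<close>  Small gradients occur only below some level \<open>B - 1\<close> of \<open>g\<close>.  A step from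
there to a value above \<open>B\<close> changes \<open>g\<close> by more than \<open>1\<close>, and as the noise is bounded the square of such a change is controlled
by \<open>D\<close>; above \<open>B\<close> the noise is summable.
Hence \<open>(max 0 (g - B))\<^sup>2\<close> has bounded expectation along the process (\<open>expected_excess_bounded\<close>), and so has
\<open>v ^ 4 \<le> 4 L\<^sup>2 g\<^sup>2\<close>.

\<^bold>\<open>Almost sure convergence.\<close>  While \<open>v\<^sup>2 \<ge> \<nu>\<close>, the martingale part of the motion is square summable and hence
converges almost surely (\<open>martingale_AE_summable\<close>).  The rest is deterministic (\<open>adagrad_trajectory\<close>).  If
\<open>S\<close> stays bounded, summability of \<open>v\<^sup>2 / S\<close> gives \<open>v \<longrightarrow> 0\<close>.  Otherwise, as the critical values are nowhere
dense, between any two levels of \<open>g\<close> there is a band without critical values, where the noise is summable and the drift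
points down; such a band is crossed upwards only finitely often, so \<open>g\<close> converges along the trajectory.
Each excursion from \<open>v \<ge> 2 r\<close> to \<open>v < r\<close> needs a displacement of at least \<open>r / L\<close> and thereby lowers \<open>g\<close> by a
fixed amount, which a convergent sequence allows only finitely often.

Convergence of \<open>v\<^sup>2\<close> to \<open>0\<close> almost surely together with bounded fourth moments yields convergence in mean.
\<close>

section \<open>Smooth non-negative functions\<close>

locale smooth_nonneg =
  fixes g :: "'a::euclidean_space \<Rightarrow> real" and grad :: "'a \<Rightarrow> 'a" and L :: real
  assumes L_pos: "L > 0"
    and gderiv: "GDERIV g x :> grad x"
    and g_nonneg: "0 \<le> g x"
    and grad_lipschitz: "norm (grad x - grad y) \<le> L * norm (x - y)"
begin

lemma g_has_derivative: "(g has_derivative (\<lambda>h. h \<bullet> grad x)) (at x)"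
  using gderiv[of x] by (simp add: gderiv_def)

lemma continuous_on_g: "continuous_on UNIV g"
  by (intro continuous_at_imp_continuous_on ballI has_derivative_continuous[OF g_has_derivative])

lemma continuous_on_grad: "continuous_on UNIV grad"
proof -
  have "L-lipschitz_on UNIV grad"
    using grad_lipschitz L_pos by (auto intro!: lipschitz_onI simp: dist_norm)
  then show ?thesis by (rule lipschitz_on_continuous_on)
qed

lemma g_borel [measurable]: "g \<in> borel_measurable borel"
  by (rule borel_measurable_continuous_onI[OF continuous_on_g])

lemma grad_borel [measurable]: "grad \<in> borel_measurable borel"
  by (rule borel_measurable_continuous_onI[OF continuous_on_grad])

text \<open>
The upper estimate gives the decrease of \<open>g\<close> along a step, the lower one limits how fast \<open>g\<close> can vary at all.
\<close>

lemma taylor_bound: "\<bar>g y - g x - grad x \<bullet> (y - x)\<bar> \<le> L / 2 * (norm (y - x))\<^sup>2"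
proof -
  define d where "d = y - x"
  have deriv: "((\<lambda>t. g (x + t *\<^sub>R d)) has_real_derivative (grad (x + t *\<^sub>R d) \<bullet> d)) (at t)" for t
  proof -
    have "((\<lambda>t. g (x + t *\<^sub>R d)) has_derivative (\<lambda>h. (h *\<^sub>R d) \<bullet> grad (x + t *\<^sub>R d))) (at t)"
      by (rule has_derivative_compose[OF _ g_has_derivative])
         (auto intro!: derivative_eq_intros)
    then show ?thesis
      by (simp add: has_field_derivative_def inner_commute mult_commute_abs)
  qed
  have dev: "\<bar>(grad (x + t *\<^sub>R d) - grad x) \<bullet> d\<bar> \<le> L * t * (norm d)\<^sup>2" if "0 \<le> t" for t
  proof -
    have "\<bar>(grad (x + t *\<^sub>R d) - grad x) \<bullet> d\<bar> \<le> norm (grad (x + t *\<^sub>R d) - grad x) * norm d"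
      by (rule Cauchy_Schwarz_ineq2)
    also have "\<dots> \<le> (L * norm (t *\<^sub>R d)) * norm d"
      using grad_lipschitz[of "x + t *\<^sub>R d" x] by (intro mult_right_mono) auto
    finally show ?thesis using that by (simp add: power2_eq_square algebra_simps)
  qed
  have up: "g (x + 1 *\<^sub>R d) - 1 * (grad x \<bullet> d) - L / 2 * 1\<^sup>2 * (norm d)\<^sup>2
      \<le> g (x + 0 *\<^sub>R d) - 0 * (grad x \<bullet> d) - L / 2 * 0\<^sup>2 * (norm d)\<^sup>2"
  proof (rule DERIV_nonpos_imp_nonincreasing[where f="\<lambda>t. g (x + t *\<^sub>R d) - t * (grad x \<bullet> d) - L / 2 * t\<^sup>2 * (norm d)\<^sup>2"])
    fix t :: real assume "0 \<le> t"
    have "((\<lambda>t. g (x + t *\<^sub>R d) - t * (grad x \<bullet> d) - L / 2 * t\<^sup>2 * (norm d)\<^sup>2) has_real_derivative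
            (grad (x + t *\<^sub>R d) \<bullet> d - grad x \<bullet> d - L * t * (norm d)\<^sup>2)) (at t)"
      by (rule derivative_eq_intros deriv refl)+ simp
    moreover have "grad (x + t *\<^sub>R d) \<bullet> d - grad x \<bullet> d - L * t * (norm d)\<^sup>2 \<le> 0"
      using dev[OF \<open>0 \<le> t\<close>] by (auto simp: inner_diff_left abs_le_iff)
    ultimately show "\<exists>y. ((\<lambda>t. g (x + t *\<^sub>R d) - t * (grad x \<bullet> d) - L / 2 * t\<^sup>2 * (norm d)\<^sup>2) has_real_derivative y) (at t) \<and> y \<le> 0"
      by blast
  qed simp
  have down: "g (x + 0 *\<^sub>R d) - 0 * (grad x \<bullet> d) + L / 2 * 0\<^sup>2 * (norm d)\<^sup>2
      \<le> g (x + 1 *\<^sub>R d) - 1 * (grad x \<bullet> d) + L / 2 * 1\<^sup>2 * (norm d)\<^sup>2"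
  proof (rule DERIV_nonneg_imp_nondecreasing[where f="\<lambda>t. g (x + t *\<^sub>R d) - t * (grad x \<bullet> d) + L / 2 * t\<^sup>2 * (norm d)\<^sup>2"])
    fix t :: real assume "0 \<le> t"
    have "((\<lambda>t. g (x + t *\<^sub>R d) - t * (grad x \<bullet> d) + L / 2 * t\<^sup>2 * (norm d)\<^sup>2) has_real_derivative
            (grad (x + t *\<^sub>R d) \<bullet> d - grad x \<bullet> d + L * t * (norm d)\<^sup>2)) (at t)"
      by (rule derivative_eq_intros deriv refl)+ simp
    moreover have "0 \<le> grad (x + t *\<^sub>R d) \<bullet> d - grad x \<bullet> d + L * t * (norm d)\<^sup>2"
      using dev[OF \<open>0 \<le> t\<close>] by (auto simp: inner_diff_left abs_le_iff)
    ultimately show "\<exists>y. ((\<lambda>t. g (x + t *\<^sub>R d) - t * (grad x \<bullet> d) + L / 2 * t\<^sup>2 * (norm d)\<^sup>2) has_real_derivative y) (at t) \<and> 0 \<le> y"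
      by blast
  qed simp
  have "x + d = y" by (simp add: d_def)
  then have "g y - g x - grad x \<bullet> d \<le> L / 2 * (norm d)\<^sup>2"
    and "- (g y - g x - grad x \<bullet> d) \<le> L / 2 * (norm d)\<^sup>2"
    using up down by auto
  then show ?thesis unfolding d_def by (rule abs_leI)
qed

text \<open>
A gradient step of length \<open>1 / L\<close> decreases \<open>g\<close> by \<open>|grad x|\<^sup>2 / (2 L)\<close>, and the result is still non-negative.
\<close>

lemma norm_grad_sq_le: "(norm (grad x))\<^sup>2 \<le> 2 * L * g x"
proof -
  define y where "y = x - (1 / L) *\<^sub>R grad x"
  have "g y \<le> g x + grad x \<bullet> (y - x) + L / 2 * (norm (y - x))\<^sup>2"
    using abs_le_D1[OF taylor_bound[of y x]] by linarith
  also have "grad x \<bullet> (y - x) = - (norm (grad x))\<^sup>2 / L"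
    by (simp add: y_def dot_square_norm)
  also have "L / 2 * (norm (y - x))\<^sup>2 = (norm (grad x))\<^sup>2 / (2 * L)"
    using L_pos by (simp add: y_def power2_eq_square)
  finally have "0 \<le> g x - (norm (grad x))\<^sup>2 / L + (norm (grad x))\<^sup>2 / (2 * L)"
    using g_nonneg[of y] by simp
  then show ?thesis using L_pos by (simp add: field_simps)
qed

text \<open>
Being at least \<open>1\<close>, \<open>w\<close> dominates constants as well as \<open>g\<close> and the square of the gradient, and its powers are
increasing in the exponent.
\<close>

definition w :: "'a \<Rightarrow> real" where "w x = 1 + g x"

lemma w_ge_1: "1 \<le> w x" by (simp add: w_def g_nonneg)

lemma w_borel [measurable]: "w \<in> borel_measurable borel"
  unfolding w_def[abs_def] by measurable

lemma norm_grad_le: "norm (grad x) \<le> sqrt (2 * L) * sqrt (w x)"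
proof -
  have "(norm (grad x))\<^sup>2 \<le> 2 * L * w x"
    using norm_grad_sq_le[of x] L_pos by (simp add: w_def algebra_simps)
  then show ?thesis by (metis real_le_rsqrt real_sqrt_mult)
qed

end

section \<open>One step of the algorithm\<close>

locale adagrad_smooth = smooth_nonneg +
  fixes \<alpha> S0 :: real
  assumes alpha_pos: "\<alpha> > 0" and S0_pos: "S0 > 0"
begin

definition step :: "'a \<Rightarrow> 'a \<Rightarrow> real \<Rightarrow> 'a" where
  "step x H S = x - (\<alpha> / sqrt (S + (norm H)\<^sup>2)) *\<^sub>R H"

definition noise_ratio :: "'a \<Rightarrow> real \<Rightarrow> real" where
  "noise_ratio H S = (norm H)\<^sup>2 / (S + (norm H)\<^sup>2)"

definition step_decay :: "'a \<Rightarrow> real \<Rightarrow> real" where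
  "step_decay H S = 1 / sqrt S - 1 / sqrt (S + (norm H)\<^sup>2)"

text \<open>
The change of \<open>g\<close> over a step is at most \<open>K\<close> times \<open>sqrt (noise_ratio H S) * sqrt (w x)\<close>.
\<close>

definition K :: real where "K = sqrt (2 * L) * \<alpha> + L / 2 * \<alpha>\<^sup>2"

lemma K_pos: "K > 0"
  using L_pos alpha_pos by (simp add: K_def add_pos_pos)

lemma noise_ratio_nonneg: "S > 0 \<Longrightarrow> 0 \<le> noise_ratio H S"
  by (simp add: noise_ratio_def)

lemma noise_ratio_le_1: "S > 0 \<Longrightarrow> noise_ratio H S \<le> 1"
  by (simp add: noise_ratio_def divide_le_eq add_pos_nonneg)

lemma noise_ratio_le_ratio: "S > 0 \<Longrightarrow> noise_ratio H S \<le> (norm H)\<^sup>2 / S"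
  unfolding noise_ratio_def by (intro divide_left_mono) (auto intro!: mult_pos_pos add_pos_nonneg)

lemma sqrt_noise_ratio: "S > 0 \<Longrightarrow> sqrt (noise_ratio H S) = norm H / sqrt (S + (norm H)\<^sup>2)"
  by (simp add: noise_ratio_def real_sqrt_divide)

lemma norm_step: "S > 0 \<Longrightarrow> norm (step x H S - x) = \<alpha> * sqrt (noise_ratio H S)"
  using alpha_pos by (simp add: step_def sqrt_noise_ratio)

lemma step_decay_nonneg: "S > 0 \<Longrightarrow> 0 \<le> step_decay H S"
  unfolding step_decay_def by (simp add: frac_le)

lemma sqrt_S_step_decay_le_1: "S > 0 \<Longrightarrow> sqrt S * step_decay H S \<le> 1"
  unfolding step_decay_def by (simp add: right_diff_distrib)

text \<open>
With the extra factor \<open>1 / sqrt S\<close> the second order term becomes part of a telescoping sum.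
\<close>

lemma noise_ratio_le_step_decay:
  assumes "S > 0"
  shows "noise_ratio H S / sqrt S \<le> 2 * step_decay H S"
proof -
  define a s where "a = sqrt S" and "s = sqrt (S + (norm H)\<^sup>2)"
  have as: "0 < a" "a \<le> s" "a\<^sup>2 = S" "s\<^sup>2 = S + (norm H)\<^sup>2"
    using assms by (auto simp: a_def s_def)
  have "noise_ratio H S = (s\<^sup>2 - a\<^sup>2) / s\<^sup>2"
    by (simp add: noise_ratio_def as)
  also have "\<dots> = (1 - a / s) * (1 + a / s)"
    using as by (simp add: field_simps power2_eq_square)
  also have "\<dots> \<le> (1 - a / s) * 2"
    using as by (intro mult_left_mono) auto
  finally have "noise_ratio H S / a \<le> (1 - a / s) * 2 / a"
    using as by (intro divide_right_mono) auto
  also have "\<dots> = 2 * step_decay H S"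
    unfolding step_decay_def a_def[symmetric] s_def[symmetric] using as by (simp add: field_simps)
  finally show ?thesis by (simp add: a_def)
qed

text \<open>
The square root of \<open>S\<close> grows by at most \<open>norm H\<close> in a step.  The estimate serves wherever the relative noise
\<open>(norm H)\<^sup>2 / S\<close> is summable.
\<close>

lemma norm_step_decay_le:
  assumes "S > 0"
  shows "norm H * step_decay H S \<le> (norm H)\<^sup>2 / S"
proof -
  define a s h where "a = sqrt S" and "s = sqrt (S + (norm H)\<^sup>2)" and "h = norm H"
  have as: "0 < a" "a \<le> s" "a\<^sup>2 = S" "s\<^sup>2 = a\<^sup>2 + h\<^sup>2" "0 \<le> h"
    using assms by (auto simp: a_def s_def h_def)
  have "s \<le> a + h"
    by (rule power2_le_imp_le) (use as in \<open>auto simp: power2_sum\<close>)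
  have "step_decay H S = (s - a) / (a * s)"
    unfolding step_decay_def a_def[symmetric] s_def[symmetric] using as by (simp add: field_simps)
  also have "\<dots> \<le> h / (a * a)"
    using as \<open>s \<le> a + h\<close> by (intro frac_le mult_left_mono) auto
  finally have "h * step_decay H S \<le> h * (h / (a * a))"
    using as by (intro mult_left_mono) auto
  then show ?thesis
    unfolding h_def[symmetric] using as by (simp add: power2_eq_square)
qed

lemma g_change:
  assumes "norm (y - x) \<le> \<alpha> * \<rho>" "0 \<le> \<rho>" "\<rho> \<le> 1"
  shows "\<bar>g y - g x\<bar> \<le> K * \<rho> * sqrt (w x)"
proof -
  have w1: "1 \<le> sqrt (w x)" using w_ge_1[of x] by simp
  have "\<bar>g y - g x\<bar> \<le> \<bar>grad x \<bullet> (y - x)\<bar> + L / 2 * (norm (y - x))\<^sup>2"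
    using taylor_bound[of y x] by linarith
  also have "\<bar>grad x \<bullet> (y - x)\<bar> \<le> norm (grad x) * norm (y - x)"
    by (rule Cauchy_Schwarz_ineq2)
  also have "\<dots> \<le> (sqrt (2 * L) * sqrt (w x)) * (\<alpha> * \<rho>)"
    using assms norm_grad_le[of x] L_pos w1 by (intro mult_mono) auto
  also have "L / 2 * (norm (y - x))\<^sup>2 \<le> L / 2 * (\<alpha> * \<rho>)\<^sup>2"
    using assms L_pos by (intro mult_left_mono power_mono) auto
  also have "(\<alpha> * \<rho>)\<^sup>2 \<le> \<alpha>\<^sup>2 * (\<rho> * sqrt (w x))"
  proof -
    have "\<rho> * \<rho> \<le> \<rho> * sqrt (w x)"
      using assms w1 order_trans[OF \<open>\<rho> \<le> 1\<close> w1] by (intro mult_left_mono) simp_all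
    then show ?thesis
      unfolding power_mult_distrib by (intro mult_left_mono) (auto simp: power2_eq_square)
  qed
  finally show ?thesis
    using L_pos by (simp add: K_def algebra_simps)
qed

lemma g_step_change:
  assumes "S > 0"
  shows "\<bar>g (step x H S) - g x\<bar> \<le> K * sqrt (noise_ratio H S) * sqrt (w x)"
  by (rule g_change) (use assms in \<open>auto simp: norm_step noise_ratio_nonneg noise_ratio_le_1\<close>)

text \<open>
The change of \<open>g\<close> is estimated from the new point backwards, so that the bound is in terms of the new value.
\<close>

lemma w_le_w_step:
  assumes "S > 0"
  shows "w x \<le> (1 + K) * w (step x H S)"
proof -
  let ?y = "step x H S"
  have "norm (x - ?y) \<le> \<alpha> * 1"
    using norm_step[OF assms, of x H] noise_ratio_le_1[OF assms, of H] alpha_pos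
    by (simp add: norm_minus_commute)
  then have "\<bar>g x - g ?y\<bar> \<le> K * 1 * sqrt (w ?y)"
    by (rule g_change) auto
  moreover have "sqrt (w ?y) \<le> w ?y"
    using w_ge_1[of ?y] by (simp add: sqrt_le_D real_le_lsqrt power2_eq_square)
  ultimately have "\<bar>g x - g ?y\<bar> \<le> K * w ?y"
    using K_pos by (smt (verit) mult_left_mono mult.right_neutral)
  then show ?thesis by (simp add: w_def algebra_simps)
qed

lemma g_step_le:
  assumes "S > 0"
  shows "g (step x H S) \<le> g x - \<alpha> * (grad x \<bullet> H) / sqrt (S + (norm H)\<^sup>2) + L * \<alpha>\<^sup>2 / 2 * noise_ratio H S"
proof -
  have "grad x \<bullet> (step x H S - x) = - \<alpha> * (grad x \<bullet> H) / sqrt (S + (norm H)\<^sup>2)"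
    by (simp add: step_def)
  moreover have "(norm (step x H S - x))\<^sup>2 = \<alpha>\<^sup>2 * noise_ratio H S"
    using assms by (simp add: norm_step power_mult_distrib noise_ratio_nonneg)
  ultimately show ?thesis
    using abs_le_D1[OF taylor_bound[of "step x H S" x]] by simp
qed

definition C1 :: real where "C1 = 3 * L * \<alpha>\<^sup>2 / 2 + 3 * K\<^sup>2 + K ^ 3"

lemma C1_pos: "C1 > 0"
  using L_pos alpha_pos K_pos by (simp add: C1_def add_pos_pos)

text \<open>
The Taylor expansion of the cube of \<open>w\<close>.  All higher order terms are of size \<open>(w x)\<^sup>2\<close> because \<open>g\<close> changes by
at most \<open>K * sqrt \<Gamma> * sqrt w\<close> and \<open>\<Gamma> \<le> 1\<close>.  The third power is chosen so that the resulting energy estimate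
carries the weight \<open>(w x)\<^sup>2\<close>, which later pays for the noise in the evolution of the square of \<open>g\<close>.
\<close>

lemma w_cube_step:
  assumes "S > 0"
  shows "(w (step x H S)) ^ 3 \<le>
    (w x) ^ 3 - 3 * \<alpha> * (w x)\<^sup>2 * (grad x \<bullet> H) / sqrt (S + (norm H)\<^sup>2) + C1 * (w x)\<^sup>2 * noise_ratio H S"
proof -
  define u where "u = w x"
  define d where "d = g (step x H S) - g x"
  define \<Gamma> where "\<Gamma> = noise_ratio H S"
  define e where "e = \<alpha> * (grad x \<bullet> H) / sqrt (S + (norm H)\<^sup>2)"
  have u1: "1 \<le> u" by (simp add: u_def w_ge_1)
  have \<Gamma>: "0 \<le> \<Gamma>" "\<Gamma> \<le> 1" using assms by (auto simp: \<Gamma>_def noise_ratio_nonneg noise_ratio_le_1)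
  have d1: "d \<le> - e + L * \<alpha>\<^sup>2 / 2 * \<Gamma>"
    using g_step_le[OF assms, of x H] by (simp add: d_def e_def \<Gamma>_def)
  have d2: "\<bar>d\<bar> \<le> K * sqrt \<Gamma> * sqrt u"
    using g_step_change[OF assms, of x H] by (simp add: d_def u_def \<Gamma>_def)
  have "d\<^sup>2 \<le> (K * sqrt \<Gamma> * sqrt u)\<^sup>2"
    using d2 by (metis abs_ge_zero power2_abs power_mono)
  then have d3: "d\<^sup>2 \<le> K\<^sup>2 * \<Gamma> * u"
    using \<Gamma> u1 by (simp add: power_mult_distrib)
  have "sqrt \<Gamma> * sqrt u \<le> 1 * u"
    using \<Gamma> u1 by (intro mult_mono) (auto simp: real_le_lsqrt power2_eq_square)
  then have d4: "\<bar>d\<bar> \<le> K * u"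
    using d2 K_pos by (smt (verit) mult.assoc mult_left_mono mult_1)
  have "d ^ 3 \<le> \<bar>d\<bar> * d\<^sup>2"
    by (simp add: power3_eq_cube power2_eq_square mult.assoc abs_mult_self_eq mult_right_mono)
  also have "\<dots> \<le> (K * u) * (K\<^sup>2 * \<Gamma> * u)"
    using d3 d4 K_pos u1 by (intro mult_mono) auto
  finally have d5: "d ^ 3 \<le> K ^ 3 * u\<^sup>2 * \<Gamma>"
    by (simp add: power3_eq_cube power2_eq_square algebra_simps)
  have d6: "3 * u * d\<^sup>2 \<le> 3 * K\<^sup>2 * u\<^sup>2 * \<Gamma>"
    using mult_left_mono[OF d3, of "3 * u"] u1 by (simp add: power2_eq_square algebra_simps)
  have d7: "3 * u\<^sup>2 * d \<le> 3 * u\<^sup>2 * (- e + L * \<alpha>\<^sup>2 / 2 * \<Gamma>)"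
    using d1 by (intro mult_left_mono) auto
  have "w (step x H S) = u + d" by (simp add: u_def d_def w_def)
  then have "(w (step x H S)) ^ 3 = u ^ 3 + 3 * u\<^sup>2 * d + 3 * u * d\<^sup>2 + d ^ 3"
    by (simp add: power3_eq_cube power2_eq_square algebra_simps)
  also have "\<dots> \<le> u ^ 3 - 3 * u\<^sup>2 * e + C1 * u\<^sup>2 * \<Gamma>"
    using d5 d6 d7 by (simp add: C1_def algebra_simps)
  finally show ?thesis by (simp add: u_def e_def \<Gamma>_def algebra_simps)
qed

definition K3 :: real where "K3 = L * \<alpha> + K * sqrt (2 * L) + K * L * \<alpha>"

text \<open>
The gradient is only Lipschitz, so the potential \<open>(w v)\<^sup>2\<close> has no second order expansion.  Its first order change
is of size \<open>w v \<cdot> w sqrt \<Gamma>\<close>, and Young's inequality with parameter \<open>\<epsilon>\<close> splits it into a small multiple of the potential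
and a term of the tractable size \<open>w\<^sup>2 \<Gamma>\<close>.
\<close>

lemma weighted_grad_step:
  assumes "S > 0" "\<epsilon> > 0"
  shows "(w (step x H S) * norm (grad (step x H S)))\<^sup>2 \<le>
    (1 + \<epsilon>) * (w x * norm (grad x))\<^sup>2 + (1 + 1 / \<epsilon>) * K3\<^sup>2 * (w x)\<^sup>2 * noise_ratio H S"
proof -
  define y where "y = step x H S"
  define u where "u = w x"
  define v where "v = norm (grad x)"
  define r where "r = sqrt (noise_ratio H S)"
  have u1: "1 \<le> u" by (simp add: u_def w_ge_1)
  have r: "0 \<le> r" "r \<le> 1" using assms by (auto simp: r_def noise_ratio_nonneg noise_ratio_le_1)
  have su: "sqrt u * sqrt u = u" "1 \<le> sqrt u" "sqrt u \<le> u"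
    using u1 by (auto simp: real_le_lsqrt power2_eq_square)
  have v: "0 \<le> v" "v \<le> sqrt (2 * L) * sqrt u"
    using norm_grad_le[of x] by (auto simp: v_def u_def)
  have wy: "w y \<le> u + K * r * sqrt u"
    using g_step_change[OF assms(1), of x H] by (simp add: y_def u_def r_def w_def)
  have "norm (grad y) \<le> v + norm (grad y - grad x)"
    using norm_triangle_ineq[of "grad x" "grad y - grad x"] by (simp add: v_def)
  also have "\<dots> \<le> v + L * (\<alpha> * r)"
    using grad_lipschitz[of y x] norm_step[OF assms(1), of x H] by (simp add: y_def r_def)
  finally have vy: "norm (grad y) \<le> v + L * \<alpha> * r" by (simp add: mult.assoc)
  have "w y * norm (grad y) \<le> (u + K * r * sqrt u) * (v + L * \<alpha> * r)"
    using wy vy w_ge_1[of y] u1 K_pos r by (intro mult_mono) auto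
  also have "\<dots> = u * v + L * \<alpha> * (u * r) + K * r * (sqrt u * v) + K * L * \<alpha> * (r * r * sqrt u)"
    by (simp add: algebra_simps)
  also have "K * r * (sqrt u * v) \<le> K * r * (sqrt (2 * L) * u)"
  proof -
    have "sqrt u * v \<le> sqrt u * (sqrt (2 * L) * sqrt u)"
      using v su by (intro mult_left_mono) auto
    also have "\<dots> = sqrt (2 * L) * u"
      using su by (simp add: mult.commute mult.left_commute)
    finally show ?thesis using K_pos r by (intro mult_left_mono) auto
  qed
  also have "K * L * \<alpha> * (r * r * sqrt u) \<le> K * L * \<alpha> * (1 * r * u)"
    using K_pos L_pos alpha_pos r su u1 by (intro mult_left_mono mult_mono) auto
  finally have b: "w y * norm (grad y) \<le> u * v + K3 * u * r"
    by (simp add: K3_def algebra_simps)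
  define p where "p = u * v"
  define z where "z = K3 * u * r"
  have "(w y * norm (grad y))\<^sup>2 \<le> (p + z)\<^sup>2"
    using b w_ge_1[of y] by (intro power_mono) (auto simp: p_def z_def)
  also have "\<dots> = p\<^sup>2 + 2 * p * z + z\<^sup>2"
    by (simp add: power2_sum)
  also have "2 * p * z \<le> \<epsilon> * p\<^sup>2 + (1 / \<epsilon>) * z\<^sup>2"
  proof -
    have "0 \<le> (\<epsilon> * p - z)\<^sup>2 / \<epsilon>"
      using assms by (intro divide_nonneg_pos) auto
    also have "\<dots> = \<epsilon> * p\<^sup>2 + (1 / \<epsilon>) * z\<^sup>2 - 2 * p * z"
      using assms by (simp add: power2_diff field_simps power2_eq_square)
    finally show ?thesis by simp
  qed
  finally have "(w y * norm (grad y))\<^sup>2 \<le> (1 + \<epsilon>) * p\<^sup>2 + (1 + 1 / \<epsilon>) * z\<^sup>2"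
    by (simp add: algebra_simps)
  moreover have "z\<^sup>2 = K3\<^sup>2 * u\<^sup>2 * noise_ratio H S"
    using assms by (simp add: z_def r_def power_mult_distrib noise_ratio_nonneg)
  ultimately show ?thesis
    by (simp add: y_def p_def u_def v_def algebra_simps)
qed

end

section \<open>A Lyapunov function\<close>

locale adagrad_noise = adagrad_smooth +
  fixes \<sigma>0 \<sigma>1 :: real
  assumes sigma0: "\<sigma>0 \<ge> 0" and sigma1: "\<sigma>1 \<ge> 0"
begin

text \<open>
A bound for the conditional second moment of the noise.  The additional \<open>1\<close> makes it a legitimate divisor even where that
moment vanishes.
\<close>

definition q :: "'a \<Rightarrow> real" where "q x = \<sigma>0 * (norm (grad x))\<^sup>2 + \<sigma>1 + 1"

lemma q_ge_1: "1 \<le> q x"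
  using sigma0 sigma1 by (simp add: q_def)

lemma q_borel [measurable]: "q \<in> borel_measurable borel"
  unfolding q_def[abs_def] by measurable

text \<open>
The factor that the correlation between noise and step size puts in front of the potential \<open>(w v)\<^sup>2\<close>.
\<close>

definition corr_coeff :: real where "corr_coeff = 3 * \<alpha> / 2 * \<sigma>0"

lemma corr_coeff_nonneg: "corr_coeff \<ge> 0"
  using alpha_pos sigma0 by (simp add: corr_coeff_def)

definition lyapunov :: "'a \<Rightarrow> real \<Rightarrow> real" where
  "lyapunov x S = (w x) ^ 3 / sqrt S + corr_coeff * ((w x * norm (grad x))\<^sup>2 / S)"

lemma lyapunov_nonneg: "S > 0 \<Longrightarrow> 0 \<le> lyapunov x S"
  using w_ge_1[of x] corr_coeff_nonneg by (simp add: lyapunov_def)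

text \<open>
This is how the cube released by the decreasing weight absorbs lower powers, also when these are taken at the neighbouring point.
\<close>

lemma square_minus_cube_le:
  fixes b y z :: real
  assumes "0 \<le> b" "0 \<le> y" "0 \<le> z" "z \<le> k * y" "k \<ge> 0"
  shows "b * z\<^sup>2 - y ^ 3 \<le> (b * k\<^sup>2) ^ 3"
proof -
  define m where "m = b * k\<^sup>2"
  have m: "0 \<le> m" using assms by (simp add: m_def)
  have "b * z\<^sup>2 \<le> b * (k * y)\<^sup>2"
    using assms by (intro mult_left_mono power_mono) auto
  also have "\<dots> = m * y\<^sup>2" by (simp add: m_def power_mult_distrib)
  finally have 1: "b * z\<^sup>2 \<le> m * y\<^sup>2" .
  show ?thesis
  proof (cases "y \<le> m")
    case True
    have "m * y\<^sup>2 \<le> m * m\<^sup>2"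
      using True assms m by (intro mult_left_mono power_mono) auto
    also have "\<dots> = m ^ 3" by (simp add: power3_eq_cube power2_eq_square)
    finally have "b * z\<^sup>2 \<le> m ^ 3" using 1 by linarith
    moreover have "0 \<le> y ^ 3" using assms by simp
    ultimately show ?thesis unfolding m_def[symmetric] by linarith
  next
    case False
    have "m * y\<^sup>2 \<le> y * y\<^sup>2"
      using False by (intro mult_right_mono) auto
    moreover have "0 \<le> m ^ 3" using m by simp
    moreover have "y * y\<^sup>2 = y ^ 3" by (simp add: power3_eq_cube power2_eq_square)
    ultimately show ?thesis using 1 unfolding m_def[symmetric] by linarith
  qed
qed

text \<open>
Replacing \<open>H\<close> by its conditional mean and the square of its norm by the bound \<open>q x\<close> turns the three terms in
the middle into \<open>- 3 \<alpha> + 3 \<alpha> / 2 + \<alpha> / 2 = - \<alpha>\<close> times \<open>(w x)\<^sup>2 * (norm (grad x))\<^sup>2 / S\<close>.  The correlation between \<open>H\<close> and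
\<open>S + (norm H)\<^sup>2\<close> is estimated pathwise by Young's inequality; the weight \<open>q x\<close>, known before the step, balances the two
resulting terms.
\<close>

lemma lyapunov_step:
  obtains C where "C \<ge> 0"
    "\<And>x H S. S \<ge> S0 \<Longrightarrow>
      lyapunov (step x H S) (S + (norm H)\<^sup>2) \<le> lyapunov x S
        - 3 * \<alpha> * (w x)\<^sup>2 / S * (grad x \<bullet> H)
        + 3 * \<alpha> / 2 * ((w x)\<^sup>2 * (norm (grad x))\<^sup>2 / (q x * S)) * (norm H)\<^sup>2
        + \<alpha> / 2 * ((w x)\<^sup>2 * (norm (grad x))\<^sup>2 / S) + C * step_decay H S"
proof -
  define \<epsilon> where "\<epsilon> = \<alpha> / (2 * (corr_coeff + 1))"
  have \<epsilon>: "\<epsilon> > 0" "corr_coeff * \<epsilon> \<le> \<alpha> / 2"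
    using alpha_pos corr_coeff_nonneg by (auto simp: \<epsilon>_def field_simps)
  define K4 where "K4 = (1 + 1 / \<epsilon>) * K3\<^sup>2"
  have K4: "K4 \<ge> 0" using \<epsilon> by (simp add: K4_def)
  define E where "E = 3 * \<alpha> / 2 * (\<sigma>1 + 1) / sqrt S0"
  define C2 where "C2 = 2 * C1 + E + corr_coeff * K4 * 2 / sqrt S0"
  have C2: "C2 \<ge> 0"
    using C1_pos alpha_pos sigma1 S0_pos corr_coeff_nonneg K4 by (simp add: C2_def E_def)
  show thesis
  proof (rule that[of "(C2 * (1 + K)\<^sup>2) ^ 3"])
    show "(C2 * (1 + K)\<^sup>2) ^ 3 \<ge> 0" using C2 by simp
    fix x H :: 'a and S :: real
    assume S: "S \<ge> S0"
    define a s where "a = sqrt S" and "s = sqrt (S + (norm H)\<^sup>2)"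
    define u v h D \<Gamma> y Q where "u = w x" and "v = norm (grad x)" and "h = norm H"
      and "D = step_decay H S" and "\<Gamma> = noise_ratio H S" and "y = step x H S" and "Q = q x"
    have S_pos: "S > 0" using S S0_pos by simp
    have sa: "sqrt S0 > 0" "sqrt S0 \<le> a" "0 < a" "a \<le> s" "0 < s" "a\<^sup>2 = S" "s\<^sup>2 = S + (norm H)\<^sup>2"
      using S S0_pos by (auto simp: a_def s_def add_pos_nonneg)
    have D_eq: "D = 1 / a - 1 / s" by (simp add: D_def step_decay_def a_def s_def)
    have D: "0 \<le> D" "a * D \<le> 1"
      using S_pos by (auto simp: D_def step_decay_nonneg a_def sqrt_S_step_decay_le_1)
    have \<Gamma>D: "\<Gamma> / a \<le> 2 * D" using noise_ratio_le_step_decay[OF S_pos] by (simp add: \<Gamma>_def a_def D_def)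
    have \<Gamma>: "0 \<le> \<Gamma>" using S_pos by (simp add: \<Gamma>_def noise_ratio_nonneg)
    have u: "1 \<le> u" and v: "0 \<le> v" and h: "0 \<le> h" and Q: "1 \<le> Q"
      by (auto simp: u_def v_def h_def Q_def w_ge_1 q_ge_1)
    have vh: "\<bar>grad x \<bullet> H\<bar> \<le> v * h"
      unfolding v_def h_def by (rule Cauchy_Schwarz_ineq2)
    \<comment> \<open>The term \<open>(w y) ^ 3 * D\<close> split off first is the gain; the correlation term is kept as a multiple of \<open>(u * v)\<^sup>2\<close>.\<close>
    have "(w y) ^ 3 / s = (w y) ^ 3 / a - (w y) ^ 3 * D"
      by (simp add: D_eq algebra_simps)
    also have "(w y) ^ 3 / a \<le> (u ^ 3 - 3 * \<alpha> * u\<^sup>2 * (grad x \<bullet> H) / s + C1 * u\<^sup>2 * \<Gamma>) / a"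
      using w_cube_step[OF S_pos, of x H] sa
      by (intro divide_right_mono) (auto simp: y_def u_def s_def \<Gamma>_def)
    also have "\<dots> = u ^ 3 / a - 3 * \<alpha> * u\<^sup>2 / S * (grad x \<bullet> H)
        + 3 * \<alpha> * u\<^sup>2 * ((grad x \<bullet> H) * D / a) + C1 * u\<^sup>2 * (\<Gamma> / a)"
    proof -
      have "1 / (s * a) = 1 / S - D / a"
        using sa by (simp add: D_eq field_simps power2_eq_square flip: \<open>a\<^sup>2 = S\<close>)
      then have "(3 * \<alpha> * u\<^sup>2 * (grad x \<bullet> H)) * (1 / (s * a)) = (3 * \<alpha> * u\<^sup>2 * (grad x \<bullet> H)) * (1 / S - D / a)"
        by simp
      then show ?thesis
        by (simp add: add_divide_distrib diff_divide_distrib right_diff_distrib)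
    qed
    also have "C1 * u\<^sup>2 * (\<Gamma> / a) \<le> C1 * u\<^sup>2 * (2 * D)"
      using \<Gamma>D C1_pos by (intro mult_left_mono) auto
    also have "3 * \<alpha> * u\<^sup>2 * ((grad x \<bullet> H) * D / a)
        \<le> 3 * \<alpha> * u\<^sup>2 * (v\<^sup>2 / (2 * Q * S) * h\<^sup>2 + Q * D / (2 * a))"
    proof (rule mult_left_mono)
      have "(grad x \<bullet> H) * D \<le> (v * h) * D"
        using vh D by (intro mult_right_mono) auto
      moreover have "v * h * D \<le> (v * h)\<^sup>2 / (2 * Q * a) + Q * a * D\<^sup>2 / 2"
      proof -
        have "0 \<le> (v * h - Q * a * D)\<^sup>2 / (2 * Q * a)"
          using sa Q by (intro divide_nonneg_pos) auto
        also have "\<dots> = (v * h)\<^sup>2 / (2 * Q * a) + Q * a * D\<^sup>2 / 2 - v * h * D"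
          using sa Q by (simp add: power2_diff field_simps power2_eq_square)
        finally show ?thesis by simp
      qed
      moreover have "Q * a * D\<^sup>2 / 2 \<le> Q * D / 2"
      proof -
        have "Q * D * (a * D) \<le> Q * D * 1"
          using D Q by (intro mult_left_mono) auto
        then show ?thesis by (simp add: power2_eq_square algebra_simps)
      qed
      ultimately have "(grad x \<bullet> H) * D \<le> (v * h)\<^sup>2 / (2 * Q * a) + Q * D / 2"
        by linarith
      then have "(grad x \<bullet> H) * D / a \<le> ((v * h)\<^sup>2 / (2 * Q * a) + Q * D / 2) / a"
        using sa by (intro divide_right_mono) auto
      also have "\<dots> = v\<^sup>2 / (2 * Q * S) * h\<^sup>2 + Q * D / (2 * a)"
        using sa Q by (simp add: power2_eq_square field_simps flip: \<open>a\<^sup>2 = S\<close>)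
      finally show "(grad x \<bullet> H) * D / a \<le> v\<^sup>2 / (2 * Q * S) * h\<^sup>2 + Q * D / (2 * a)" .
    qed (use alpha_pos in auto)
    also have "3 * \<alpha> * u\<^sup>2 * (v\<^sup>2 / (2 * Q * S) * h\<^sup>2 + Q * D / (2 * a))
        = 3 * \<alpha> / 2 * (u\<^sup>2 * v\<^sup>2 / (Q * S)) * h\<^sup>2 + corr_coeff * (u * v)\<^sup>2 * (D / a)
          + 3 * \<alpha> / 2 * (\<sigma>1 + 1) * u\<^sup>2 * (D / a)"
    proof -
      have "3 * \<alpha> * u\<^sup>2 * (Q * D / (2 * a)) = 3 * \<alpha> / 2 * u\<^sup>2 * Q * (D / a)"
        by simp
      also have "\<dots> = corr_coeff * (u * v)\<^sup>2 * (D / a) + 3 * \<alpha> / 2 * (\<sigma>1 + 1) * u\<^sup>2 * (D / a)"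
        unfolding Q_def q_def corr_coeff_def v_def[symmetric]
        by (simp add: algebra_simps power_mult_distrib add_divide_distrib)
      finally show ?thesis by (simp add: distrib_left)
    qed
    also have "3 * \<alpha> / 2 * (\<sigma>1 + 1) * u\<^sup>2 * (D / a) \<le> 3 * \<alpha> / 2 * (\<sigma>1 + 1) * u\<^sup>2 * (D / sqrt S0)"
      using alpha_pos sigma1 sa D by (intro mult_left_mono divide_left_mono) auto
    also have "3 * \<alpha> / 2 * (\<sigma>1 + 1) * u\<^sup>2 * (D / sqrt S0) = E * u\<^sup>2 * D"
      by (simp add: E_def)
    finally have cubic: "(w y) ^ 3 / s \<le> u ^ 3 / a - 3 * \<alpha> * u\<^sup>2 / S * (grad x \<bullet> H)
        + 3 * \<alpha> / 2 * (u\<^sup>2 * v\<^sup>2 / (Q * S)) * h\<^sup>2 + corr_coeff * (u * v)\<^sup>2 * (D / a)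
        + (2 * C1 + E) * u\<^sup>2 * D - (w y) ^ 3 * D"
      by (simp add: algebra_simps)
    \<comment> \<open>The decay of \<open>1 / S\<close> dominates \<open>D / sqrt S\<close> and thus pays for the correlation term.\<close>
    define P where "P = (u * v)\<^sup>2"
    have "D / a \<le> 1 / a\<^sup>2 - 1 / s\<^sup>2"
    proof -
      have "1 / a\<^sup>2 - 1 / s\<^sup>2 = D * (1 / a + 1 / s)"
        by (simp add: D_eq algebra_simps power2_eq_square)
      moreover have "D * (1 / a) \<le> D * (1 / a + 1 / s)"
        using D sa by (intro mult_left_mono) auto
      ultimately show ?thesis by simp
    qed
    then have "P * (D / a) \<le> P * (1 / a\<^sup>2 - 1 / s\<^sup>2)"
      by (intro mult_left_mono) (auto simp: P_def)
    then have PD: "P * (D / a) \<le> P / a\<^sup>2 - P / s\<^sup>2"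
      by (simp add: right_diff_distrib)
    have "(w y * norm (grad y))\<^sup>2 / s\<^sup>2 \<le> ((1 + \<epsilon>) * P + K4 * u\<^sup>2 * \<Gamma>) / s\<^sup>2"
      using weighted_grad_step[OF S_pos \<epsilon>(1), of x H]
      by (intro divide_right_mono) (auto simp: y_def P_def u_def v_def \<Gamma>_def K4_def)
    also have "\<dots> = P / s\<^sup>2 + \<epsilon> * (P / s\<^sup>2) + K4 * u\<^sup>2 * (\<Gamma> / s\<^sup>2)"
      by (simp add: add_divide_distrib distrib_right)
    also have "\<epsilon> * (P / s\<^sup>2) \<le> \<epsilon> * (P / a\<^sup>2)"
    proof (intro mult_left_mono frac_le power_mono zero_less_power)
      show "0 \<le> P" by (simp add: P_def)
    qed (use \<epsilon> sa in auto)
    also have "K4 * u\<^sup>2 * (\<Gamma> / s\<^sup>2) \<le> K4 * u\<^sup>2 * (2 * D / sqrt S0)"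
    proof (intro mult_left_mono)
      have "\<Gamma> / s\<^sup>2 \<le> \<Gamma> / (a * sqrt S0)"
        unfolding power2_eq_square using sa \<Gamma> by (intro divide_left_mono mult_mono) auto
      also have "\<dots> = \<Gamma> / a / sqrt S0" by simp
      also have "\<dots> \<le> 2 * D / sqrt S0"
        using \<Gamma>D sa by (intro divide_right_mono) auto
      finally show "\<Gamma> / s\<^sup>2 \<le> 2 * D / sqrt S0" .
    qed (use K4 in auto)
    finally have "P * (D / a) + (w y * norm (grad y))\<^sup>2 / s\<^sup>2
        \<le> P / a\<^sup>2 + \<epsilon> * (P / a\<^sup>2) + K4 * u\<^sup>2 * (2 * D / sqrt S0)"
      using PD by linarith
    then have "corr_coeff * (P * (D / a) + (w y * norm (grad y))\<^sup>2 / s\<^sup>2)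
        \<le> corr_coeff * (P / a\<^sup>2 + \<epsilon> * (P / a\<^sup>2) + K4 * u\<^sup>2 * (2 * D / sqrt S0))"
      using corr_coeff_nonneg by (rule mult_left_mono)
    moreover have "(corr_coeff * \<epsilon>) * (P / a\<^sup>2) \<le> \<alpha> / 2 * (P / a\<^sup>2)"
      using \<epsilon> by (intro mult_right_mono) (auto simp: P_def)
    ultimately have gradient: "corr_coeff * (u * v)\<^sup>2 * (D / a) + corr_coeff * ((w y * norm (grad y))\<^sup>2 / s\<^sup>2)
        \<le> corr_coeff * ((u * v)\<^sup>2 / a\<^sup>2) + \<alpha> / 2 * (u\<^sup>2 * v\<^sup>2 / S) + corr_coeff * K4 * 2 / sqrt S0 * u\<^sup>2 * D"
      unfolding P_def sa(6) by (simp add: algebra_simps power_mult_distrib)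
    \<comment> \<open>All errors of size \<open>u\<^sup>2 * D\<close> are absorbed by the gain.\<close>
    have "C2 * u\<^sup>2 - (w y) ^ 3 \<le> (C2 * (1 + K)\<^sup>2) ^ 3"
      using w_le_w_step[OF S_pos, of x H] w_ge_1[of y] u K_pos C2
      by (intro square_minus_cube_le) (auto simp: u_def y_def)
    then have "(C2 * u\<^sup>2 - (w y) ^ 3) * D \<le> (C2 * (1 + K)\<^sup>2) ^ 3 * D"
      using D by (intro mult_right_mono) auto
    then have "(2 * C1 + E) * u\<^sup>2 * D + corr_coeff * K4 * 2 / sqrt S0 * u\<^sup>2 * D
        - (w y) ^ 3 * D \<le> (C2 * (1 + K)\<^sup>2) ^ 3 * D"
      by (simp add: C2_def algebra_simps)
    with cubic gradient have "(w y) ^ 3 / s + corr_coeff * ((w y * norm (grad y))\<^sup>2 / s\<^sup>2) \<le>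
        u ^ 3 / a + corr_coeff * ((u * v)\<^sup>2 / a\<^sup>2) - 3 * \<alpha> * u\<^sup>2 / S * (grad x \<bullet> H)
        + 3 * \<alpha> / 2 * (u\<^sup>2 * v\<^sup>2 / (Q * S)) * h\<^sup>2
        + \<alpha> / 2 * (u\<^sup>2 * v\<^sup>2 / S) + (C2 * (1 + K)\<^sup>2) ^ 3 * D"
      by linarith
    then show "lyapunov (step x H S) (S + (norm H)\<^sup>2) \<le> lyapunov x S
        - 3 * \<alpha> * (w x)\<^sup>2 / S * (grad x \<bullet> H)
        + 3 * \<alpha> / 2 * ((w x)\<^sup>2 * (norm (grad x))\<^sup>2 / (q x * S)) * (norm H)\<^sup>2
        + \<alpha> / 2 * ((w x)\<^sup>2 * (norm (grad x))\<^sup>2 / S) + (C2 * (1 + K)\<^sup>2) ^ 3 * step_decay H S"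
      using sa(6,7) unfolding lyapunov_def u_def v_def h_def D_def Q_def y_def a_def s_def by simp
  qed
qed

end

section \<open>Convergence of a single trajectory\<close>

context adagrad_smooth
begin

definition K5 :: real where "K5 = \<alpha> * sqrt (2 * L) + L * \<alpha>\<^sup>2 / 2"

lemma K5_pos: "K5 > 0"
  using alpha_pos L_pos by (simp add: K5_def add_pos_pos)

lemma norm_grad_le_w: "norm (grad x) \<le> sqrt (2 * L) * (w x)"
proof -
  have "sqrt (w x) \<le> w x"
    using w_ge_1[of x] by (simp add: real_le_lsqrt power2_eq_square)
  then have "sqrt (2 * L) * sqrt (w x) \<le> sqrt (2 * L) * w x"
    using L_pos by (intro mult_left_mono) auto
  then show ?thesis using norm_grad_le[of x] by linarith
qed

lemma inverse_sqrt_next: "1 / sqrt (S + (norm H)\<^sup>2) = 1 / sqrt S - step_decay H S"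
  by (simp add: step_decay_def)

lemma noise_step_decay_bound:
  assumes "S > 0"
  shows "grad x \<bullet> H * step_decay H S \<le> sqrt (2 * L) * ((w x) * (norm H)\<^sup>2 / S)"
proof -
  have "grad x \<bullet> H * step_decay H S \<le> (norm (grad x) * norm H) * step_decay H S"
    using step_decay_nonneg[OF assms] by (intro mult_right_mono norm_cauchy_schwarz)
  also have "\<dots> \<le> norm (grad x) * ((norm H)\<^sup>2 / S)"
    unfolding mult.assoc by (intro mult_left_mono norm_step_decay_le assms) auto
  also have "\<dots> \<le> (sqrt (2 * L) * (w x)) * ((norm H)\<^sup>2 / S)"
    using assms by (intro mult_right_mono norm_grad_le_w) auto
  finally show ?thesis by simp
qed

text \<open>
A version of the descent estimate in which the step size is known before the step.  Its error, unlike
\<open>step_decay\<close>, is summable only along times at which the gradient is bounded away from zero.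
\<close>

lemma g_step_le_noise:
  assumes "S > 0"
  shows "g (step x H S) \<le> g x - \<alpha> * (grad x \<bullet> H) / sqrt S + K5 * (w x * (norm H)\<^sup>2 / S)"
proof -
  have "g (step x H S) \<le> g x - \<alpha> * (grad x \<bullet> H) * (1 / sqrt (S + (norm H)\<^sup>2)) + L * \<alpha>\<^sup>2 / 2 * noise_ratio H S"
    using g_step_le[OF assms, of x H] by simp
  also have "\<dots> = g x - \<alpha> * (grad x \<bullet> H) / sqrt S + \<alpha> * (grad x \<bullet> H * step_decay H S) + L * \<alpha>\<^sup>2 / 2 * noise_ratio H S"
    unfolding inverse_sqrt_next by (simp add: algebra_simps)
  also have "\<alpha> * (grad x \<bullet> H * step_decay H S) \<le> \<alpha> * (sqrt (2 * L) * (w x * (norm H)\<^sup>2 / S))"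
    using alpha_pos by (intro mult_left_mono noise_step_decay_bound[OF assms]) auto
  also have "L * \<alpha>\<^sup>2 / 2 * noise_ratio H S \<le> L * \<alpha>\<^sup>2 / 2 * (w x * (norm H)\<^sup>2 / S)"
  proof (intro mult_left_mono order_trans[OF noise_ratio_le_ratio[OF assms]])
    have "1 * (norm H)\<^sup>2 / S \<le> w x * (norm H)\<^sup>2 / S"
      using assms w_ge_1[of x] by (intro divide_right_mono mult_right_mono) auto
    then show "(norm H)\<^sup>2 / S \<le> w x * (norm H)\<^sup>2 / S" by simp
  qed (use L_pos in auto)
  finally show ?thesis
    by (simp add: K5_def algebra_simps)
qed

lemma g_step_le_martingale:
  assumes "S > 0"
  shows "g (step x H S) \<le> g x - \<alpha> * ((norm (grad x))\<^sup>2 / sqrt S)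
    + \<alpha> * (1 / sqrt S * (grad x \<bullet> (grad x - H))) + K5 * (w x * (norm H)\<^sup>2 / S)"
  using g_step_le_noise[OF assms, of x H]
  by (simp add: algebra_simps diff_divide_distrib inner_diff_right dot_square_norm)

lemma step_decomposition:
  assumes "S > 0"
  shows "norm (step x H S - x - (\<alpha> / sqrt S) *\<^sub>R (grad x - H) + (\<alpha> / sqrt S) *\<^sub>R grad x)
    \<le> \<alpha> * (w x * (norm H)\<^sup>2 / S)"
proof -
  have "\<alpha> / sqrt (S + (norm H)\<^sup>2) = \<alpha> / sqrt S - \<alpha> * step_decay H S"
    by (simp add: step_decay_def right_diff_distrib)
  then have "step x H S - x = (\<alpha> * step_decay H S) *\<^sub>R H - (\<alpha> / sqrt S) *\<^sub>R H"
    unfolding step_def by (simp add: scaleR_left_diff_distrib)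
  then have "step x H S - x - (\<alpha> / sqrt S) *\<^sub>R (grad x - H) + (\<alpha> / sqrt S) *\<^sub>R grad x = (\<alpha> * step_decay H S) *\<^sub>R H"
    by (simp add: scaleR_right_diff_distrib)
  then have "norm (step x H S - x - (\<alpha> / sqrt S) *\<^sub>R (grad x - H) + (\<alpha> / sqrt S) *\<^sub>R grad x)
      = \<alpha> * (norm H * step_decay H S)"
    using alpha_pos step_decay_nonneg[OF assms] by (simp add: abs_mult)
  also have "\<dots> \<le> \<alpha> * ((norm H)\<^sup>2 / S)"
    using alpha_pos norm_step_decay_le[OF assms] by (intro mult_left_mono) auto
  also have "\<dots> \<le> \<alpha> * (w x * (norm H)\<^sup>2 / S)"
  proof -
    have "1 * (norm H)\<^sup>2 / S \<le> w x * (norm H)\<^sup>2 / S"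
      using assms w_ge_1[of x] by (intro divide_right_mono mult_right_mono) auto
    then show ?thesis using alpha_pos by (intro mult_left_mono) auto
  qed
  finally show ?thesis .
qed

text \<open>
Coercivity makes the band of points with \<open>a \<le> g y \<le> b\<close> compact, so that the absence of critical points in it
bounds the gradient from below.
\<close>

lemma critical_gap:
  assumes coercive: "filterlim g at_top at_infinity"
    and nowhere: "interior (closure {g x | x. grad x = 0}) = {}"
    and "l < u"
  obtains a b \<nu> where "l < a" "a < b" "b < u" "\<nu> > 0"
    "\<And>y. a \<le> g y \<Longrightarrow> g y \<le> b \<Longrightarrow> \<nu> \<le> (norm (grad y))\<^sup>2"
proof -
  let ?C = "{g x | x. grad x = 0}"
  have "\<not> {l<..<u} \<subseteq> closure ?C"
    using interior_maximal[of "{l<..<u}" "closure ?C"] nowhere \<open>l < u\<close> by auto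
  then obtain p where p: "l < p" "p < u" "p \<in> - closure ?C"
    by (meson ComplI greaterThanLessThan_iff subsetI)
  define X where "X = - closure ?C \<inter> {l<..<u}"
  have "open X" unfolding X_def by (intro open_Int) auto
  moreover have "p \<in> X" using p by (simp add: X_def)
  ultimately obtain e where e: "e > 0" "cball p e \<subseteq> - closure ?C \<inter> {l<..<u}"
    using open_contains_cball[of X] unfolding X_def[symmetric] by blast
  define a b where "a = p - e" and "b = p + e"
  have ab: "{a..b} \<subseteq> - closure ?C \<inter> {l<..<u}"
    using e by (simp add: cball_eq_atLeastAtMost a_def b_def)
  have "a < b" using e by (simp add: a_def b_def)
  then have "a \<in> {a..b}" "b \<in> {a..b}" by auto
  then have lu: "l < a" "b < u" using subsetD[OF ab, of a] subsetD[OF ab, of b] by simp_all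
  define Y where "Y = {y. a \<le> g y \<and> g y \<le> b}"
  have "closed (g -` {a..b})"
    using continuous_on_closed_vimage[of UNIV g] continuous_on_g by auto
  moreover have "g -` {a..b} = Y" by (auto simp: Y_def)
  ultimately have "closed Y" by simp
  have "eventually (\<lambda>y. g y > b) at_infinity"
    using coercive by (simp add: filterlim_at_top_dense)
  then obtain R where R: "\<And>y. R \<le> norm y \<Longrightarrow> g y > b"
    by (auto simp: eventually_at_infinity)
  have "bounded Y"
    unfolding bounded_iff
  proof (intro exI ballI)
    fix y assume "y \<in> Y"
    then have "g y \<le> b" by (simp add: Y_def)
    then have "\<not> R \<le> norm y" using R[of y] by linarith
    then show "norm y \<le> R" by simp
  qed
  with \<open>closed Y\<close> have "compact Y" by (simp add: compact_eq_bounded_closed)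
  show thesis
  proof (cases "Y = {}")
    case True
    show ?thesis
      by (rule that[OF lu(1) \<open>a < b\<close> lu(2), of 1]) (use True in \<open>auto simp: Y_def\<close>)
  next
    case False
    have "continuous_on Y (\<lambda>y. (norm (grad y))\<^sup>2)"
      by (intro continuous_intros continuous_on_subset[OF continuous_on_grad]) auto
    then obtain y0 where y0: "y0 \<in> Y" "\<And>y. y \<in> Y \<Longrightarrow> (norm (grad y0))\<^sup>2 \<le> (norm (grad y))\<^sup>2"
      using continuous_attains_inf[OF \<open>compact Y\<close> False] by blast
    have "grad y0 \<noteq> 0"
    proof
      assume "grad y0 = 0"
      then have "g y0 \<in> closure ?C" by (intro closure_subset[THEN subsetD]) auto
      moreover have "g y0 \<in> {a..b}" using y0 by (auto simp: Y_def)
      ultimately show False using subsetD[OF ab, of "g y0"] by simp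
    qed
    then show ?thesis
      by (intro that[OF lu(1) \<open>a < b\<close> lu(2), of "(norm (grad y0))\<^sup>2"] y0) (auto simp: Y_def)
  qed
qed

end

text \<open>
If the lower and the upper limit differed, a gap between them would be crossed infinitely often; the last two
hypotheses exclude infinite limits.
\<close>

lemma real_convergent_if_gaps_not_crossed:
  fixes f :: "nat \<Rightarrow> real"
  assumes gaps: "\<And>l u. l < u \<Longrightarrow> \<exists>a b. l < a \<and> a < b \<and> b < u \<and>
      (eventually (\<lambda>n. a \<le> f n) sequentially \<or> eventually (\<lambda>n. f n \<le> b) sequentially)"
    and below: "\<And>n. 0 \<le> f n"
    and freq: "frequently (\<lambda>n. f n \<le> B) sequentially"
  shows "convergent f"
proof -
  let ?f = "\<lambda>n. ereal (f n)"
  have "limsup ?f \<le> liminf ?f"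
  proof (rule ccontr)
    assume "\<not> limsup ?f \<le> liminf ?f"
    then have "liminf ?f < limsup ?f" by simp
    then obtain l where l: "liminf ?f < ereal l" "ereal l < limsup ?f"
      using ereal_dense2 by blast
    then obtain u where u: "ereal l < ereal u" "ereal u < limsup ?f"
      using ereal_dense2 by blast
    then obtain a b where ab: "l < a" "a < b" "b < u"
      "eventually (\<lambda>n. a \<le> f n) sequentially \<or> eventually (\<lambda>n. f n \<le> b) sequentially"
      using gaps[of l u] by auto
    from ab(4) show False
    proof
      assume "eventually (\<lambda>n. a \<le> f n) sequentially"
      then have "ereal a \<le> liminf ?f" by (intro Liminf_bounded) auto
      also have "\<dots> < ereal l" by (rule l)
      finally show False using ab by simp
    next
      assume "eventually (\<lambda>n. f n \<le> b) sequentially"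
      then have "limsup ?f \<le> ereal b" by (intro Limsup_bounded) auto
      then have "ereal u < ereal b" using u by (rule_tac less_le_trans) auto
      then show False using ab by simp
    qed
  qed
  then have eq: "liminf ?f = limsup ?f"
    using Liminf_le_Limsup[of sequentially ?f] by auto
  have "0 \<le> liminf ?f" using below by (intro Liminf_bounded) auto
  moreover have "liminf ?f \<le> ereal B"
  proof (rule ccontr)
    assume "\<not> ?thesis"
    then have "eventually (\<lambda>n. ereal B < ?f n) sequentially"
      by (intro less_LiminfD) auto
    then show False using freq by (simp add: frequently_def not_le)
  qed
  ultimately obtain r where "liminf ?f = ereal r"
    by (cases "liminf ?f") auto
  then have "?f \<longlonglongrightarrow> ereal r"
    using eq by (intro Liminf_eq_Limsup) auto
  then show ?thesis by (auto simp: convergent_def)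
qed

text \<open>
A single trajectory with the summability properties that hold almost surely.  Only the levels \<open>1 / (k + 1)\<close> occur in
the last three of these, since the exceptional null sets of countably many levels can be combined.
\<close>

locale adagrad_trajectory = adagrad_smooth +
  fixes x H :: "nat \<Rightarrow> 'a" and S :: "nat \<Rightarrow> real" and D0 D1 :: real
  assumes x_Suc: "x (Suc n) = step (x n) (H n) (S n)"
    and S_Suc: "S (Suc n) = S n + (norm (H n))\<^sup>2"
    and S_0: "S 0 = S0"
    and D0_pos: "D0 > 0"
    and bounded_noise: "(norm (grad (x n)))\<^sup>2 < D0 \<Longrightarrow> (norm (H n))\<^sup>2 < D1"
    and grad_summable: "summable (\<lambda>n. (norm (grad (x n)))\<^sup>2 / S n)"
    and level_noise_summable: "summable (\<lambda>n. of_bool (inverse (real (Suc k)) \<le> (norm (grad (x n)))\<^sup>2)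
      * (w (x n) * (norm (H n))\<^sup>2 / S n))"
    and mart_summable: "summable (\<lambda>n. of_bool (inverse (real (Suc k)) \<le> (norm (grad (x n)))\<^sup>2)
      * (1 / sqrt (S n) * (grad (x n) \<bullet> (grad (x n) - H n))))"
    and vec_mart_summable: "summable (\<lambda>n. (of_bool (inverse (real (Suc k)) \<le> (norm (grad (x n)))\<^sup>2)
      / sqrt (S n)) *\<^sub>R (grad (x n) - H n))"
    and coercive: "filterlim g at_top at_infinity"
    and nowhere: "interior (closure {g x | x. grad x = 0}) = {}"
    and small_grad_bounded: "\<exists>\<eta>>0. \<exists>B. \<forall>y. (norm (grad y))\<^sup>2 < \<eta> \<longrightarrow> g y \<le> B"
begin

lemma S_ge: "S0 \<le> S n"
  by (induction n) (auto simp: S_0 S_Suc intro: add_increasing2)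

lemma S_pos: "S n > 0"
  using S_ge[of n] S0_pos by linarith

lemma S_mono: "m \<le> n \<Longrightarrow> S m \<le> S n"
  by (rule lift_Suc_mono_le[of S]) (auto simp: S_Suc)

lemma noise_summable:
  assumes "\<nu> > 0"
  shows "summable (\<lambda>n. of_bool (\<nu> \<le> (norm (grad (x n)))\<^sup>2) * (w (x n) * (norm (H n))\<^sup>2 / S n))"
proof -
  obtain k where k: "inverse (real (Suc k)) < \<nu>" using reals_Archimedean[OF assms] by blast
  show ?thesis
  proof (rule summable_comparison_test'[OF level_noise_summable[of k], of 0])
    fix n
    have "0 \<le> w (x n) * (norm (H n))\<^sup>2 / S n" using S_pos[of n] w_ge_1[of "x n"] by simp
    then show "norm (of_bool (\<nu> \<le> (norm (grad (x n)))\<^sup>2) * (w (x n) * (norm (H n))\<^sup>2 / S n))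
      \<le> of_bool (inverse (real (Suc k)) \<le> (norm (grad (x n)))\<^sup>2) * (w (x n) * (norm (H n))\<^sup>2 / S n)"
      using k by (cases "\<nu> \<le> (norm (grad (x n)))\<^sup>2") auto
  qed
qed

text \<open>
Along a late window of times at which the gradient is not small, the motion is that of the gradient flow up to an
arbitrarily small error, however long the window: noise and second order terms are tails of convergent series.
\<close>

lemma window_bounds:
  assumes "\<nu> > 0" "\<epsilon> > 0"
  shows "\<exists>N. \<forall>s t. N \<le> s \<longrightarrow> s \<le> t \<longrightarrow> (\<forall>k. s \<le> k \<longrightarrow> k < t \<longrightarrow> \<nu> \<le> (norm (grad (x k)))\<^sup>2) \<longrightarrow>
    g (x t) - g (x s) \<le> - \<alpha> * (\<Sum>k\<in>{s..<t}. (norm (grad (x k)))\<^sup>2 / sqrt (S k)) + \<epsilon> \<and>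
    norm (x t - x s) \<le> \<alpha> * (\<Sum>k\<in>{s..<t}. norm (grad (x k)) / sqrt (S k)) + \<epsilon>"
proof -
  obtain j where j: "inverse (real (Suc j)) < \<nu>" using reals_Archimedean[OF assms(1)] by blast
  define I :: "nat \<Rightarrow> real" where "I k = of_bool (inverse (real (Suc j)) \<le> (norm (grad (x k)))\<^sup>2)" for k
  define e where "e k = I k * (w (x k) * (norm (H k))\<^sup>2 / S k)" for k
  define m where "m k = I k * (1 / sqrt (S k) * (grad (x k) \<bullet> (grad (x k) - H k)))" for k
  define z where "z k = (I k / sqrt (S k)) *\<^sub>R (grad (x k) - H k)" for k
  define drift where "drift k = (\<alpha> / sqrt (S k)) *\<^sub>R grad (x k)" for k
  define err where "err k = x (Suc k) - x k - \<alpha> *\<^sub>R z k + drift k" for k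
  define \<delta> where "\<delta> = \<epsilon> / (2 * (\<alpha> + K5))"
  have "\<delta> > 0" using assms alpha_pos K5_pos by (simp add: \<delta>_def)
  have \<delta>: "\<alpha> * \<delta> + K5 * \<delta> \<le> \<epsilon>" "\<alpha> * \<delta> + \<alpha> * \<delta> \<le> \<epsilon>"
  proof -
    have "(\<alpha> + K5) * \<delta> = \<epsilon> / 2"
      using alpha_pos K5_pos by (simp add: \<delta>_def field_simps add_pos_pos add_eq_0_iff)
    moreover have "0 < K5 * \<delta>" using K5_pos \<open>\<delta> > 0\<close> by simp
    ultimately show "\<alpha> * \<delta> + K5 * \<delta> \<le> \<epsilon>" "\<alpha> * \<delta> + \<alpha> * \<delta> \<le> \<epsilon>"
      using assms by (auto simp: distrib_right)
  qed
  have "summable e" "summable m" "summable z"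
    unfolding e_def m_def z_def I_def
    using level_noise_summable[of j] mart_summable[of j] vec_mart_summable[of j] by simp_all
  then obtain N1 N2 N3 where N:
    "\<And>s t. s \<ge> N1 \<Longrightarrow> norm (sum e {s..<t}) < \<delta>"
    "\<And>s t. s \<ge> N2 \<Longrightarrow> norm (sum m {s..<t}) < \<delta>"
    "\<And>s t. s \<ge> N3 \<Longrightarrow> norm (sum z {s..<t}) < \<delta>"
    unfolding summable_Cauchy using \<open>\<delta> > 0\<close> by meson
  show ?thesis
  proof (rule exI[of _ "max N1 (max N2 N3)"], intro allI impI conjI)
    fix s t
    assume st: "max N1 (max N2 N3) \<le> s" "s \<le> t"
      and win: "\<forall>k. s \<le> k \<longrightarrow> k < t \<longrightarrow> \<nu> \<le> (norm (grad (x k)))\<^sup>2"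
    have I1: "I k = 1" if "k \<in> {s..<t}" for k
      using win that j by (fastforce simp: I_def)
    have "g (x t) - g (x s) = (\<Sum>k\<in>{s..<t}. g (x (Suc k)) - g (x k))"
      using sum_Suc_diff'[of s t "\<lambda>k. g (x k)"] st by simp
    also have "\<dots> \<le> (\<Sum>k\<in>{s..<t}. - \<alpha> * ((norm (grad (x k)))\<^sup>2 / sqrt (S k)) + \<alpha> * m k + K5 * e k)"
    proof (rule sum_mono)
      fix k assume "k \<in> {s..<t}"
      then show "g (x (Suc k)) - g (x k) \<le> - \<alpha> * ((norm (grad (x k)))\<^sup>2 / sqrt (S k)) + \<alpha> * m k + K5 * e k"
        using g_step_le_martingale[OF S_pos[of k], of "x k" "H k"] I1[of k]
        by (simp add: x_Suc m_def e_def)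
    qed
    also have "\<dots> = - \<alpha> * (\<Sum>k\<in>{s..<t}. (norm (grad (x k)))\<^sup>2 / sqrt (S k)) + \<alpha> * sum m {s..<t} + K5 * sum e {s..<t}"
      by (simp only: sum.distrib sum_distrib_left)
    also have "\<alpha> * sum m {s..<t} \<le> \<alpha> * \<delta>"
      using N(2)[of s t] st alpha_pos by (intro mult_left_mono) auto
    also have "K5 * sum e {s..<t} \<le> K5 * \<delta>"
      using N(1)[of s t] st K5_pos by (intro mult_left_mono) auto
    finally show "g (x t) - g (x s) \<le> - \<alpha> * (\<Sum>k\<in>{s..<t}. (norm (grad (x k)))\<^sup>2 / sqrt (S k)) + \<epsilon>"
      using \<delta> by linarith
    have "x t - x s = (\<Sum>k\<in>{s..<t}. x (Suc k) - x k)"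
      using sum_Suc_diff'[of s t x] st by simp
    also have "\<dots> = (\<Sum>k\<in>{s..<t}. err k - drift k) + \<alpha> *\<^sub>R sum z {s..<t}"
      by (simp add: err_def sum.distrib sum_subtractf scaleR_sum_right)
    finally have split: "x t - x s = (\<Sum>k\<in>{s..<t}. err k - drift k) + \<alpha> *\<^sub>R sum z {s..<t}" .
    have "norm (x t - x s) \<le> norm (\<Sum>k\<in>{s..<t}. err k - drift k) + norm (\<alpha> *\<^sub>R sum z {s..<t})"
      unfolding split by (rule norm_triangle_ineq)
    also have "norm (\<alpha> *\<^sub>R sum z {s..<t}) \<le> \<alpha> * \<delta>"
      using N(3)[of s t] st alpha_pos by simp
    also have "norm (\<Sum>k\<in>{s..<t}. err k - drift k) \<le> (\<Sum>k\<in>{s..<t}. \<alpha> * e k + \<alpha> * (norm (grad (x k)) / sqrt (S k)))"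
    proof (rule sum_norm_le)
      fix k assume k: "k \<in> {s..<t}"
      have "norm (err k) \<le> \<alpha> * e k"
        using step_decomposition[OF S_pos[of k], of "x k" "H k"] I1[OF k]
        by (simp add: err_def drift_def x_Suc z_def e_def)
      moreover have "norm (drift k) = \<alpha> * (norm (grad (x k)) / sqrt (S k))"
        using alpha_pos S_pos[of k] by (simp add: drift_def)
      ultimately show "norm (err k - drift k) \<le> \<alpha> * e k + \<alpha> * (norm (grad (x k)) / sqrt (S k))"
        using norm_triangle_ineq4[of "err k" "drift k"] by linarith
    qed
    also have "\<dots> = \<alpha> * sum e {s..<t} + \<alpha> * (\<Sum>k\<in>{s..<t}. norm (grad (x k)) / sqrt (S k))"
      by (simp only: sum.distrib sum_distrib_left)
    also have "\<alpha> * sum e {s..<t} \<le> \<alpha> * \<delta>"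
      using N(1)[of s t] st alpha_pos by (intro mult_left_mono) auto
    finally show "norm (x t - x s) \<le> \<alpha> * (\<Sum>k\<in>{s..<t}. norm (grad (x k)) / sqrt (S k)) + \<epsilon>"
      using \<delta> by linarith
  qed
qed

lemma grad_tendsto_if_S_bounded:
  assumes "\<And>n. S n \<le> B"
  shows "(\<lambda>n. (norm (grad (x n)))\<^sup>2) \<longlonglongrightarrow> 0"
proof (rule tendsto_sandwich[OF _ _ tendsto_const])
  show "(\<lambda>n. B * ((norm (grad (x n)))\<^sup>2 / S n)) \<longlonglongrightarrow> 0"
    using tendsto_mult_left[OF summable_LIMSEQ_zero[OF grad_summable], of B] by simp
  show "eventually (\<lambda>n. (norm (grad (x n)))\<^sup>2 \<le> B * ((norm (grad (x n)))\<^sup>2 / S n)) sequentially"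
  proof (intro always_eventually allI)
    fix n
    have "S n * ((norm (grad (x n)))\<^sup>2 / S n) \<le> B * ((norm (grad (x n)))\<^sup>2 / S n)"
      using S_pos[of n] assms[of n] by (intro mult_right_mono) auto
    then show "(norm (grad (x n)))\<^sup>2 \<le> B * ((norm (grad (x n)))\<^sup>2 / S n)"
      using S_pos[of n] by simp
  qed
qed simp

text \<open>
If the gradient stayed away from zero, the relative increments of \<open>S\<close> would be summable and \<open>S\<close> bounded; but then
the gradient tends to zero.
\<close>

lemma small_grad_frequently:
  assumes "\<nu> > 0"
  shows "frequently (\<lambda>n. (norm (grad (x n)))\<^sup>2 < \<nu>) sequentially"
proof (rule ccontr)
  assume "\<not> ?thesis"
  then obtain N where N: "\<And>n. n \<ge> N \<Longrightarrow> \<nu> \<le> (norm (grad (x n)))\<^sup>2"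
    by (auto simp: frequently_def eventually_sequentially not_less)
  define r where "r n = (norm (H n))\<^sup>2 / S n" for n
  have r0: "0 \<le> r n" for n using S_pos[of n] by (simp add: r_def)
  have "summable r"
  proof (rule summable_comparison_test'[OF noise_summable[OF assms], of N])
    fix n assume "N \<le> n"
    have "1 * (norm (H n))\<^sup>2 / S n \<le> w (x n) * (norm (H n))\<^sup>2 / S n"
      using S_pos[of n] w_ge_1[of "x n"] by (intro divide_right_mono mult_right_mono) auto
    then show "norm (r n) \<le> of_bool (\<nu> \<le> (norm (grad (x n)))\<^sup>2) * (w (x n) * (norm (H n))\<^sup>2 / S n)"
      using N[OF \<open>N \<le> n\<close>] r0[of n] by (simp add: r_def)
  qed
  have "S n \<le> S0 * exp (sum r {..<n})" for n
  proof (induction n)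
    case (Suc n)
    have "S (Suc n) = S n * (1 + r n)"
      using S_pos[of n] by (simp add: S_Suc r_def field_simps)
    also have "\<dots> \<le> (S0 * exp (sum r {..<n})) * exp (r n)"
      using Suc S_pos[of n] r0[of n] S0_pos by (intro mult_mono exp_ge_add_one_self) auto
    finally show ?case by (simp add: exp_add mult.assoc)
  qed (simp add: S_0)
  also have "S0 * exp (sum r {..<n}) \<le> S0 * exp (suminf r)" for n
    using sum_le_suminf[OF \<open>summable r\<close>, of "{..<n}"] r0 S0_pos by simp
  finally have "(\<lambda>n. (norm (grad (x n)))\<^sup>2) \<longlonglongrightarrow> 0"
    by (rule grad_tendsto_if_S_bounded)
  then have "eventually (\<lambda>n. (norm (grad (x n)))\<^sup>2 < \<nu>) sequentially"
    using assms by (rule order_tendstoD(2))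
  then obtain M where "\<And>n. n \<ge> M \<Longrightarrow> (norm (grad (x n)))\<^sup>2 < \<nu>"
    by (auto simp: eventually_sequentially)
  from this[of "max N M"] N[of "max N M"] show False by auto
qed

text \<open>
Where the gradient is small the noise is bounded and \<open>S\<close> is large; elsewhere the relative noise is summable.  In
both cases a single step changes \<open>g\<close> little.
\<close>

lemma jumps_vanish:
  assumes unbounded: "filterlim S at_top sequentially" and "\<delta> > 0"
  shows "eventually (\<lambda>n. g (x n) \<le> b \<longrightarrow> g (x (Suc n)) \<le> g (x n) + \<delta>) sequentially"
proof -
  define e where "e n = of_bool (D0 \<le> (norm (grad (x n)))\<^sup>2) * (w (x n) * (norm (H n))\<^sup>2 / S n)" for n
  define M where "M = \<bar>D1\<bar> * (1 + \<bar>b\<bar>)"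
  have "e \<longlonglongrightarrow> 0"
    unfolding e_def by (rule summable_LIMSEQ_zero[OF noise_summable[OF D0_pos]])
  moreover have "(\<lambda>n. M / S n) \<longlonglongrightarrow> 0"
    by (rule tendsto_divide_0[OF tendsto_const filterlim_at_top_imp_at_infinity[OF unbounded]])
  ultimately have "(\<lambda>n. K * sqrt (e n + M / S n)) \<longlonglongrightarrow> K * sqrt (0 + 0)"
    by (intro tendsto_intros)
  then have "eventually (\<lambda>n. K * sqrt (e n + M / S n) < \<delta>) sequentially"
    using \<open>\<delta> > 0\<close> by (intro order_tendstoD(2)) auto
  then show ?thesis
  proof (rule eventually_mono, intro impI)
    fix n assume n: "K * sqrt (e n + M / S n) < \<delta>" and b: "g (x n) \<le> b"
    have e0: "0 \<le> e n" using S_pos[of n] w_ge_1[of "x n"] by (simp add: e_def)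
    have M0: "0 \<le> M / S n" using S_pos[of n] by (simp add: M_def)
    have w1: "1 \<le> w (x n)" by (rule w_ge_1)
    have "noise_ratio (H n) (S n) * w (x n) \<le> e n + M / S n"
    proof (cases "D0 \<le> (norm (grad (x n)))\<^sup>2")
      case True
      have "noise_ratio (H n) (S n) * w (x n) \<le> ((norm (H n))\<^sup>2 / S n) * w (x n)"
        using noise_ratio_le_ratio[OF S_pos] w1 by (intro mult_right_mono) auto
      also have "\<dots> = e n" using True by (simp add: e_def)
      finally show ?thesis using M0 by linarith
    next
      case False
      then have "(norm (H n))\<^sup>2 \<le> \<bar>D1\<bar>" using bounded_noise[of n] by linarith
      then have "noise_ratio (H n) (S n) \<le> \<bar>D1\<bar> / S n"
        using order_trans[OF noise_ratio_le_ratio[OF S_pos] divide_right_mono] S_pos[of n] by (simp add: less_imp_le)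
      then have "noise_ratio (H n) (S n) * w (x n) \<le> (\<bar>D1\<bar> / S n) * (1 + \<bar>b\<bar>)"
        using b w1 S_pos[of n] by (intro mult_mono) (auto simp: w_def)
      then show ?thesis using e0 by (simp add: M_def)
    qed
    then have "sqrt (noise_ratio (H n) (S n)) * sqrt (w (x n)) \<le> sqrt (e n + M / S n)"
      by (simp flip: real_sqrt_mult)
    then have "K * (sqrt (noise_ratio (H n) (S n)) * sqrt (w (x n))) \<le> K * sqrt (e n + M / S n)"
      using K_pos by (intro mult_left_mono) auto
    then show "g (x (Suc n)) \<le> g (x n) + \<delta>"
      using g_step_change[OF S_pos[of n], of "x n" "H n"] n by (simp add: x_Suc mult.assoc)
  qed
qed

text \<open>
Consider an upward crossing and the last time before its end at which \<open>g\<close> is below \<open>a\<close>.  One small jump leads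
into the band, and from there on the window estimate permits no further increase beyond a small error.
\<close>

lemma gap_not_crossed:
  assumes unbounded: "filterlim S at_top sequentially"
    and "a < b" "\<nu> > 0" and gap: "\<And>y. a \<le> g y \<Longrightarrow> g y \<le> b \<Longrightarrow> \<nu> \<le> (norm (grad y))\<^sup>2"
  shows "eventually (\<lambda>n. a \<le> g (x n)) sequentially \<or> eventually (\<lambda>n. g (x n) \<le> b) sequentially"
proof (rule ccontr)
  assume "\<not> ?thesis"
  then have low: "\<And>N. \<exists>n\<ge>N. g (x n) < a" and high: "\<And>N. \<exists>n\<ge>N. b < g (x n)"
    by (auto simp: eventually_sequentially not_le)
  define \<delta> where "\<delta> = (b - a) / 3"
  have "\<delta> > 0" using \<open>a < b\<close> by (simp add: \<delta>_def)
  obtain N1 where N1: "\<forall>s t. N1 \<le> s \<longrightarrow> s \<le> t \<longrightarrow> (\<forall>k. s \<le> k \<longrightarrow> k < t \<longrightarrow> \<nu> \<le> (norm (grad (x k)))\<^sup>2) \<longrightarrow>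
    g (x t) - g (x s) \<le> - \<alpha> * (\<Sum>k\<in>{s..<t}. (norm (grad (x k)))\<^sup>2 / sqrt (S k)) + \<delta> \<and>
    norm (x t - x s) \<le> \<alpha> * (\<Sum>k\<in>{s..<t}. norm (grad (x k)) / sqrt (S k)) + \<delta>"
    using window_bounds[OF \<open>\<nu> > 0\<close> \<open>\<delta> > 0\<close>] ..
  obtain N2 where N2: "\<And>n. n \<ge> N2 \<Longrightarrow> g (x n) \<le> a \<Longrightarrow> g (x (Suc n)) \<le> g (x n) + \<delta>"
    using jumps_vanish[OF unbounded \<open>\<delta> > 0\<close>, of a] by (auto simp: eventually_sequentially)
  obtain s0 where s0: "s0 \<ge> max N1 N2" "g (x s0) < a" using low by blast
  have "\<exists>t. t \<ge> s0 \<and> b < g (x t)" using high by blast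
  define t where "t = (LEAST t. t \<ge> s0 \<and> b < g (x t))"
  have t: "s0 \<le> t" "b < g (x t)"
    using LeastI_ex[OF \<open>\<exists>t. t \<ge> s0 \<and> b < g (x t)\<close>] by (simp_all add: t_def)
  have t_least: "g (x k) \<le> b" if "s0 \<le> k" "k < t" for k
    using not_less_Least[of k "\<lambda>t. t \<ge> s0 \<and> b < g (x t)"] that by (simp add: t_def not_less)
  \<comment> \<open>The last time below \<open>a\<close> is the maximum of this set.\<close>
  define A where "A = {k. s0 \<le> k \<and> k < t \<and> g (x k) < a}"
  have "finite A" by (simp add: A_def)
  have "s0 \<noteq> t" using t s0 \<open>a < b\<close> by auto
  then have "s0 \<in> A" using t s0 by (simp add: A_def)
  define s where "s = Max A"
  have sA: "s \<in> A" unfolding s_def using \<open>finite A\<close> \<open>s0 \<in> A\<close> by (intro Max_in) auto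
  have s_max: "a \<le> g (x k)" if "s < k" "k < t" for k
  proof (rule ccontr)
    assume "\<not> a \<le> g (x k)"
    then have "k \<in> A" using that sA by (auto simp: A_def)
    then show False using Max_ge[OF \<open>finite A\<close>, of k] that by (simp add: s_def)
  qed
  have s: "s0 \<le> s" "s < t" "g (x s) < a" using sA by (auto simp: A_def)
  have "g (x (Suc s)) \<le> g (x s) + \<delta>" using N2[of s] s s0 by auto
  moreover have "g (x t) - g (x (Suc s)) \<le> - \<alpha> * (\<Sum>k\<in>{Suc s..<t}. (norm (grad (x k)))\<^sup>2 / sqrt (S k)) + \<delta>"
    using s s0 s_max t_least by (intro N1[rule_format, THEN conjunct1] gap) auto
  moreover have "0 \<le> \<alpha> * (\<Sum>k\<in>{Suc s..<t}. (norm (grad (x k)))\<^sup>2 / sqrt (S k))"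
    using alpha_pos S_pos by (intro mult_nonneg_nonneg sum_nonneg) (auto simp: less_imp_le)
  moreover have "3 * \<delta> = b - a" by (simp add: \<delta>_def)
  ultimately show False using s t \<open>\<delta> > 0\<close> by linarith
qed

lemma g_convergent:
  assumes unbounded: "filterlim S at_top sequentially"
  shows "convergent (\<lambda>n. g (x n))"
proof -
  obtain \<eta> B where \<eta>: "\<eta> > 0" "\<And>y. (norm (grad y))\<^sup>2 < \<eta> \<Longrightarrow> g y \<le> B"
    using small_grad_bounded by blast
  show ?thesis
  proof (rule real_convergent_if_gaps_not_crossed)
    show "frequently (\<lambda>n. g (x n) \<le> B) sequentially"
      using small_grad_frequently[OF \<eta>(1)] \<eta>(2) by (rule frequently_elim1)
    fix l u :: real assume "l < u"
    from critical_gap[OF coercive nowhere this] obtain a b \<nu> where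
      "l < a" "a < b" "b < u" "\<nu> > 0" "\<And>y. a \<le> g y \<Longrightarrow> g y \<le> b \<Longrightarrow> \<nu> \<le> (norm (grad y))\<^sup>2"
      by blast
    with gap_not_crossed[OF unbounded this(2,4,5)]
    show "\<exists>a b. l < a \<and> a < b \<and> b < u \<and>
      (eventually (\<lambda>n. a \<le> g (x n)) sequentially \<or> eventually (\<lambda>n. g (x n) \<le> b) sequentially)"
      by blast
  qed (rule g_nonneg)
qed

text \<open>
On a window from \<open>v \<ge> 2 r\<close> to the first later time with \<open>v < r\<close> the point moves by at least \<open>r / L\<close>.  As \<open>v \<ge> r\<close> in the window, the
decrease of \<open>g\<close> is at least \<open>r\<close> times the length of the path, up to small errors.
\<close>

lemma grad_tendsto_if_g_convergent:
  assumes "convergent (\<lambda>n. g (x n))"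
  shows "(\<lambda>n. norm (grad (x n))) \<longlonglongrightarrow> 0"
proof (rule ccontr)
  assume "\<not> ?thesis"
  then obtain r' where r': "r' > 0" "\<And>N. \<exists>n\<ge>N. r' \<le> norm (grad (x n))"
    by (auto simp: lim_sequentially not_less)
  define r where "r = r' / 2"
  have r: "r > 0" "\<And>N. \<exists>n\<ge>N. 2 * r \<le> norm (grad (x n))" using r' by (auto simp: r_def)
  \<comment> \<open>Chosen so that the decrease \<open>r * (r / L - \<epsilon>) - \<epsilon>\<close> of \<open>g\<close> over a window exceeds \<open>\<epsilon>\<close>.\<close>
  define \<epsilon> where "\<epsilon> = r\<^sup>2 / (2 * L * (r + 2))"
  have \<epsilon>: "\<epsilon> > 0" "(r + 2) * \<epsilon> < r * (r / L)"
    using r L_pos by (auto simp: \<epsilon>_def field_simps power2_eq_square add_pos_pos)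
  have "r\<^sup>2 > 0" using r by simp
  obtain N1 where N1: "\<forall>s t. N1 \<le> s \<longrightarrow> s \<le> t \<longrightarrow> (\<forall>k. s \<le> k \<longrightarrow> k < t \<longrightarrow> r\<^sup>2 \<le> (norm (grad (x k)))\<^sup>2) \<longrightarrow>
    g (x t) - g (x s) \<le> - \<alpha> * (\<Sum>k\<in>{s..<t}. (norm (grad (x k)))\<^sup>2 / sqrt (S k)) + \<epsilon> \<and>
    norm (x t - x s) \<le> \<alpha> * (\<Sum>k\<in>{s..<t}. norm (grad (x k)) / sqrt (S k)) + \<epsilon>"
    using window_bounds[OF \<open>r\<^sup>2 > 0\<close> \<epsilon>(1)] ..
  have "Cauchy (\<lambda>n. g (x n))" using assms by (simp add: Cauchy_convergent_iff)
  then obtain N2 where N2: "\<And>m n. m \<ge> N2 \<Longrightarrow> n \<ge> N2 \<Longrightarrow> \<bar>g (x m) - g (x n)\<bar> < \<epsilon>"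
    using \<epsilon>(1) unfolding Cauchy_def dist_real_def by meson
  obtain s where s: "s \<ge> max N1 N2" "2 * r \<le> norm (grad (x s))" using r(2) by blast
  obtain t0 where "t0 \<ge> s" "(norm (grad (x t0)))\<^sup>2 < r\<^sup>2"
    using small_grad_frequently[OF \<open>r\<^sup>2 > 0\<close>] by (auto simp: frequently_sequentially)
  then have ex: "\<exists>t. t \<ge> s \<and> norm (grad (x t)) < r"
    using r(1) power2_less_imp_less[of "norm (grad (x t0))" r] by auto
  define t where "t = (LEAST t. t \<ge> s \<and> norm (grad (x t)) < r)"
  have t: "s \<le> t" "norm (grad (x t)) < r"
    using LeastI_ex[OF ex] by (simp_all add: t_def)
  have t_least: "r \<le> norm (grad (x k))" if "s \<le> k" "k < t" for k
    using not_less_Least[of k "\<lambda>t. t \<ge> s \<and> norm (grad (x t)) < r"] that by (simp add: t_def not_less)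
  define T where "T = (\<Sum>k\<in>{s..<t}. norm (grad (x k)) / sqrt (S k))"
  have "r \<le> norm (grad (x s) - grad (x t))"
    using s t norm_triangle_ineq2[of "grad (x s)" "grad (x t)"] by linarith
  also have "\<dots> \<le> L * norm (x t - x s)"
    using grad_lipschitz[of "x s" "x t"] by (simp add: norm_minus_commute)
  finally have far: "r / L \<le> norm (x t - x s)"
    using L_pos by (simp add: field_simps)
  have both: "g (x t) - g (x s) \<le> - \<alpha> * (\<Sum>k\<in>{s..<t}. (norm (grad (x k)))\<^sup>2 / sqrt (S k)) + \<epsilon> \<and>
      norm (x t - x s) \<le> \<alpha> * T + \<epsilon>"
    unfolding T_def using s t t_least r(1) by (intro N1[rule_format] power_mono) auto
  have "r * T \<le> (\<Sum>k\<in>{s..<t}. (norm (grad (x k)))\<^sup>2 / sqrt (S k))"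
    unfolding T_def sum_distrib_left
  proof (rule sum_mono)
    fix k assume "k \<in> {s..<t}"
    then have "r * norm (grad (x k)) / sqrt (S k) \<le> norm (grad (x k)) * norm (grad (x k)) / sqrt (S k)"
      using t_least S_pos[of k] by (intro divide_right_mono mult_right_mono) (auto simp: less_imp_le)
    then show "r * (norm (grad (x k)) / sqrt (S k)) \<le> (norm (grad (x k)))\<^sup>2 / sqrt (S k)"
      by (simp add: power2_eq_square)
  qed
  then have "\<alpha> * (r * T) \<le> \<alpha> * (\<Sum>k\<in>{s..<t}. (norm (grad (x k)))\<^sup>2 / sqrt (S k))"
    using alpha_pos by (intro mult_left_mono) auto
  moreover have "r * (r / L) \<le> r * (\<alpha> * T + \<epsilon>)"
    using far both r(1) by (intro mult_left_mono) auto
  moreover have "- \<epsilon> < g (x t) - g (x s)" using N2[of t s] s t by auto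
  ultimately have "r * (r / L) \<le> r * \<epsilon> + 2 * \<epsilon>"
    using both by (simp add: algebra_simps)
  then show False using \<epsilon> by (simp add: algebra_simps)
qed

lemma grad_tendsto_zero: "(\<lambda>n. (norm (grad (x n)))\<^sup>2) \<longlonglongrightarrow> 0"
proof (cases "\<exists>B. \<forall>n. S n \<le> B")
  case True
  then show ?thesis using grad_tendsto_if_S_bounded by blast
next
  case False
  have "filterlim S at_top sequentially"
    unfolding filterlim_at_top eventually_sequentially
  proof
    fix Z
    obtain N where "Z < S N" using False not_le by blast
    then show "\<exists>N. \<forall>n\<ge>N. Z \<le> S n" using S_mono less_imp_le order_trans by blast
  qed
  from tendsto_power[OF grad_tendsto_if_g_convergent[OF g_convergent[OF this]], of 2]
  show ?thesis by simp
qed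

end

section \<open>Almost sure convergence of square-integrable martingales\<close>

lemma AE_summable_if_expectations_bounded:
  fixes f :: "nat \<Rightarrow> 'w \<Rightarrow> real"
  assumes int: "\<And>n. integrable M (f n)"
    and nonneg: "\<And>n \<omega>. \<omega> \<in> space M \<Longrightarrow> 0 \<le> f n \<omega>"
    and bound: "\<And>n. (\<Sum>k<n. \<integral>\<omega>. f k \<omega> \<partial>M) \<le> C"
  shows "AE \<omega> in M. summable (\<lambda>n. f n \<omega>)"
proof -
  have nonneg_int: "0 \<le> (\<integral>\<omega>. f n \<omega> \<partial>M)" for n
    by (rule integral_nonneg_AE) (use nonneg in auto)
  have summ: "summable (\<lambda>n. \<integral>\<omega>. f n \<omega> \<partial>M)"
    by (rule summableI_nonneg_bounded[OF nonneg_int bound])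
  have "(\<integral>\<^sup>+\<omega>. (\<Sum>n. ennreal (f n \<omega>)) \<partial>M) = (\<Sum>n. \<integral>\<^sup>+\<omega>. ennreal (f n \<omega>) \<partial>M)"
    using borel_measurable_integrable[OF int] by (intro nn_integral_suminf) auto
  also have "\<dots> = (\<Sum>n. ennreal (\<integral>\<omega>. f n \<omega> \<partial>M))"
    using int nonneg by (intro suminf_cong nn_integral_eq_integral) auto
  also have "\<dots> = ennreal (\<Sum>n. \<integral>\<omega>. f n \<omega> \<partial>M)"
    by (rule suminf_ennreal2[OF nonneg_int summ])
  finally have "(\<integral>\<^sup>+\<omega>. (\<Sum>n. ennreal (f n \<omega>)) \<partial>M) \<noteq> \<infinity>"
    by simp
  then have "AE \<omega> in M. (\<Sum>n. ennreal (f n \<omega>)) \<noteq> \<infinity>"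
    using borel_measurable_integrable[OF int] by (intro nn_integral_noteq_infinite) auto
  then show ?thesis
    using AE_space
  proof eventually_elim
    case (elim \<omega>)
    then show ?case using nonneg by (intro summable_suminf_not_top) auto
  qed
qed

text \<open>
The martingale property is stated through integrals against bounded weights.  These include the stopped partial
sums, as long as the stopping has not occurred.
\<close>

locale martingale_increments = prob_space M for M :: "'w measure" +
  fixes F :: "nat \<Rightarrow> 'w measure" and X :: "nat \<Rightarrow> 'w \<Rightarrow> real"
  assumes subalg: "subalgebra M (F n)"
    and filtration: "m \<le> n \<Longrightarrow> sets (F m) \<subseteq> sets (F n)"
    and adapted: "X n \<in> borel_measurable (F (Suc n))"
    and square_integrable: "integrable M (\<lambda>\<omega>. (X n \<omega>)\<^sup>2)"
    and orthogonal: "f \<in> borel_measurable (F n) \<Longrightarrow> (\<And>\<omega>. \<omega> \<in> space M \<Longrightarrow> \<bar>f \<omega>\<bar> \<le> c) \<Longrightarrow>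
      (\<integral>\<omega>. f \<omega> * X n \<omega> \<partial>M) = 0"
begin

lemma space_F: "space (F n) = space M"
  using subalg[of n] by (simp add: subalgebra_def)

lemma measurable_F_mono:
  "m \<le> n \<Longrightarrow> f \<in> borel_measurable (F m) \<Longrightarrow> f \<in> borel_measurable (F n)"
  by (rule measurable_from_subalg) (use filtration space_F in \<open>auto simp: subalgebra_def\<close>)

lemma measurable_F_M: "f \<in> borel_measurable (F n) \<Longrightarrow> f \<in> borel_measurable M"
  by (rule measurable_from_subalg[OF subalg])

lemma X_measurable [measurable]: "X n \<in> borel_measurable M"
  by (rule measurable_F_M[OF adapted])

lemma partial_sum_measurable: "(\<lambda>\<omega>. \<Sum>i<k. X i \<omega>) \<in> borel_measurable (F k)"
  by (rule borel_measurable_sum) (use measurable_F_mono[OF _ adapted] in auto)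

text \<open>
Kolmogorov's inequality.  The sum \<open>T\<close> stopped at the first exceedance of \<open>\<epsilon>\<close> still has orthogonal increments, and
at the final time it equals the partial sum at which the exceedance took place, so Chebyshev's inequality for \<open>T n\<close> suffices.
\<close>

lemma maximal_inequality:
  assumes "\<epsilon> > 0"
  shows "measure M {\<omega> \<in> space M. \<exists>k\<le>n. \<epsilon> \<le> \<bar>\<Sum>i<k. X i \<omega>\<bar>} \<le> (\<Sum>k<n. \<integral>\<omega>. (X k \<omega>)\<^sup>2 \<partial>M) / \<epsilon>\<^sup>2"
proof -
  define I :: "nat \<Rightarrow> 'w \<Rightarrow> real" where "I k \<omega> = of_bool (\<forall>j\<le>k. \<bar>\<Sum>i<j. X i \<omega>\<bar> < \<epsilon>)" for k \<omega>
  define T where "T k \<omega> = (\<Sum>i<k. I i \<omega> * X i \<omega>)" for k \<omega>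
  have I_meas: "I k \<in> borel_measurable (F k)" for k
  proof -
    have [measurable]: "(\<lambda>\<omega>. \<Sum>i<j. X i \<omega>) \<in> borel_measurable (F k)" if "j \<le> k" for j
      by (rule measurable_F_mono[OF that partial_sum_measurable])
    have "{\<omega> \<in> space (F k). \<forall>j\<le>k. \<bar>\<Sum>i<j. X i \<omega>\<bar> < \<epsilon>} = (\<Inter>j\<in>{..k}. {\<omega> \<in> space (F k). \<bar>\<Sum>i<j. X i \<omega>\<bar> < \<epsilon>})"
      by auto
    also have "\<dots> \<in> sets (F k)"
      by (intro sets.finite_INT) auto
    finally show ?thesis
      unfolding I_def[abs_def] of_bool_def by (intro measurable_If) (auto simp: pred_def)
  qed
  have T_eq: "T k \<omega> = (\<Sum>i<k. X i \<omega>)" if "I k \<omega> \<noteq> 0" for k \<omega>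
    unfolding T_def
  proof (rule sum.cong)
    fix i assume "i \<in> {..<k}"
    then have "I i \<omega> = 1" using that by (auto simp: I_def split: if_splits)
    then show "I i \<omega> * X i \<omega> = X i \<omega>" by simp
  qed simp
  have IM [measurable]: "I k \<in> borel_measurable M" for k
    by (rule measurable_F_M[OF I_meas])
  have TM [measurable]: "T k \<in> borel_measurable M" for k
    unfolding T_def[abs_def] by measurable
  have I01: "0 \<le> I k \<omega>" "I k \<omega> \<le> 1" "(I k \<omega>)\<^sup>2 = I k \<omega>" for k \<omega>
    by (auto simp: I_def)
  have intX: "integrable M (X k)" for k
    by (rule square_integrable_imp_integrable) (use square_integrable in auto)
  have IX2: "integrable M (\<lambda>\<omega>. I k \<omega> * (X k \<omega>)\<^sup>2)" for k
    by (rule Bochner_Integration.integrable_bound[OF square_integrable[of k]])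
       (use I01 in \<open>auto simp: abs_mult mult_left_le_one_le\<close>)
  have second_moment: "integrable M (\<lambda>\<omega>. (T k \<omega>)\<^sup>2) \<and>
      (\<integral>\<omega>. (T k \<omega>)\<^sup>2 \<partial>M) \<le> (\<Sum>j<k. \<integral>\<omega>. (X j \<omega>)\<^sup>2 \<partial>M)" for k
  proof (induction k)
    case 0
    then show ?case by (simp add: T_def)
  next
    case (Suc k)
    \<comment> \<open>On the event that the sum has not been stopped, \<open>T k\<close> is bounded by \<open>\<epsilon>\<close>, so \<open>f\<close> is an admissible weight.\<close>
    define f where "f \<omega> = T k \<omega> * I k \<omega>" for \<omega>
    have f_eq: "f \<omega> = (\<Sum>i<k. X i \<omega>) * I k \<omega>" for \<omega>
      using T_eq[of k \<omega>] by (cases "I k \<omega> = 0") (auto simp: f_def)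
    have f_meas: "f \<in> borel_measurable (F k)"
      unfolding f_eq[abs_def] by (intro borel_measurable_times partial_sum_measurable I_meas)
    have f_bound: "\<bar>f \<omega>\<bar> \<le> \<epsilon>" for \<omega>
      using assms by (auto simp: f_eq I_def)
    have fX: "integrable M (\<lambda>\<omega>. f \<omega> * X k \<omega>)"
    proof (rule Bochner_Integration.integrable_bound[OF integrable_mult_right[OF intX[of k], of \<epsilon>]])
      show "(\<lambda>\<omega>. f \<omega> * X k \<omega>) \<in> borel_measurable M"
        using measurable_F_M[OF f_meas] by measurable
      show "AE \<omega> in M. norm (f \<omega> * X k \<omega>) \<le> norm (\<epsilon> * X k \<omega>)"
        using f_bound assms by (auto simp: abs_mult intro!: mult_right_mono)
    qed
    have expand: "(T (Suc k) \<omega>)\<^sup>2 = (T k \<omega>)\<^sup>2 + 2 * (f \<omega> * X k \<omega>) + I k \<omega> * (X k \<omega>)\<^sup>2" for \<omega>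
    proof -
      have "(T (Suc k) \<omega>)\<^sup>2 = (T k \<omega>)\<^sup>2 + 2 * (f \<omega> * X k \<omega>) + (I k \<omega>)\<^sup>2 * (X k \<omega>)\<^sup>2"
        by (simp add: T_def f_def power2_eq_square algebra_simps)
      then show ?thesis by (simp only: I01)
    qed
    have "integrable M (\<lambda>\<omega>. (T (Suc k) \<omega>)\<^sup>2)"
      unfolding expand using Suc fX IX2[of k] by (intro Bochner_Integration.integrable_add integrable_mult_right) auto
    moreover have "(\<integral>\<omega>. (T (Suc k) \<omega>)\<^sup>2 \<partial>M) = (\<integral>\<omega>. (T k \<omega>)\<^sup>2 \<partial>M) + 2 * (\<integral>\<omega>. f \<omega> * X k \<omega> \<partial>M)
        + (\<integral>\<omega>. I k \<omega> * (X k \<omega>)\<^sup>2 \<partial>M)"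
      unfolding expand using Suc fX IX2[of k] by simp
    moreover have "(\<integral>\<omega>. f \<omega> * X k \<omega> \<partial>M) = 0"
      by (rule orthogonal[OF f_meas f_bound])
    moreover have "(\<integral>\<omega>. I k \<omega> * (X k \<omega>)\<^sup>2 \<partial>M) \<le> (\<integral>\<omega>. (X k \<omega>)\<^sup>2 \<partial>M)"
      using I01 by (intro integral_mono IX2 square_integrable) (auto simp: mult_left_le_one_le)
    ultimately show ?case using Suc by auto
  qed
  have "{\<omega> \<in> space M. \<exists>k\<le>n. \<epsilon> \<le> \<bar>\<Sum>i<k. X i \<omega>\<bar>} \<subseteq> {\<omega> \<in> space M. \<epsilon>\<^sup>2 \<le> (T n \<omega>)\<^sup>2}"
  proof safe
    fix \<omega> k assume k: "k \<le> n" "\<epsilon> \<le> \<bar>\<Sum>i<k. X i \<omega>\<bar>"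
    define k0 where "k0 = (LEAST k. \<epsilon> \<le> \<bar>\<Sum>i<k. X i \<omega>\<bar>)"
    have k0: "\<epsilon> \<le> \<bar>\<Sum>i<k0. X i \<omega>\<bar>" unfolding k0_def by (rule LeastI[of _ k]) (rule k)
    have "k0 \<le> n" using Least_le[of "\<lambda>k. \<epsilon> \<le> \<bar>\<Sum>i<k. X i \<omega>\<bar>", OF k(2)] k(1) by (simp add: k0_def)
    have I_eq: "I i \<omega> = of_bool (i < k0)" for i
    proof (cases "i < k0")
      case True
      have "\<bar>\<Sum>i<j. X i \<omega>\<bar> < \<epsilon>" if "j \<le> i" for j
        using not_less_Least[of j "\<lambda>k. \<epsilon> \<le> \<bar>\<Sum>i<k. X i \<omega>\<bar>"] that True by (simp add: k0_def)
      then show ?thesis using True by (simp add: I_def)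
    next
      case False
      then show ?thesis using k0 by (auto simp: I_def not_less)
    qed
    have "T n \<omega> = (\<Sum>i\<in>{..<n}. if i < k0 then X i \<omega> else 0)"
      unfolding T_def I_eq by (rule sum.cong) auto
    also have "\<dots> = (\<Sum>i\<in>{..<n} \<inter> {i. i < k0}. X i \<omega>)"
      by (subst sum.inter_restrict) auto
    also have "{..<n} \<inter> {i. i < k0} = {..<k0}" using \<open>k0 \<le> n\<close> by auto
    finally have "\<epsilon> \<le> \<bar>T n \<omega>\<bar>" using k0 by simp
    then show "\<epsilon>\<^sup>2 \<le> (T n \<omega>)\<^sup>2"
      using assms by (metis less_imp_le power2_abs power_mono)
  qed
  then have "measure M {\<omega> \<in> space M. \<exists>k\<le>n. \<epsilon> \<le> \<bar>\<Sum>i<k. X i \<omega>\<bar>} \<le> measure M {\<omega> \<in> space M. \<epsilon>\<^sup>2 \<le> (T n \<omega>)\<^sup>2}"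
    by (rule finite_measure_mono) measurable
  also have "\<dots> \<le> (\<integral>\<omega>. (T n \<omega>)\<^sup>2 \<partial>M) / \<epsilon>\<^sup>2"
    by (rule integral_Markov_inequality_measure[where A="space M"]) (use second_moment assms in auto)
  also have "\<dots> \<le> (\<Sum>k<n. \<integral>\<omega>. (X k \<omega>)\<^sup>2 \<partial>M) / \<epsilon>\<^sup>2"
    using second_moment by (intro divide_right_mono) auto
  finally show ?thesis .
qed

lemma shifted: "martingale_increments M (\<lambda>n. F (m + n)) (\<lambda>n. X (m + n))"
proof unfold_locales
  show "sets (F (m + i)) \<subseteq> sets (F (m + j))" if "i \<le> j" for i j
    using that by (intro filtration) simp
  show "X (m + n) \<in> borel_measurable (F (m + Suc n))" for n
    using adapted[of "m + n"] by simp
qed (fact subalg square_integrable orthogonal)+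

lemma sup_inequality:
  assumes "\<epsilon> > 0" and summ: "summable (\<lambda>n. \<integral>\<omega>. (X n \<omega>)\<^sup>2 \<partial>M)"
  shows "measure M {\<omega> \<in> space M. \<exists>k. \<epsilon> \<le> \<bar>\<Sum>i<k. X i \<omega>\<bar>} \<le> (\<Sum>n. \<integral>\<omega>. (X n \<omega>)\<^sup>2 \<partial>M) / \<epsilon>\<^sup>2"
proof -
  define A where "A n = {\<omega> \<in> space M. \<exists>k\<le>n. \<epsilon> \<le> \<bar>\<Sum>i<k. X i \<omega>\<bar>}" for n
  have "range A \<subseteq> sets M" unfolding A_def by auto
  moreover have "incseq A" unfolding A_def by (auto simp: incseq_def) (meson order_trans)
  ultimately have "(\<lambda>n. measure M (A n)) \<longlonglongrightarrow> measure M (\<Union>n. A n)"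
    by (rule finite_Lim_measure_incseq)
  moreover have "measure M (A n) \<le> (\<Sum>n. \<integral>\<omega>. (X n \<omega>)\<^sup>2 \<partial>M) / \<epsilon>\<^sup>2" for n
  proof -
    have "measure M (A n) \<le> (\<Sum>k<n. \<integral>\<omega>. (X k \<omega>)\<^sup>2 \<partial>M) / \<epsilon>\<^sup>2"
      unfolding A_def by (rule maximal_inequality[OF assms(1)])
    also have "\<dots> \<le> (\<Sum>n. \<integral>\<omega>. (X n \<omega>)\<^sup>2 \<partial>M) / \<epsilon>\<^sup>2"
      by (intro divide_right_mono sum_le_suminf[OF summ]) auto
    finally show ?thesis .
  qed
  ultimately have "measure M (\<Union>n. A n) \<le> (\<Sum>n. \<integral>\<omega>. (X n \<omega>)\<^sup>2 \<partial>M) / \<epsilon>\<^sup>2"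
    by (intro LIMSEQ_le_const2) auto
  also have "(\<Union>n. A n) = {\<omega> \<in> space M. \<exists>k. \<epsilon> \<le> \<bar>\<Sum>i<k. X i \<omega>\<bar>}"
    by (auto simp: A_def)
  finally show ?thesis .
qed

text \<open>
The maximal inequality for the increments after time \<open>m\<close> bounds the probability that the partial sums oscillate by
\<open>\<epsilon>\<close> after \<open>m\<close>; this bound tends to zero, so almost every path of partial sums is Cauchy.
\<close>

theorem martingale_AE_summable:
  assumes summ: "summable (\<lambda>n. \<integral>\<omega>. (X n \<omega>)\<^sup>2 \<partial>M)"
  shows "AE \<omega> in M. summable (\<lambda>n. X n \<omega>)"
proof -
  define B where "B \<epsilon> m = {\<omega> \<in> space M. \<exists>k. \<epsilon> \<le> \<bar>\<Sum>i<k. X (m + i) \<omega>\<bar>}" for \<epsilon> :: real and m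
  have B_sets [measurable]: "B \<epsilon> m \<in> sets M" for \<epsilon> m unfolding B_def by measurable
  have null: "AE \<omega> in M. \<exists>m. \<omega> \<notin> B \<epsilon> m" if "\<epsilon> > 0" for \<epsilon>
  proof -
    have "measure M (\<Inter>m. B \<epsilon> m) \<le> 0 + \<delta>" if "\<delta> > 0" for \<delta>
    proof -
      have "\<delta> * \<epsilon>\<^sup>2 > 0" using \<open>\<epsilon> > 0\<close> \<open>\<delta> > 0\<close> by simp
      from suminf_exist_split[OF this summ] obtain m where
        m: "norm (\<Sum>i. \<integral>\<omega>. (X (i + m) \<omega>)\<^sup>2 \<partial>M) < \<delta> * \<epsilon>\<^sup>2" by blast
      interpret sh: martingale_increments M "\<lambda>n. F (m + n)" "\<lambda>n. X (m + n)" by (rule shifted)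
      have "summable (\<lambda>n. \<integral>\<omega>. (X (m + n) \<omega>)\<^sup>2 \<partial>M)"
        using summable_ignore_initial_segment[OF summ, of m] by (simp add: add.commute)
      from sh.sup_inequality[OF \<open>\<epsilon> > 0\<close> this]
      have "measure M (B \<epsilon> m) \<le> (\<Sum>n. \<integral>\<omega>. (X (m + n) \<omega>)\<^sup>2 \<partial>M) / \<epsilon>\<^sup>2"
        by (simp add: B_def)
      also have "\<dots> \<le> (\<delta> * \<epsilon>\<^sup>2) / \<epsilon>\<^sup>2"
        using m by (intro divide_right_mono) (auto simp: add.commute)
      also have "\<dots> = \<delta>" using \<open>\<epsilon> > 0\<close> by simp
      finally have "measure M (B \<epsilon> m) \<le> \<delta>" .
      moreover have "measure M (\<Inter>m. B \<epsilon> m) \<le> measure M (B \<epsilon> m)"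
        by (intro finite_measure_mono) auto
      ultimately show ?thesis by simp
    qed
    then have "measure M (\<Inter>m. B \<epsilon> m) \<le> 0" by (rule field_le_epsilon)
    then have "(\<Inter>m. B \<epsilon> m) \<in> null_sets M"
      by (simp add: null_sets_def emeasure_eq_measure measure_le_0_iff)
    from AE_not_in[OF this] show ?thesis by auto
  qed
  have "AE \<omega> in M. \<forall>j. \<exists>m. \<omega> \<notin> B (inverse (real (Suc j))) m"
    unfolding AE_all_countable using null by simp
  then show ?thesis
    using AE_space
  proof eventually_elim
    case (elim \<omega>)
    show ?case
      unfolding summable_Cauchy
    proof (intro allI impI)
      fix e :: real assume "e > 0"
      then obtain j where j: "inverse (real (Suc j)) < e / 2"
        using reals_Archimedean[of "e / 2"] by auto
      from elim obtain m where notin: "\<omega> \<notin> B (inverse (real (Suc j))) m" by blast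
      have "\<not> inverse (real (Suc j)) \<le> \<bar>\<Sum>i<k. X (m + i) \<omega>\<bar>" for k
        using notin elim(2) unfolding B_def by blast
      then have m: "\<bar>\<Sum>i<k. X (m + i) \<omega>\<bar> < e / 2" for k
        using j order_less_trans not_le by blast
      show "\<exists>N. \<forall>p\<ge>N. \<forall>q. norm (sum (\<lambda>n. X n \<omega>) {p..<q}) < e"
      proof (intro exI allI impI)
        fix p q assume "m \<le> p"
        show "norm (sum (\<lambda>n. X n \<omega>) {p..<q}) < e"
        proof (cases "p \<le> q")
          case True
          have shift: "(\<Sum>n\<in>{m..<r}. X n \<omega>) = (\<Sum>i<r - m. X (m + i) \<omega>)" for r
            using sum.shift_bounds_nat_ivl[of "\<lambda>n. X n \<omega>" 0 m "r - m"]
            by (cases "m \<le> r") (auto simp: atLeast0LessThan add.commute)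
          have "sum (\<lambda>n. X n \<omega>) {p..<q} = (\<Sum>n\<in>{m..<q}. X n \<omega>) - (\<Sum>n\<in>{m..<p}. X n \<omega>)"
            using sum.atLeastLessThan_concat[OF \<open>m \<le> p\<close> True, of "\<lambda>n. X n \<omega>"] by simp
          also have "norm \<dots> \<le> \<bar>\<Sum>i<q - m. X (m + i) \<omega>\<bar> + \<bar>\<Sum>i<p - m. X (m + i) \<omega>\<bar>"
            unfolding shift by simp
          also have "\<dots> < e / 2 + e / 2" by (intro add_strict_mono m)
          finally show ?thesis by simp
        qed (use \<open>e > 0\<close> in simp)
      qed
    qed
  qed
qed

end

section \<open>The stochastic process\<close>

context adagrad_smooth
begin

text \<open>
The positive part of \<open>g - B\<close> evolves without non-summable errors.  If the gradient is small, the value starts below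
\<open>B - 1\<close>, so a positive excess requires the change \<open>d\<close> of \<open>g\<close> to exceed \<open>1\<close>.  The square of the excess is then at
most the third power of \<open>d\<close>, and the extra factor is bounded noise over \<open>sqrt S\<close>, which turns the second order term into the decay.
\<close>

lemma excess_step:
  assumes S: "S \<ge> S0"
    and noise: "(norm (grad x))\<^sup>2 < \<nu> \<Longrightarrow> (norm H)\<^sup>2 < D1"
    and level: "(norm (grad x))\<^sup>2 < \<nu> \<Longrightarrow> g x \<le> B - 1"
    and "0 \<le> B"
  shows "(max 0 (g (step x H S) - B))\<^sup>2 \<le> (max 0 (g x - B))\<^sup>2
     - 2 * \<alpha> * max 0 (g x - B) / sqrt S * (grad x \<bullet> H)
     + (2 * K5 + K\<^sup>2) * (of_bool (\<nu> \<le> (norm (grad x))\<^sup>2) * (w x)\<^sup>2 / S * (norm H)\<^sup>2)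
     + 2 * (K * sqrt B) ^ 3 * sqrt \<bar>D1\<bar> * step_decay H S"
proof -
  have S_pos: "S > 0" using S S0_pos by simp
  define d where "d = g (step x H S) - g x"
  define y where "y = max 0 (g x - B)"
  define y' where "y' = max 0 (g (step x H S) - B)"
  have d_abs: "\<bar>d\<bar> \<le> K * sqrt (noise_ratio H S) * sqrt (w x)"
    unfolding d_def by (rule g_step_change[OF S_pos])
  have step_decay0: "0 \<le> step_decay H S" by (rule step_decay_nonneg[OF S_pos])
  have G0: "0 \<le> noise_ratio H S" "noise_ratio H S \<le> (norm H)\<^sup>2 / S"
    using S_pos by (auto simp: noise_ratio_nonneg noise_ratio_le_ratio)
  have w1: "1 \<le> w x" by (rule w_ge_1)
  have K0: "0 < K" by (rule K_pos)
  have y: "0 \<le> y" "y \<le> w x"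
    using \<open>0 \<le> B\<close> g_nonneg[of x] by (auto simp: y_def w_def)
  have y'_le: "y' \<le> \<bar>y + d\<bar>" "y' \<ge> 0"
    by (auto simp: y'_def y_def d_def)
  show ?thesis
  proof (cases "\<nu> \<le> (norm (grad x))\<^sup>2")
    case True
    define e where "e = (norm H)\<^sup>2 / S"
    have e: "0 \<le> e" using S_pos by (simp add: e_def)
    have "d \<le> - \<alpha> * (grad x \<bullet> H) / sqrt S + K5 * (w x * e)"
      using g_step_le_noise[OF S_pos, of x H] by (simp add: d_def e_def)
    then have "2 * y * d \<le> 2 * y * (- \<alpha> * (grad x \<bullet> H) / sqrt S + K5 * (w x * e))"
      using y by (intro mult_left_mono) auto
    also have "\<dots> = - 2 * \<alpha> * y / sqrt S * (grad x \<bullet> H) + 2 * K5 * (y * (w x * e))"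
      by (simp add: algebra_simps)
    also have "2 * K5 * (y * (w x * e)) \<le> 2 * K5 * (w x * (w x * e))"
      using y w1 e K5_pos by (intro mult_left_mono mult_right_mono) auto
    finally have 1: "2 * y * d \<le> - 2 * \<alpha> * y / sqrt S * (grad x \<bullet> H) + 2 * K5 * ((w x)\<^sup>2 * e)"
      by (simp add: power2_eq_square mult.assoc)
    have "d\<^sup>2 \<le> (K * sqrt (noise_ratio H S) * sqrt (w x))\<^sup>2"
      using d_abs by (metis abs_ge_zero power2_abs power_mono)
    also have "\<dots> = K\<^sup>2 * (noise_ratio H S * w x)"
      using G0 w1 by (simp add: power_mult_distrib)
    also have "\<dots> \<le> K\<^sup>2 * (e * (w x)\<^sup>2)"
      using G0 e w1 self_le_power[of "w x" 2] by (intro mult_left_mono mult_mono) (auto simp: e_def)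
    finally have 2: "d\<^sup>2 \<le> K\<^sup>2 * ((w x)\<^sup>2 * e)" by (simp add: mult.commute)
    have "y'\<^sup>2 \<le> (y + d)\<^sup>2"
      using y'_le by (metis power2_abs power_mono)
    also have "\<dots> = y\<^sup>2 + 2 * y * d + d\<^sup>2" by (simp add: power2_sum)
    also have "\<dots> \<le> y\<^sup>2 - 2 * \<alpha> * y / sqrt S * (grad x \<bullet> H) + (2 * K5 + K\<^sup>2) * ((w x)\<^sup>2 * e)"
      using 1 2 by (simp add: distrib_right)
    finally have "y'\<^sup>2 \<le> y\<^sup>2 - 2 * \<alpha> * y / sqrt S * (grad x \<bullet> H) + (2 * K5 + K\<^sup>2) * ((w x)\<^sup>2 * e)" .
    moreover have "(w x)\<^sup>2 * e = of_bool (\<nu> \<le> (norm (grad x))\<^sup>2) * (w x)\<^sup>2 / S * (norm H)\<^sup>2"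
      using True by (simp add: e_def)
    ultimately have "y'\<^sup>2 \<le> y\<^sup>2 - 2 * \<alpha> * y / sqrt S * (grad x \<bullet> H)
        + (2 * K5 + K\<^sup>2) * (of_bool (\<nu> \<le> (norm (grad x))\<^sup>2) * (w x)\<^sup>2 / S * (norm H)\<^sup>2)"
      by simp
    moreover have "0 \<le> 2 * (K * sqrt B) ^ 3 * sqrt \<bar>D1\<bar> * step_decay H S"
      using K0 \<open>0 \<le> B\<close> step_decay0 by simp
    ultimately show ?thesis unfolding y_def y'_def by linarith
  next
    case False
    then have small: "(norm H)\<^sup>2 < D1" "g x \<le> B - 1" using noise level by auto
    have y0: "y = 0" using small by (simp add: y_def)
    have y'_d: "y' \<le> max 0 (\<bar>d\<bar> - 1)" using small by (auto simp: y'_def d_def)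
    have "y'\<^sup>2 \<le> \<bar>d\<bar> ^ 3"
    proof (cases "\<bar>d\<bar> \<le> 1")
      case True
      then show ?thesis using y'_d y'_le by simp
    next
      case False
      have "y'\<^sup>2 \<le> \<bar>d\<bar>\<^sup>2" using y'_d y'_le False by (intro power_mono) auto
      also have "\<dots> \<le> \<bar>d\<bar> ^ 3" using False by (intro power_increasing) auto
      finally show ?thesis .
    qed
    also have "\<dots> \<le> ((K * sqrt B) * sqrt (noise_ratio H S)) ^ 3"
    proof (rule power_mono)
      have "sqrt (w x) \<le> sqrt B" using small by (simp add: w_def)
      then have "K * sqrt (noise_ratio H S) * sqrt (w x) \<le> K * sqrt (noise_ratio H S) * sqrt B"
        using K0 G0 by (intro mult_left_mono) auto
      then show "\<bar>d\<bar> \<le> (K * sqrt B) * sqrt (noise_ratio H S)"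
        using d_abs by (simp add: mult_ac)
    qed simp
    also have "\<dots> = (K * sqrt B) ^ 3 * (noise_ratio H S * sqrt (noise_ratio H S))"
      using G0 by (simp add: power_mult_distrib power3_eq_cube)
    also have "\<dots> \<le> (K * sqrt B) ^ 3 * (sqrt \<bar>D1\<bar> * (2 * step_decay H S))"
    proof (rule mult_left_mono)
      have "sqrt (noise_ratio H S) \<le> sqrt (\<bar>D1\<bar> / S)"
        using order_trans[OF G0(2) divide_right_mono[of _ "\<bar>D1\<bar>" S]] small S_pos by simp
      then have "noise_ratio H S * sqrt (noise_ratio H S) \<le> noise_ratio H S * (sqrt \<bar>D1\<bar> / sqrt S)"
        using G0 by (intro mult_left_mono) (auto simp: real_sqrt_divide)
      also have "\<dots> = sqrt \<bar>D1\<bar> * (noise_ratio H S / sqrt S)" by simp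
      also have "\<dots> \<le> sqrt \<bar>D1\<bar> * (2 * step_decay H S)"
        by (intro mult_left_mono noise_ratio_le_step_decay[OF S_pos]) auto
      finally show "noise_ratio H S * sqrt (noise_ratio H S) \<le> sqrt \<bar>D1\<bar> * (2 * step_decay H S)" .
    qed (use K0 \<open>0 \<le> B\<close> in simp)
    finally show ?thesis
      using False y0 by (simp add: y_def[symmetric] y'_def[symmetric] mult_ac)
  qed
qed

end

text \<open>
Time is shifted so that \<open>x n\<close> and \<open>S n\<close> are known at time \<open>n\<close> while \<open>H n\<close> is revealed at time \<open>n + 1\<close>.  The two
conditional moment hypotheses are expressed by integrals against weights known at time \<open>n\<close>.
\<close>

locale adagrad_process = adagrad_noise g grad L \<alpha> S0 \<sigma>0 \<sigma>1 + prob_space M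
  for g :: "'a::euclidean_space \<Rightarrow> real" and grad L \<alpha> S0 \<sigma>0 \<sigma>1 and M :: "'w measure" +
  fixes F :: "nat \<Rightarrow> 'w measure"
    and x H :: "nat \<Rightarrow> 'w \<Rightarrow> 'a" and S :: "nat \<Rightarrow> 'w \<Rightarrow> real"
    and x0 :: 'a and D0 D1 :: real
  assumes subalg: "subalgebra M (F n)"
    and filtration: "m \<le> n \<Longrightarrow> sets (F m) \<subseteq> sets (F n)"
    and x_adapted: "x n \<in> borel_measurable (F n)"
    and S_adapted: "S n \<in> borel_measurable (F n)"
    and H_adapted: "H n \<in> borel_measurable (F (Suc n))"
    and x_0: "\<omega> \<in> space M \<Longrightarrow> x 0 \<omega> = x0"
    and S_0: "\<omega> \<in> space M \<Longrightarrow> S 0 \<omega> = S0"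
    and x_Suc: "\<omega> \<in> space M \<Longrightarrow> x (Suc n) \<omega> = step (x n \<omega>) (H n \<omega>) (S n \<omega>)"
    and S_Suc: "\<omega> \<in> space M \<Longrightarrow> S (Suc n) \<omega> = S n \<omega> + (norm (H n \<omega>))\<^sup>2"
    and unbiased: "h \<in> borel_measurable (F n) \<Longrightarrow> (\<And>\<omega>. \<omega> \<in> space M \<Longrightarrow> norm (h \<omega>) \<le> c) \<Longrightarrow>
      integrable M (H n) \<Longrightarrow> (\<integral>\<omega>. h \<omega> \<bullet> H n \<omega> \<partial>M) = (\<integral>\<omega>. h \<omega> \<bullet> grad (x n \<omega>) \<partial>M)"
    and affine_variance: "f \<in> borel_measurable (F n) \<Longrightarrow>
      (\<integral>\<^sup>+\<omega>. f \<omega> * ennreal ((norm (H n \<omega>))\<^sup>2) \<partial>M)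
        \<le> (\<integral>\<^sup>+\<omega>. f \<omega> * ennreal (\<sigma>0 * (norm (grad (x n \<omega>)))\<^sup>2 + \<sigma>1) \<partial>M)"
    and D0_pos: "D0 > 0"
    and bounded_noise: "AE \<omega> in M. (norm (grad (x n \<omega>)))\<^sup>2 < D0 \<longrightarrow> (norm (H n \<omega>))\<^sup>2 < D1"
    and coercive: "filterlim g at_top at_infinity"
    and nowhere: "interior (closure {g x | x. grad x = 0}) = {}"
    and small_grad_bounded: "\<exists>\<eta>>0. \<exists>B. \<forall>y. (norm (grad y))\<^sup>2 < \<eta> \<longrightarrow> g y \<le> B"
begin

lemma space_F: "space (F n) = space M"
  using subalg[of n] by (simp add: subalgebra_def)

lemma subalg_F: "m \<le> n \<Longrightarrow> subalgebra (F n) (F m)"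
  using filtration space_F by (auto simp: subalgebra_def)

lemma S_ge: "\<omega> \<in> space M \<Longrightarrow> S0 \<le> S n \<omega>"
  by (induction n) (auto simp: S_0 S_Suc intro: add_increasing2)

lemma S_pos: "\<omega> \<in> space M \<Longrightarrow> 0 < S n \<omega>"
  using S_ge[of \<omega> n] S0_pos by linarith

lemma x_M [measurable]: "x n \<in> borel_measurable M"
  by (rule measurable_from_subalg[OF subalg x_adapted])

lemma S_M [measurable]: "S n \<in> borel_measurable M"
  by (rule measurable_from_subalg[OF subalg S_adapted])

lemma H_M [measurable]: "H n \<in> borel_measurable M"
  by (rule measurable_from_subalg[OF subalg H_adapted])

lemma x_bounded: "\<omega> \<in> space M \<Longrightarrow> norm (x n \<omega> - x0) \<le> real n * \<alpha>"
proof (induction n)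
  case (Suc n)
  have "norm (x (Suc n) \<omega> - x n \<omega>) = \<alpha> * sqrt (noise_ratio (H n \<omega>) (S n \<omega>))"
    using norm_step[OF S_pos[OF Suc(2)]] by (simp add: x_Suc Suc)
  also have "\<dots> \<le> \<alpha> * 1"
    using noise_ratio_le_1[OF S_pos[OF Suc(2)]] alpha_pos by (intro mult_left_mono) auto
  finally have "norm (x (Suc n) \<omega> - x n \<omega>) \<le> \<alpha>" by simp
  then show ?case
    using Suc norm_triangle_ineq[of "x (Suc n) \<omega> - x n \<omega>" "x n \<omega> - x0"]
    by (simp add: algebra_simps)
qed (simp add: x_0)

lemma w_bounded: "\<exists>W. \<forall>\<omega>\<in>space M. w (x n \<omega>) \<le> W"
proof -
  have "compact (g ` cball x0 (real n * \<alpha>))"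
    by (intro compact_continuous_image continuous_on_subset[OF continuous_on_g]) auto
  then obtain W where "\<And>y. y \<in> cball x0 (real n * \<alpha>) \<Longrightarrow> g y \<le> W"
    by (meson bounded_imp_bdd_above bdd_above.unfold compact_imp_bounded image_eqI)
  then have "w (x n \<omega>) \<le> 1 + W" if "\<omega> \<in> space M" for \<omega>
    using x_bounded[OF that, of n] by (simp add: w_def dist_norm norm_minus_commute)
  then show ?thesis by blast
qed

text \<open>
Boundedness here is for fixed \<open>n\<close> and without any uniformity; it takes care of all integrability questions, since
the iterate \<open>x n\<close> lies in a deterministic ball.
\<close>

definition bounded_rv :: "nat \<Rightarrow> ('w \<Rightarrow> real) \<Rightarrow> bool" where
  "bounded_rv n f \<longleftrightarrow> f \<in> borel_measurable (F n) \<and> (\<exists>c. \<forall>\<omega>\<in>space M. \<bar>f \<omega>\<bar> \<le> c)"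

lemma bounded_rvI:
  "f \<in> borel_measurable (F n) \<Longrightarrow> (\<And>\<omega>. \<omega> \<in> space M \<Longrightarrow> \<bar>f \<omega>\<bar> \<le> c) \<Longrightarrow> bounded_rv n f"
  unfolding bounded_rv_def by blast

lemma bounded_rv_integrable:
  assumes "bounded_rv n f"
  shows "integrable M f"
proof -
  obtain c where c: "\<And>\<omega>. \<omega> \<in> space M \<Longrightarrow> \<bar>f \<omega>\<bar> \<le> c" using assms by (auto simp: bounded_rv_def)
  show ?thesis
  proof (rule integrable_const_bound[where B=c])
    show "f \<in> borel_measurable M"
      using assms measurable_from_subalg[OF subalg] by (auto simp: bounded_rv_def)
  qed (use c in auto)
qed

lemma bounded_rv_const: "bounded_rv n (\<lambda>_. c)"
  by (rule bounded_rvI[where c="\<bar>c\<bar>"]) auto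

lemma bounded_rv_add:
  assumes "bounded_rv n f" "bounded_rv n h"
  shows "bounded_rv n (\<lambda>\<omega>. f \<omega> + h \<omega>)"
proof -
  obtain a b where "\<And>\<omega>. \<omega> \<in> space M \<Longrightarrow> \<bar>f \<omega>\<bar> \<le> a" "\<And>\<omega>. \<omega> \<in> space M \<Longrightarrow> \<bar>h \<omega>\<bar> \<le> b"
    using assms by (auto simp: bounded_rv_def)
  then have "\<bar>f \<omega> + h \<omega>\<bar> \<le> a + b" if "\<omega> \<in> space M" for \<omega>
    using that by (meson abs_triangle_ineq add_mono order_trans)
  moreover have "(\<lambda>\<omega>. f \<omega> + h \<omega>) \<in> borel_measurable (F n)"
    using assms by (intro borel_measurable_add) (auto simp: bounded_rv_def)
  ultimately show ?thesis by (rule bounded_rvI[rotated])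
qed

lemma bounded_rv_mult:
  assumes "bounded_rv n f" "bounded_rv n h"
  shows "bounded_rv n (\<lambda>\<omega>. f \<omega> * h \<omega>)"
proof -
  obtain a b where "\<And>\<omega>. \<omega> \<in> space M \<Longrightarrow> \<bar>f \<omega>\<bar> \<le> a" "\<And>\<omega>. \<omega> \<in> space M \<Longrightarrow> \<bar>h \<omega>\<bar> \<le> b"
    using assms by (auto simp: bounded_rv_def)
  then have "\<bar>f \<omega> * h \<omega>\<bar> \<le> a * b" if "\<omega> \<in> space M" for \<omega>
    using that unfolding abs_mult by (intro mult_mono) (auto intro: order_trans[OF abs_ge_zero])
  moreover have "(\<lambda>\<omega>. f \<omega> * h \<omega>) \<in> borel_measurable (F n)"
    using assms by (intro borel_measurable_times) (auto simp: bounded_rv_def)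
  ultimately show ?thesis by (rule bounded_rvI[rotated])
qed

lemma bounded_rv_power: "bounded_rv n f \<Longrightarrow> bounded_rv n (\<lambda>\<omega>. f \<omega> ^ k)"
  by (induction k) (auto intro: bounded_rv_const bounded_rv_mult)

lemma bounded_rv_w: "bounded_rv n (\<lambda>\<omega>. w (x n \<omega>))"
proof -
  obtain W where "\<forall>\<omega>\<in>space M. w (x n \<omega>) \<le> W" using w_bounded by blast
  then have "\<bar>w (x n \<omega>)\<bar> \<le> W" if "\<omega> \<in> space M" for \<omega>
    using that w_ge_1[of "x n \<omega>"] by auto
  moreover have "(\<lambda>\<omega>. w (x n \<omega>)) \<in> borel_measurable (F n)"
    by (rule measurable_compose[OF x_adapted w_borel])
  ultimately show ?thesis by (rule bounded_rvI[rotated])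
qed

lemma bounded_rv_g: "bounded_rv n (\<lambda>\<omega>. g (x n \<omega>))"
  using bounded_rv_add[OF bounded_rv_w bounded_rv_const[of n "-1"]] by (simp add: w_def)

lemma bounded_rv_dominated:
  assumes "f \<in> borel_measurable (F n)" "bounded_rv n h" "\<And>\<omega>. \<omega> \<in> space M \<Longrightarrow> \<bar>f \<omega>\<bar> \<le> h \<omega>"
  shows "bounded_rv n f"
proof -
  obtain c where "\<And>\<omega>. \<omega> \<in> space M \<Longrightarrow> \<bar>h \<omega>\<bar> \<le> c" using assms(2) by (auto simp: bounded_rv_def)
  then show ?thesis
    using assms(1,3) by (intro bounded_rvI[where c=c]) (auto intro: order_trans[OF _ order_trans[OF abs_ge_self]])
qed

lemma grad_x_adapted: "(\<lambda>\<omega>. grad (x n \<omega>)) \<in> borel_measurable (F n)"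
  by (rule measurable_compose[OF x_adapted grad_borel])

lemma bounded_rv_grad: "bounded_rv n (\<lambda>\<omega>. norm (grad (x n \<omega>)))"
proof (rule bounded_rv_dominated[OF _ bounded_rv_mult[OF bounded_rv_const[of n "sqrt (2 * L)"] bounded_rv_w]])
  have [measurable]: "(\<lambda>\<omega>. grad (x n \<omega>)) \<in> borel_measurable (F n)" by (rule grad_x_adapted)
  show "(\<lambda>\<omega>. norm (grad (x n \<omega>))) \<in> borel_measurable (F n)" by measurable
qed (simp add: norm_grad_le_w)

lemma bounded_rv_inverse_S: "bounded_rv n (\<lambda>\<omega>. 1 / S n \<omega>)"
proof (rule bounded_rvI[where c="1 / S0"])
  show "\<bar>1 / S n \<omega>\<bar> \<le> 1 / S0" if "\<omega> \<in> space M" for \<omega>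
    using S_ge[OF that, of n] S0_pos by (simp add: frac_le)
qed (intro borel_measurable_divide S_adapted borel_measurable_const)

lemma bounded_rv_inverse_sqrt_S: "bounded_rv n (\<lambda>\<omega>. 1 / sqrt (S n \<omega>))"
proof (rule bounded_rvI[where c="1 / sqrt S0"])
  show "\<bar>1 / sqrt (S n \<omega>)\<bar> \<le> 1 / sqrt S0" if "\<omega> \<in> space M" for \<omega>
    using S_ge[OF that, of n] S0_pos by (simp add: frac_le)
  have [measurable]: "S n \<in> borel_measurable (F n)" by (rule S_adapted)
  show "(\<lambda>\<omega>. 1 / sqrt (S n \<omega>)) \<in> borel_measurable (F n)" by measurable
qed

lemma bounded_rv_inverse_q: "bounded_rv n (\<lambda>\<omega>. 1 / q (x n \<omega>))"
proof (rule bounded_rvI[where c=1])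
  show "\<bar>1 / q (x n \<omega>)\<bar> \<le> 1" for \<omega>
    using q_ge_1[of "x n \<omega>"] by simp
qed (intro borel_measurable_divide borel_measurable_const measurable_compose[OF x_adapted q_borel])

lemma bounded_rv_level: "bounded_rv n (\<lambda>\<omega>. of_bool (\<nu> \<le> (norm (grad (x n \<omega>)))\<^sup>2))"
proof (rule bounded_rvI[where c=1])
  have [measurable]: "(\<lambda>\<omega>. grad (x n \<omega>)) \<in> borel_measurable (F n)" by (rule grad_x_adapted)
  show "(\<lambda>\<omega>. of_bool (\<nu> \<le> (norm (grad (x n \<omega>)))\<^sup>2) :: real) \<in> borel_measurable (F n)"
    unfolding of_bool_def by measurable
qed auto

lemma bounded_rv_excess: "bounded_rv n (\<lambda>\<omega>. max 0 (g (x n \<omega>) - B))"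
proof (rule bounded_rv_dominated[OF _ bounded_rv_add[OF bounded_rv_g bounded_rv_const[of n "\<bar>B\<bar>"]]])
  show "(\<lambda>\<omega>. max 0 (g (x n \<omega>) - B)) \<in> borel_measurable (F n)"
    by (intro borel_measurable_max borel_measurable_diff borel_measurable_const
        measurable_compose[OF x_adapted g_borel])
qed (auto simp: g_nonneg max_def)

lemma bounded_rv_step_decay: "bounded_rv (Suc n) (\<lambda>\<omega>. step_decay (H n \<omega>) (S n \<omega>))"
proof (rule bounded_rvI[where c="1 / sqrt S0"])
  have [measurable]: "S n \<in> borel_measurable (F (Suc n))" "H n \<in> borel_measurable (F (Suc n))"
    using measurable_from_subalg[OF subalg_F S_adapted] H_adapted by auto
  show "(\<lambda>\<omega>. step_decay (H n \<omega>) (S n \<omega>)) \<in> borel_measurable (F (Suc n))"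
    unfolding step_decay_def by measurable
  fix \<omega> assume \<omega>: "\<omega> \<in> space M"
  have "step_decay (H n \<omega>) (S n \<omega>) \<le> 1 / sqrt (S n \<omega>)"
    using S_pos[OF \<omega>, of n] by (simp add: step_decay_def)
  also have "\<dots> \<le> 1 / sqrt S0"
    using S_ge[OF \<omega>, of n] S0_pos by (simp add: frac_le)
  finally show "\<bar>step_decay (H n \<omega>) (S n \<omega>)\<bar> \<le> 1 / sqrt S0"
    using step_decay_nonneg[OF S_pos[OF \<omega>]] by simp
qed

lemma expected_step_decay_sum: "(\<Sum>k<n. \<integral>\<omega>. step_decay (H k \<omega>) (S k \<omega>) \<partial>M) \<le> 1 / sqrt S0"
proof -
  have int: "integrable M (\<lambda>\<omega>. step_decay (H k \<omega>) (S k \<omega>))" for k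
    by (rule bounded_rv_integrable[OF bounded_rv_step_decay])
  have "(\<Sum>k<n. step_decay (H k \<omega>) (S k \<omega>)) \<le> 1 / sqrt S0" if \<omega>: "\<omega> \<in> space M" for \<omega>
  proof -
    have "(\<Sum>k<n. step_decay (H k \<omega>) (S k \<omega>)) = (\<Sum>k<n. 1 / sqrt (S k \<omega>) - 1 / sqrt (S (Suc k) \<omega>))"
      by (simp add: step_decay_def S_Suc[OF \<omega>])
    also have "\<dots> = 1 / sqrt (S 0 \<omega>) - 1 / sqrt (S n \<omega>)"
      by (rule sum_lessThan_telescope')
    finally show ?thesis using S_pos[OF \<omega>, of n] by (simp add: S_0[OF \<omega>])
  qed
  then have "(\<integral>\<omega>. (\<Sum>k<n. step_decay (H k \<omega>) (S k \<omega>)) \<partial>M) \<le> (\<integral>\<omega>. 1 / sqrt S0 \<partial>M)"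
    by (intro integral_mono) (auto intro!: Bochner_Integration.integrable_sum int)
  then show ?thesis using int by (simp add: prob_space)
qed

lemma expected_noise:
  assumes f: "bounded_rv n f" and nonneg: "\<And>\<omega>. \<omega> \<in> space M \<Longrightarrow> 0 \<le> f \<omega>"
  shows "integrable M (\<lambda>\<omega>. f \<omega> * (norm (H n \<omega>))\<^sup>2)"
    and "(\<integral>\<omega>. f \<omega> * (norm (H n \<omega>))\<^sup>2 \<partial>M)
      \<le> (\<integral>\<omega>. f \<omega> * (\<sigma>0 * (norm (grad (x n \<omega>)))\<^sup>2 + \<sigma>1) \<partial>M)"
proof -
  have f_meas: "f \<in> borel_measurable (F n)" using f by (simp add: bounded_rv_def)
  have [measurable]: "f \<in> borel_measurable M" by (rule measurable_from_subalg[OF subalg f_meas])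
  define R where "R \<omega> = f \<omega> * (\<sigma>0 * (norm (grad (x n \<omega>)))\<^sup>2 + \<sigma>1)" for \<omega>
  have "bounded_rv n R"
    unfolding R_def[abs_def]
    by (intro bounded_rv_mult f bounded_rv_add bounded_rv_const bounded_rv_power bounded_rv_grad)
  then have R: "integrable M R" by (rule bounded_rv_integrable)
  have R0: "0 \<le> R \<omega>" if "\<omega> \<in> space M" for \<omega>
    using nonneg[OF that] sigma0 sigma1 by (simp add: R_def)
  have "(\<integral>\<^sup>+\<omega>. ennreal (f \<omega> * (norm (H n \<omega>))\<^sup>2) \<partial>M) = (\<integral>\<^sup>+\<omega>. ennreal (f \<omega>) * ennreal ((norm (H n \<omega>))\<^sup>2) \<partial>M)"
    by (rule nn_integral_cong) (simp add: ennreal_mult nonneg)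
  also have "\<dots> \<le> (\<integral>\<^sup>+\<omega>. ennreal (f \<omega>) * ennreal (\<sigma>0 * (norm (grad (x n \<omega>)))\<^sup>2 + \<sigma>1) \<partial>M)"
    by (rule affine_variance) (use f_meas in measurable)
  also have "\<dots> = (\<integral>\<^sup>+\<omega>. ennreal (R \<omega>) \<partial>M)"
    by (rule nn_integral_cong) (use sigma0 sigma1 nonneg in \<open>simp add: R_def ennreal_mult\<close>)
  also have "\<dots> = ennreal (\<integral>\<omega>. R \<omega> \<partial>M)"
    by (rule nn_integral_eq_integral[OF R]) (use R0 in auto)
  finally have le: "(\<integral>\<^sup>+\<omega>. ennreal (f \<omega> * (norm (H n \<omega>))\<^sup>2) \<partial>M) \<le> ennreal (\<integral>\<omega>. R \<omega> \<partial>M)" .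
  show int: "integrable M (\<lambda>\<omega>. f \<omega> * (norm (H n \<omega>))\<^sup>2)"
  proof (rule integrableI_nonneg)
    show "(\<integral>\<^sup>+\<omega>. ennreal (f \<omega> * (norm (H n \<omega>))\<^sup>2) \<partial>M) < \<infinity>"
      using le by (simp add: order_le_less_trans)
  qed (use nonneg in auto)
  have "(\<integral>\<^sup>+\<omega>. ennreal (f \<omega> * (norm (H n \<omega>))\<^sup>2) \<partial>M) = ennreal (\<integral>\<omega>. f \<omega> * (norm (H n \<omega>))\<^sup>2 \<partial>M)"
    by (rule nn_integral_eq_integral[OF int]) (use nonneg in auto)
  with le have "ennreal (\<integral>\<omega>. f \<omega> * (norm (H n \<omega>))\<^sup>2 \<partial>M) \<le> ennreal (\<integral>\<omega>. R \<omega> \<partial>M)" by simp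
  moreover have "0 \<le> (\<integral>\<omega>. R \<omega> \<partial>M)" by (rule integral_nonneg_AE) (use R0 in auto)
  ultimately show "(\<integral>\<omega>. f \<omega> * (norm (H n \<omega>))\<^sup>2 \<partial>M)
      \<le> (\<integral>\<omega>. f \<omega> * (\<sigma>0 * (norm (grad (x n \<omega>)))\<^sup>2 + \<sigma>1) \<partial>M)"
    by (simp add: R_def[abs_def])
qed

lemma H_square_integrable: "integrable M (\<lambda>\<omega>. (norm (H n \<omega>))\<^sup>2)"
  using expected_noise(1)[OF bounded_rv_const[of n 1]] by simp

lemma H_integrable: "integrable M (H n)"
proof -
  have "integrable M (\<lambda>\<omega>. norm (H n \<omega>))"
    by (rule square_integrable_imp_integrable) (use H_square_integrable in auto)
  then show ?thesis by (simp add: integrable_norm_iff)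
qed

lemma integrable_bounded_inner:
  assumes h: "h \<in> borel_measurable M" and bound: "\<And>\<omega>. \<omega> \<in> space M \<Longrightarrow> norm (h \<omega> :: 'a) \<le> c"
  shows "integrable M (\<lambda>\<omega>. h \<omega> \<bullet> H n \<omega>)"
proof (rule Bochner_Integration.integrable_bound[OF integrable_mult_right[OF integrable_norm[OF H_integrable[of n]], of c]])
  show "(\<lambda>\<omega>. h \<omega> \<bullet> H n \<omega>) \<in> borel_measurable M" using h by measurable
  show "AE \<omega> in M. norm (h \<omega> \<bullet> H n \<omega>) \<le> norm (c * norm (H n \<omega>))"
  proof (rule AE_I2)
    fix \<omega> assume \<omega>: "\<omega> \<in> space M"
    have "norm (h \<omega> \<bullet> H n \<omega>) \<le> norm (h \<omega>) * norm (H n \<omega>)" using Cauchy_Schwarz_ineq2 by auto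
    also have "\<dots> \<le> c * norm (H n \<omega>)" using bound[OF \<omega>] by (intro mult_right_mono) auto
    finally show "norm (h \<omega> \<bullet> H n \<omega>) \<le> norm (c * norm (H n \<omega>))" by simp
  qed
qed

lemma expected_grad_inner:
  assumes f: "bounded_rv n f"
  shows "integrable M (\<lambda>\<omega>. f \<omega> * (grad (x n \<omega>) \<bullet> H n \<omega>))"
    and "(\<integral>\<omega>. f \<omega> * (grad (x n \<omega>) \<bullet> H n \<omega>) \<partial>M) = (\<integral>\<omega>. f \<omega> * (norm (grad (x n \<omega>)))\<^sup>2 \<partial>M)"
proof -
  define h where "h \<omega> = f \<omega> *\<^sub>R grad (x n \<omega>)" for \<omega>
  have "bounded_rv n (\<lambda>\<omega>. f \<omega> * norm (grad (x n \<omega>)))"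
    by (intro bounded_rv_mult f bounded_rv_grad)
  then obtain c where "\<And>\<omega>. \<omega> \<in> space M \<Longrightarrow> \<bar>f \<omega> * norm (grad (x n \<omega>))\<bar> \<le> c"
    by (auto simp: bounded_rv_def)
  then have c: "\<And>\<omega>. \<omega> \<in> space M \<Longrightarrow> norm (h \<omega>) \<le> c" by (simp add: h_def abs_mult)
  have h: "h \<in> borel_measurable (F n)"
    unfolding h_def[abs_def] using f by (intro borel_measurable_scaleR grad_x_adapted) (auto simp: bounded_rv_def)
  show "integrable M (\<lambda>\<omega>. f \<omega> * (grad (x n \<omega>) \<bullet> H n \<omega>))"
    using integrable_bounded_inner[OF measurable_from_subalg[OF subalg h] c] by (simp add: h_def)
  show "(\<integral>\<omega>. f \<omega> * (grad (x n \<omega>) \<bullet> H n \<omega>) \<partial>M) = (\<integral>\<omega>. f \<omega> * (norm (grad (x n \<omega>)))\<^sup>2 \<partial>M)"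
    using unbiased[OF h c H_integrable] by (simp add: h_def dot_square_norm)
qed

text \<open>
The energy whose total expectation is finite.
\<close>

definition descent :: "nat \<Rightarrow> 'w \<Rightarrow> real" where
  "descent n \<omega> = (w (x n \<omega>))\<^sup>2 * (norm (grad (x n \<omega>)))\<^sup>2 * (1 / S n \<omega>)"

lemma bounded_rv_descent: "bounded_rv n (descent n)"
  unfolding descent_def[abs_def]
  by (intro bounded_rv_mult bounded_rv_power bounded_rv_w bounded_rv_grad bounded_rv_inverse_S)

lemma descent_nonneg: "\<omega> \<in> space M \<Longrightarrow> 0 \<le> descent n \<omega>"
  using S_pos[of \<omega> n] by (simp add: descent_def)

lemma integrable_descent: "integrable M (descent n)"
  by (rule bounded_rv_integrable[OF bounded_rv_descent])

lemma bounded_rv_lyapunov: "bounded_rv n (\<lambda>\<omega>. lyapunov (x n \<omega>) (S n \<omega>))"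
proof -
  have "bounded_rv n (\<lambda>\<omega>. (w (x n \<omega>)) ^ 3 * (1 / sqrt (S n \<omega>)) +
      corr_coeff * ((w (x n \<omega>) * norm (grad (x n \<omega>)))\<^sup>2 * (1 / S n \<omega>)))"
    by (intro bounded_rv_add bounded_rv_mult bounded_rv_power bounded_rv_const bounded_rv_w
        bounded_rv_grad bounded_rv_inverse_S bounded_rv_inverse_sqrt_S)
  then show ?thesis by (simp add: lyapunov_def)
qed

text \<open>
The expectations of the Lyapunov function are non-negative and decrease by \<open>\<alpha>\<close> times the expected descent, up to
expected decays with a finite sum.
\<close>

lemma expected_descent_sum: "\<exists>C. \<forall>n. (\<Sum>k<n. \<integral>\<omega>. descent k \<omega> \<partial>M) \<le> C"
proof -
  obtain C where C: "C \<ge> 0"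
    "\<And>x H S. S \<ge> S0 \<Longrightarrow>
      lyapunov (step x H S) (S + (norm H)\<^sup>2) \<le> lyapunov x S
        - 3 * \<alpha> * (w x)\<^sup>2 / S * (grad x \<bullet> H)
        + 3 * \<alpha> / 2 * ((w x)\<^sup>2 * (norm (grad x))\<^sup>2 / (q x * S)) * (norm H)\<^sup>2
        + \<alpha> / 2 * ((w x)\<^sup>2 * (norm (grad x))\<^sup>2 / S) + C * step_decay H S"
    using lyapunov_step by blast
  define V where "V n = (\<integral>\<omega>. lyapunov (x n \<omega>) (S n \<omega>) \<partial>M)" for n
  have drift: "V (Suc n) \<le> V n - \<alpha> * (\<integral>\<omega>. descent n \<omega> \<partial>M) + C * (\<integral>\<omega>. step_decay (H n \<omega>) (S n \<omega>) \<partial>M)" for n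
  proof -
    define f1 where "f1 \<omega> = 3 * \<alpha> * ((w (x n \<omega>))\<^sup>2 * (1 / S n \<omega>))" for \<omega>
    define f2 where "f2 \<omega> = 3 * \<alpha> / 2 * (descent n \<omega> * (1 / q (x n \<omega>)))" for \<omega>
    have f1: "bounded_rv n f1" unfolding f1_def[abs_def]
      by (intro bounded_rv_mult bounded_rv_const bounded_rv_power bounded_rv_w bounded_rv_inverse_S)
    have f2: "bounded_rv n f2" unfolding f2_def[abs_def]
      by (intro bounded_rv_mult bounded_rv_const bounded_rv_descent bounded_rv_inverse_q)
    have f2_nonneg: "0 \<le> f2 \<omega>" if "\<omega> \<in> space M" for \<omega>
      using alpha_pos descent_nonneg[OF that, of n] q_ge_1[of "x n \<omega>"] by (simp add: f2_def)
    have i1: "integrable M (\<lambda>\<omega>. lyapunov (x n \<omega>) (S n \<omega>))" "integrable M (\<lambda>\<omega>. lyapunov (x (Suc n) \<omega>) (S (Suc n) \<omega>))"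
      "integrable M (descent n)"
      by (rule bounded_rv_integrable, rule bounded_rv_lyapunov bounded_rv_descent)+
    have i2: "integrable M (\<lambda>\<omega>. f1 \<omega> * (grad (x n \<omega>) \<bullet> H n \<omega>))" by (rule expected_grad_inner(1)[OF f1])
    have i3: "integrable M (\<lambda>\<omega>. f2 \<omega> * (norm (H n \<omega>))\<^sup>2)" by (rule expected_noise(1)[OF f2 f2_nonneg])
    have i4: "integrable M (\<lambda>\<omega>. step_decay (H n \<omega>) (S n \<omega>))" by (rule bounded_rv_integrable[OF bounded_rv_step_decay])
    have "V (Suc n) \<le> (\<integral>\<omega>. lyapunov (x n \<omega>) (S n \<omega>) - f1 \<omega> * (grad (x n \<omega>) \<bullet> H n \<omega>)
        + f2 \<omega> * (norm (H n \<omega>))\<^sup>2 + \<alpha> / 2 * descent n \<omega> + C * step_decay (H n \<omega>) (S n \<omega>) \<partial>M)"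
      unfolding V_def
    proof (rule integral_mono)
      show "integrable M (\<lambda>\<omega>. lyapunov (x n \<omega>) (S n \<omega>) - f1 \<omega> * (grad (x n \<omega>) \<bullet> H n \<omega>)
        + f2 \<omega> * (norm (H n \<omega>))\<^sup>2 + \<alpha> / 2 * descent n \<omega> + C * step_decay (H n \<omega>) (S n \<omega>))"
        by (intro Bochner_Integration.integrable_add Bochner_Integration.integrable_diff integrable_mult_right i1 i2 i3 i4)
      fix \<omega> assume \<omega>: "\<omega> \<in> space M"
      show "lyapunov (x (Suc n) \<omega>) (S (Suc n) \<omega>) \<le> lyapunov (x n \<omega>) (S n \<omega>) - f1 \<omega> * (grad (x n \<omega>) \<bullet> H n \<omega>)
        + f2 \<omega> * (norm (H n \<omega>))\<^sup>2 + \<alpha> / 2 * descent n \<omega> + C * step_decay (H n \<omega>) (S n \<omega>)"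
        using C(2)[OF S_ge[OF \<omega>, of n], of "x n \<omega>" "H n \<omega>"] by (simp add: x_Suc[OF \<omega>] S_Suc[OF \<omega>] f1_def f2_def descent_def mult.commute[of "S n \<omega>"])
    qed (rule i1)
    also have "\<dots> = V n - (\<integral>\<omega>. f1 \<omega> * (grad (x n \<omega>) \<bullet> H n \<omega>) \<partial>M) + (\<integral>\<omega>. f2 \<omega> * (norm (H n \<omega>))\<^sup>2 \<partial>M)
        + \<alpha> / 2 * (\<integral>\<omega>. descent n \<omega> \<partial>M) + C * (\<integral>\<omega>. step_decay (H n \<omega>) (S n \<omega>) \<partial>M)"
      using i1 i2 i3 i4 by (simp add: V_def)
    also have "(\<integral>\<omega>. f1 \<omega> * (grad (x n \<omega>) \<bullet> H n \<omega>) \<partial>M) = (\<integral>\<omega>. 3 * \<alpha> * descent n \<omega> \<partial>M)"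
      unfolding expected_grad_inner(2)[OF f1] by (rule Bochner_Integration.integral_cong) (auto simp: f1_def descent_def)
    also have "\<dots> = 3 * \<alpha> * (\<integral>\<omega>. descent n \<omega> \<partial>M)"
      by simp
    also have "(\<integral>\<omega>. f2 \<omega> * (norm (H n \<omega>))\<^sup>2 \<partial>M) \<le> (\<integral>\<omega>. 3 * \<alpha> / 2 * descent n \<omega> \<partial>M)"
    proof (rule order_trans[OF expected_noise(2)[OF f2 f2_nonneg] integral_mono])
      show "integrable M (\<lambda>\<omega>. f2 \<omega> * (\<sigma>0 * (norm (grad (x n \<omega>)))\<^sup>2 + \<sigma>1))"
        by (intro bounded_rv_integrable[of n] bounded_rv_mult f2 bounded_rv_add bounded_rv_const bounded_rv_power bounded_rv_grad)
      show "integrable M (\<lambda>\<omega>. 3 * \<alpha> / 2 * descent n \<omega>)" by (intro integrable_mult_right i1)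
      fix \<omega> assume \<omega>: "\<omega> \<in> space M"
      have "(1 / q (x n \<omega>)) * (\<sigma>0 * (norm (grad (x n \<omega>)))\<^sup>2 + \<sigma>1) \<le> 1"
        using q_ge_1[of "x n \<omega>"] by (simp add: divide_le_eq) (simp add: q_def)
      then have "3 * \<alpha> / 2 * descent n \<omega> * ((1 / q (x n \<omega>)) * (\<sigma>0 * (norm (grad (x n \<omega>)))\<^sup>2 + \<sigma>1))
          \<le> 3 * \<alpha> / 2 * descent n \<omega> * 1"
        using alpha_pos descent_nonneg[OF \<omega>, of n] by (intro mult_left_mono) auto
      then show "f2 \<omega> * (\<sigma>0 * (norm (grad (x n \<omega>)))\<^sup>2 + \<sigma>1) \<le> 3 * \<alpha> / 2 * descent n \<omega>"
        unfolding f2_def by (simp only: mult.assoc mult_1_right)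
    qed auto
    also have "\<dots> = 3 * \<alpha> / 2 * (\<integral>\<omega>. descent n \<omega> \<partial>M)"
      by simp
    finally show ?thesis by (simp add: algebra_simps)
  qed
  have V0: "0 \<le> V n" for n
    unfolding V_def by (rule integral_nonneg_AE) (use S_pos lyapunov_nonneg in auto)
  have tele: "V n + \<alpha> * (\<Sum>k<n. \<integral>\<omega>. descent k \<omega> \<partial>M) \<le> V 0 + C * (\<Sum>k<n. \<integral>\<omega>. step_decay (H k \<omega>) (S k \<omega>) \<partial>M)" for n
  proof (induction n)
    case (Suc n)
    then show ?case using drift[of n] by (simp add: distrib_left)
  qed simp
  have "(\<Sum>k<n. \<integral>\<omega>. descent k \<omega> \<partial>M) \<le> (V 0 + C * (1 / sqrt S0)) / \<alpha>" for n
  proof -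
    have "\<alpha> * (\<Sum>k<n. \<integral>\<omega>. descent k \<omega> \<partial>M) \<le> V 0 + C * (1 / sqrt S0)"
      using tele[of n] V0[of n] mult_left_mono[OF expected_step_decay_sum[of n] C(1)] by linarith
    then show ?thesis using alpha_pos by (simp add: field_simps)
  qed
  then show ?thesis by blast
qed

definition level_weight :: "real \<Rightarrow> nat \<Rightarrow> 'w \<Rightarrow> real" where
  "level_weight \<nu> n \<omega> = of_bool (\<nu> \<le> (norm (grad (x n \<omega>)))\<^sup>2) * (w (x n \<omega>))\<^sup>2 * (1 / S n \<omega>)"

lemma bounded_rv_level_weight: "bounded_rv n (level_weight \<nu> n)"
  unfolding level_weight_def[abs_def]
  by (intro bounded_rv_mult bounded_rv_level bounded_rv_power bounded_rv_w bounded_rv_inverse_S)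

lemma level_weight_nonneg: "\<omega> \<in> space M \<Longrightarrow> 0 \<le> level_weight \<nu> n \<omega>"
  using S_pos[of \<omega> n] by (simp add: level_weight_def)

lemma integrable_level_noise: "integrable M (\<lambda>\<omega>. level_weight \<nu> n \<omega> * (norm (H n \<omega>))\<^sup>2)"
  by (rule expected_noise(1)[OF bounded_rv_level_weight level_weight_nonneg])

text \<open>
Where \<open>\<nu> \<le> (norm (grad x))\<^sup>2\<close>, the constant \<open>\<sigma>1\<close> in the variance bound is at most \<open>\<sigma>1 / \<nu>\<close> times the square of the gradient, so the noise is
dominated by the descent.
\<close>

lemma expected_level_noise_sum:
  assumes "\<nu> > 0"
  shows "\<exists>C. \<forall>n. (\<Sum>k<n. \<integral>\<omega>. level_weight \<nu> k \<omega> * (norm (H k \<omega>))\<^sup>2 \<partial>M) \<le> C"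
proof -
  obtain C where C: "\<And>n. (\<Sum>k<n. \<integral>\<omega>. descent k \<omega> \<partial>M) \<le> C" using expected_descent_sum by blast
  define r where "r = \<sigma>0 + \<sigma>1 / \<nu>"
  have r: "0 \<le> r" using sigma0 sigma1 assms by (simp add: r_def)
  have "(\<integral>\<omega>. level_weight \<nu> k \<omega> * (norm (H k \<omega>))\<^sup>2 \<partial>M) \<le> r * (\<integral>\<omega>. descent k \<omega> \<partial>M)" for k
  proof -
    have "(\<integral>\<omega>. level_weight \<nu> k \<omega> * (norm (H k \<omega>))\<^sup>2 \<partial>M)
        \<le> (\<integral>\<omega>. level_weight \<nu> k \<omega> * (\<sigma>0 * (norm (grad (x k \<omega>)))\<^sup>2 + \<sigma>1) \<partial>M)"
      by (rule expected_noise(2)[OF bounded_rv_level_weight level_weight_nonneg])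
    also have "\<dots> \<le> (\<integral>\<omega>. r * descent k \<omega> \<partial>M)"
    proof (rule integral_mono)
      show "integrable M (\<lambda>\<omega>. level_weight \<nu> k \<omega> * (\<sigma>0 * (norm (grad (x k \<omega>)))\<^sup>2 + \<sigma>1))"
        by (intro bounded_rv_integrable[of k] bounded_rv_mult[of k "level_weight \<nu> k"] bounded_rv_level_weight
            bounded_rv_add bounded_rv_mult bounded_rv_const bounded_rv_power bounded_rv_grad)
      show "integrable M (\<lambda>\<omega>. r * descent k \<omega>)" by (intro integrable_mult_right integrable_descent)
      fix \<omega> assume \<omega>: "\<omega> \<in> space M"
      show "level_weight \<nu> k \<omega> * (\<sigma>0 * (norm (grad (x k \<omega>)))\<^sup>2 + \<sigma>1) \<le> r * descent k \<omega>"
      proof (cases "\<nu> \<le> (norm (grad (x k \<omega>)))\<^sup>2")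
        case True
        have "\<sigma>1 * \<nu> \<le> \<sigma>1 * (norm (grad (x k \<omega>)))\<^sup>2" using True sigma1 by (rule mult_left_mono)
        then have "\<sigma>0 * (norm (grad (x k \<omega>)))\<^sup>2 + \<sigma>1 \<le> r * (norm (grad (x k \<omega>)))\<^sup>2"
          using assms by (simp add: r_def field_simps)
        then have "level_weight \<nu> k \<omega> * (\<sigma>0 * (norm (grad (x k \<omega>)))\<^sup>2 + \<sigma>1)
            \<le> level_weight \<nu> k \<omega> * (r * (norm (grad (x k \<omega>)))\<^sup>2)"
          by (intro mult_left_mono level_weight_nonneg \<omega>)
        then show ?thesis using True by (simp add: level_weight_def descent_def mult_ac)
      next
        case False
        then show ?thesis using mult_nonneg_nonneg[OF r descent_nonneg[OF \<omega>, of k]] by (simp add: level_weight_def)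
      qed
    qed
    also have "\<dots> = r * (\<integral>\<omega>. descent k \<omega> \<partial>M)" by simp
    finally show ?thesis .
  qed
  then have "(\<Sum>k<n. \<integral>\<omega>. level_weight \<nu> k \<omega> * (norm (H k \<omega>))\<^sup>2 \<partial>M) \<le> r * C" for n
  proof -
    assume le: "\<And>k. (\<integral>\<omega>. level_weight \<nu> k \<omega> * (norm (H k \<omega>))\<^sup>2 \<partial>M) \<le> r * (\<integral>\<omega>. descent k \<omega> \<partial>M)"
    have "(\<Sum>k<n. \<integral>\<omega>. level_weight \<nu> k \<omega> * (norm (H k \<omega>))\<^sup>2 \<partial>M) \<le> (\<Sum>k<n. r * (\<integral>\<omega>. descent k \<omega> \<partial>M))"
      by (rule sum_mono) (rule le)
    also have "\<dots> \<le> r * C"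
      unfolding sum_distrib_left[symmetric] using C r by (intro mult_left_mono)
    finally show ?thesis .
  qed
  then show ?thesis by blast
qed

section \<open>Uniform integrability\<close>

text \<open>
The level \<open>B\<close> is chosen so high that below the threshold \<open>\<nu>\<close> for the squared gradient both the noise is bounded and \<open>g\<close> is at most \<open>B - 1\<close>.
The drift term has a favourable sign, and the errors of \<open>excess_step\<close> have summable expectations.
\<close>

lemma expected_excess_bounded: "\<exists>B C. 0 \<le> B \<and> (\<forall>n. (\<integral>\<omega>. (max 0 (g (x n \<omega>) - B))\<^sup>2 \<partial>M) \<le> C)"
proof -
  obtain \<eta> B' where \<eta>: "\<eta> > 0" "\<And>y. (norm (grad y))\<^sup>2 < \<eta> \<Longrightarrow> g y \<le> B'"
    using small_grad_bounded by blast
  define \<nu> where "\<nu> = min \<eta> D0"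
  define B where "B = \<bar>B'\<bar> + 1"
  have \<nu>: "\<nu> > 0" "\<nu> \<le> D0" using \<eta>(1) D0_pos by (auto simp: \<nu>_def)
  have B: "0 \<le> B" "\<And>y. (norm (grad y))\<^sup>2 < \<nu> \<Longrightarrow> g y \<le> B - 1"
    using \<eta>(2) by (auto simp: B_def \<nu>_def intro: order_trans[OF _ abs_ge_self])
  obtain C where C: "\<And>n. (\<Sum>k<n. \<integral>\<omega>. level_weight \<nu> k \<omega> * (norm (H k \<omega>))\<^sup>2 \<partial>M) \<le> C"
    using expected_level_noise_sum[OF \<nu>(1)] by blast
  define a where "a = 2 * K5 + K\<^sup>2"
  define b where "b = 2 * (K * sqrt B) ^ 3 * sqrt \<bar>D1\<bar>"
  have ab: "0 \<le> a" "0 \<le> b" using K5_pos K_pos B by (auto simp: a_def b_def)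
  define V where "V n = (\<integral>\<omega>. (max 0 (g (x n \<omega>) - B))\<^sup>2 \<partial>M)" for n
  have int_V: "integrable M (\<lambda>\<omega>. (max 0 (g (x n \<omega>) - B))\<^sup>2)" for n
    by (intro bounded_rv_integrable[of n] bounded_rv_power bounded_rv_excess)
  have drift: "V (Suc n) \<le> V n + a * (\<integral>\<omega>. level_weight \<nu> n \<omega> * (norm (H n \<omega>))\<^sup>2 \<partial>M)
      + b * (\<integral>\<omega>. step_decay (H n \<omega>) (S n \<omega>) \<partial>M)" for n
  proof -
    define f where "f \<omega> = 2 * \<alpha> * max 0 (g (x n \<omega>) - B) * (1 / sqrt (S n \<omega>))" for \<omega>
    have f: "bounded_rv n f" unfolding f_def[abs_def]
      by (intro bounded_rv_mult bounded_rv_const bounded_rv_excess bounded_rv_inverse_sqrt_S)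
    have i2: "integrable M (\<lambda>\<omega>. f \<omega> * (grad (x n \<omega>) \<bullet> H n \<omega>))" by (rule expected_grad_inner(1)[OF f])
    have i4: "integrable M (\<lambda>\<omega>. step_decay (H n \<omega>) (S n \<omega>))" by (rule bounded_rv_integrable[OF bounded_rv_step_decay])
    have "V (Suc n) \<le> (\<integral>\<omega>. (max 0 (g (x n \<omega>) - B))\<^sup>2 - f \<omega> * (grad (x n \<omega>) \<bullet> H n \<omega>)
        + a * (level_weight \<nu> n \<omega> * (norm (H n \<omega>))\<^sup>2) + b * step_decay (H n \<omega>) (S n \<omega>) \<partial>M)"
      unfolding V_def
    proof (rule integral_mono_AE)
      show "integrable M (\<lambda>\<omega>. (max 0 (g (x n \<omega>) - B))\<^sup>2 - f \<omega> * (grad (x n \<omega>) \<bullet> H n \<omega>)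
        + a * (level_weight \<nu> n \<omega> * (norm (H n \<omega>))\<^sup>2) + b * step_decay (H n \<omega>) (S n \<omega>))"
        by (intro Bochner_Integration.integrable_add Bochner_Integration.integrable_diff integrable_mult_right
            int_V i2 integrable_level_noise i4)
      show "AE \<omega> in M. (max 0 (g (x (Suc n) \<omega>) - B))\<^sup>2 \<le> (max 0 (g (x n \<omega>) - B))\<^sup>2 - f \<omega> * (grad (x n \<omega>) \<bullet> H n \<omega>)
        + a * (level_weight \<nu> n \<omega> * (norm (H n \<omega>))\<^sup>2) + b * step_decay (H n \<omega>) (S n \<omega>)"
        using bounded_noise[of n] AE_space
      proof eventually_elim
        case (elim \<omega>)
        have "(norm (grad (x n \<omega>)))\<^sup>2 < \<nu> \<Longrightarrow> (norm (H n \<omega>))\<^sup>2 < D1" using elim \<nu> by auto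
        from excess_step[OF S_ge[OF elim(2), of n] this B(2,1)]
        show ?case by (simp add: x_Suc[OF elim(2)] f_def a_def b_def level_weight_def)
      qed
    qed (rule int_V)
    also have "\<dots> = V n - (\<integral>\<omega>. f \<omega> * (grad (x n \<omega>) \<bullet> H n \<omega>) \<partial>M)
        + a * (\<integral>\<omega>. level_weight \<nu> n \<omega> * (norm (H n \<omega>))\<^sup>2 \<partial>M) + b * (\<integral>\<omega>. step_decay (H n \<omega>) (S n \<omega>) \<partial>M)"
      using int_V[of n] i2 i4 integrable_level_noise[of \<nu> n] by (simp add: V_def)
    finally have "V (Suc n) \<le> V n - (\<integral>\<omega>. f \<omega> * (grad (x n \<omega>) \<bullet> H n \<omega>) \<partial>M)
        + a * (\<integral>\<omega>. level_weight \<nu> n \<omega> * (norm (H n \<omega>))\<^sup>2 \<partial>M) + b * (\<integral>\<omega>. step_decay (H n \<omega>) (S n \<omega>) \<partial>M)" .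
    moreover have "0 \<le> (\<integral>\<omega>. f \<omega> * (grad (x n \<omega>) \<bullet> H n \<omega>) \<partial>M)"
      unfolding expected_grad_inner(2)[OF f]
    proof (rule integral_nonneg_AE, rule AE_I2)
      fix \<omega> assume "\<omega> \<in> space M"
      then show "0 \<le> f \<omega> * (norm (grad (x n \<omega>)))\<^sup>2"
        using alpha_pos S_pos[of \<omega> n] by (simp add: f_def)
    qed
    ultimately show ?thesis by simp
  qed
  have tele: "V n \<le> V 0 + a * (\<Sum>k<n. \<integral>\<omega>. level_weight \<nu> k \<omega> * (norm (H k \<omega>))\<^sup>2 \<partial>M)
      + b * (\<Sum>k<n. \<integral>\<omega>. step_decay (H k \<omega>) (S k \<omega>) \<partial>M)" for n
  proof (induction n)
    case (Suc n)
    then show ?case using drift[of n] by (simp add: distrib_left)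
  qed simp
  have "V n \<le> V 0 + a * C + b * (1 / sqrt S0)" for n
    using tele[of n] mult_left_mono[OF C[of n] ab(1)] mult_left_mono[OF expected_step_decay_sum[of n] ab(2)]
    by linarith
  then show ?thesis using B(1) unfolding V_def by blast
qed

lemma expected_grad_fourth_bounded: "\<exists>C. \<forall>n. (\<integral>\<omega>. (norm (grad (x n \<omega>))) ^ 4 \<partial>M) \<le> C"
proof -
  obtain B C where BC: "0 \<le> B" "\<And>n. (\<integral>\<omega>. (max 0 (g (x n \<omega>) - B))\<^sup>2 \<partial>M) \<le> C"
    using expected_excess_bounded by blast
  have "(\<integral>\<omega>. (norm (grad (x n \<omega>))) ^ 4 \<partial>M) \<le> 8 * L\<^sup>2 * C + 8 * L\<^sup>2 * B\<^sup>2" for n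
  proof -
    have int: "integrable M (\<lambda>\<omega>. (max 0 (g (x n \<omega>) - B))\<^sup>2)"
      by (intro bounded_rv_integrable[of n] bounded_rv_power bounded_rv_excess)
    have "(\<integral>\<omega>. (norm (grad (x n \<omega>))) ^ 4 \<partial>M)
        \<le> (\<integral>\<omega>. 8 * L\<^sup>2 * (max 0 (g (x n \<omega>) - B))\<^sup>2 + 8 * L\<^sup>2 * B\<^sup>2 \<partial>M)"
    proof (rule integral_mono)
      show "integrable M (\<lambda>\<omega>. (norm (grad (x n \<omega>))) ^ 4)"
        by (intro bounded_rv_integrable[of n] bounded_rv_power bounded_rv_grad)
      show "integrable M (\<lambda>\<omega>. 8 * L\<^sup>2 * (max 0 (g (x n \<omega>) - B))\<^sup>2 + 8 * L\<^sup>2 * B\<^sup>2)"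
        by (intro Bochner_Integration.integrable_add integrable_mult_right int integrable_const)
      fix \<omega>
      define y where "y = max 0 (g (x n \<omega>) - B)"
      have "(norm (grad (x n \<omega>))) ^ 4 = ((norm (grad (x n \<omega>)))\<^sup>2)\<^sup>2" by simp
      also have "\<dots> \<le> (2 * L * (y + B))\<^sup>2"
      proof (rule power_mono)
        have "2 * L * g (x n \<omega>) \<le> 2 * L * (y + B)"
          using L_pos by (intro mult_left_mono) (auto simp: y_def)
        then show "(norm (grad (x n \<omega>)))\<^sup>2 \<le> 2 * L * (y + B)"
          using norm_grad_sq_le[of "x n \<omega>"] by linarith
      qed simp
      also have "\<dots> = 4 * L\<^sup>2 * (y + B)\<^sup>2" by (simp add: power_mult_distrib)
      also have "\<dots> \<le> 4 * L\<^sup>2 * (2 * y\<^sup>2 + 2 * B\<^sup>2)"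
      proof (rule mult_left_mono)
        have "0 \<le> (y - B)\<^sup>2" by simp
        then show "(y + B)\<^sup>2 \<le> 2 * y\<^sup>2 + 2 * B\<^sup>2" by (simp add: power2_sum power2_diff)
      qed simp
      finally show "(norm (grad (x n \<omega>))) ^ 4 \<le> 8 * L\<^sup>2 * (max 0 (g (x n \<omega>) - B))\<^sup>2 + 8 * L\<^sup>2 * B\<^sup>2"
        by (simp add: y_def algebra_simps)
    qed
    also have "\<dots> = 8 * L\<^sup>2 * (\<integral>\<omega>. (max 0 (g (x n \<omega>) - B))\<^sup>2 \<partial>M) + 8 * L\<^sup>2 * B\<^sup>2"
      using int by (simp add: prob_space)
    also have "\<dots> \<le> 8 * L\<^sup>2 * C + 8 * L\<^sup>2 * B\<^sup>2"
      using BC(2) by (intro add_right_mono mult_left_mono) auto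
    finally show ?thesis .
  qed
  then show ?thesis by blast
qed

section \<open>Almost every trajectory converges\<close>

lemma AE_level_noise_summable:
  assumes "\<nu> > 0"
  shows "AE \<omega> in M. summable (\<lambda>n. level_weight \<nu> n \<omega> * (norm (H n \<omega>))\<^sup>2)"
proof -
  obtain C where C: "\<And>n. (\<Sum>k<n. \<integral>\<omega>. level_weight \<nu> k \<omega> * (norm (H k \<omega>))\<^sup>2 \<partial>M) \<le> C"
    using expected_level_noise_sum[OF assms] by blast
  show ?thesis
    by (rule AE_summable_if_expectations_bounded[OF integrable_level_noise _ C])
       (simp add: level_weight_nonneg)
qed

lemma AE_descent_summable: "AE \<omega> in M. summable (\<lambda>n. descent n \<omega>)"
proof -
  obtain C where C: "\<And>n. (\<Sum>k<n. \<integral>\<omega>. descent k \<omega> \<partial>M) \<le> C"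
    using expected_descent_sum by blast
  show ?thesis
    by (rule AE_summable_if_expectations_bounded[OF integrable_descent descent_nonneg C])
qed

text \<open>
A weight whose square is dominated by the level weight makes the centred noise a square summable martingale.  It is used with the
gradient as direction, for the change of \<open>g\<close>, and with the coordinate directions, for the displacement.
\<close>

lemma AE_martingale_summable:
  assumes "\<nu> > 0"
    and h: "\<And>n. h n \<in> borel_measurable (F n)"
    and dom: "\<And>n \<omega>. \<omega> \<in> space M \<Longrightarrow> (norm (h n \<omega> :: 'a))\<^sup>2 \<le> A * level_weight \<nu> n \<omega>"
    and A: "0 \<le> A"
  shows "AE \<omega> in M. summable (\<lambda>n. h n \<omega> \<bullet> (grad (x n \<omega>) - H n \<omega>))"
proof -
  define X where "X n \<omega> = h n \<omega> \<bullet> (grad (x n \<omega>) - H n \<omega>)" for n \<omega>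
  define Y where "Y n \<omega> = 2 * A * (descent n \<omega> + level_weight \<nu> n \<omega> * (norm (H n \<omega>))\<^sup>2)" for n \<omega>
  have int_Y: "integrable M (Y n)" for n
    unfolding Y_def[abs_def]
    by (intro integrable_mult_right Bochner_Integration.integrable_add integrable_descent integrable_level_noise)
  have hM [measurable]: "h n \<in> borel_measurable M" for n
    by (rule measurable_from_subalg[OF subalg h])
  have XM [measurable]: "X n \<in> borel_measurable M" for n
    unfolding X_def[abs_def] by measurable
  have XY: "(X n \<omega>)\<^sup>2 \<le> Y n \<omega>" if \<omega>: "\<omega> \<in> space M" for n \<omega>
  proof -
    have "\<bar>X n \<omega>\<bar> \<le> norm (h n \<omega>) * norm (grad (x n \<omega>) - H n \<omega>)"
      unfolding X_def by (rule Cauchy_Schwarz_ineq2)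
    then have "\<bar>X n \<omega>\<bar>\<^sup>2 \<le> (norm (h n \<omega>) * norm (grad (x n \<omega>) - H n \<omega>))\<^sup>2"
      by (intro power_mono) auto
    then have "(X n \<omega>)\<^sup>2 \<le> (norm (h n \<omega>))\<^sup>2 * (norm (grad (x n \<omega>) - H n \<omega>))\<^sup>2"
      by (simp add: power_mult_distrib)
    also have "\<dots> \<le> (A * level_weight \<nu> n \<omega>) * (2 * ((norm (grad (x n \<omega>)))\<^sup>2 + (norm (H n \<omega>))\<^sup>2))"
    proof (rule mult_mono[OF dom[OF \<omega>]])
      have "(norm (grad (x n \<omega>) - H n \<omega>))\<^sup>2 \<le> (norm (grad (x n \<omega>)) + norm (H n \<omega>))\<^sup>2"
        by (intro power_mono norm_triangle_ineq4) auto
      also have "\<dots> \<le> 2 * ((norm (grad (x n \<omega>)))\<^sup>2 + (norm (H n \<omega>))\<^sup>2)"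
        using zero_le_power2[of "norm (grad (x n \<omega>)) - norm (H n \<omega>)"]
        by (simp add: power2_sum power2_diff)
      finally show "(norm (grad (x n \<omega>) - H n \<omega>))\<^sup>2 \<le> 2 * ((norm (grad (x n \<omega>)))\<^sup>2 + (norm (H n \<omega>))\<^sup>2)" .
    qed (use A level_weight_nonneg[OF \<omega>, of \<nu> n] in auto)
    also have "\<dots> = 2 * A * (level_weight \<nu> n \<omega> * (norm (grad (x n \<omega>)))\<^sup>2 + level_weight \<nu> n \<omega> * (norm (H n \<omega>))\<^sup>2)"
      by (simp add: algebra_simps)
    also have "\<dots> \<le> Y n \<omega>"
      unfolding Y_def
    proof (intro mult_left_mono add_right_mono)
      show "level_weight \<nu> n \<omega> * (norm (grad (x n \<omega>)))\<^sup>2 \<le> descent n \<omega>"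
        using descent_nonneg[OF \<omega>, of n] by (simp add: level_weight_def descent_def)
    qed (use A in auto)
    finally show ?thesis .
  qed
  have int_X2: "integrable M (\<lambda>\<omega>. (X n \<omega>)\<^sup>2)" for n
    by (rule Bochner_Integration.integrable_bound[OF int_Y[of n]])
       (auto intro!: AE_I2 order_trans[OF XY abs_ge_self])
  have mart: "martingale_increments M F X"
  proof unfold_locales
    fix n
    have [measurable]: "h n \<in> borel_measurable (F (Suc n))" "x n \<in> borel_measurable (F (Suc n))"
      "H n \<in> borel_measurable (F (Suc n))"
      using measurable_from_subalg[OF subalg_F h[of n]] measurable_from_subalg[OF subalg_F x_adapted[of n]]
        H_adapted[of n] by auto
    show "X n \<in> borel_measurable (F (Suc n))" unfolding X_def[abs_def] by measurable
    show "integrable M (\<lambda>\<omega>. (X n \<omega>)\<^sup>2)" by (rule int_X2)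
    fix f c assume f: "f \<in> borel_measurable (F n)" and fc: "\<And>\<omega>. \<omega> \<in> space M \<Longrightarrow> \<bar>f \<omega>\<bar> \<le> (c::real)"
    obtain W where W: "\<And>\<omega>. \<omega> \<in> space M \<Longrightarrow> \<bar>level_weight \<nu> n \<omega>\<bar> \<le> W"
      using bounded_rv_level_weight[of n \<nu>] by (auto simp: bounded_rv_def)
    define h' where "h' \<omega> = f \<omega> *\<^sub>R h n \<omega>" for \<omega>
    have h': "h' \<in> borel_measurable (F n)" unfolding h'_def[abs_def] by (intro borel_measurable_scaleR f h)
    have bound: "norm (h' \<omega>) \<le> c * (A * W + 1)" if \<omega>: "\<omega> \<in> space M" for \<omega>
    proof -
      have "norm (h n \<omega>) \<le> (norm (h n \<omega>))\<^sup>2 + 1"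
        using zero_le_power2[of "norm (h n \<omega>) - 1"] by (simp add: power2_diff) (smt (verit) norm_ge_zero)
      also have "\<dots> \<le> A * W + 1"
        using dom[OF \<omega>, of n] mult_left_mono[OF order_trans[OF abs_ge_self W[OF \<omega>]] A] by linarith
      finally show ?thesis
        unfolding h'_def norm_scaleR using fc[OF \<omega>] by (intro mult_mono) auto
    qed
    have i1: "integrable M (\<lambda>\<omega>. h' \<omega> \<bullet> H n \<omega>)"
      by (rule integrable_bounded_inner[OF measurable_from_subalg[OF subalg h'] bound])
    have "bounded_rv n (\<lambda>\<omega>. h' \<omega> \<bullet> grad (x n \<omega>))"
    proof (rule bounded_rv_dominated[OF _ bounded_rv_mult[OF bounded_rv_const[of n "c * (A * W + 1)"] bounded_rv_grad]])
      show "(\<lambda>\<omega>. h' \<omega> \<bullet> grad (x n \<omega>)) \<in> borel_measurable (F n)"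
        by (intro borel_measurable_inner h' grad_x_adapted)
      show "\<bar>h' \<omega> \<bullet> grad (x n \<omega>)\<bar> \<le> c * (A * W + 1) * norm (grad (x n \<omega>))" if "\<omega> \<in> space M" for \<omega>
        using order_trans[OF Cauchy_Schwarz_ineq2 mult_right_mono[OF bound[OF that] norm_ge_zero]] .
    qed
    then have i2: "integrable M (\<lambda>\<omega>. h' \<omega> \<bullet> grad (x n \<omega>))" by (rule bounded_rv_integrable)
    have "(\<integral>\<omega>. f \<omega> * X n \<omega> \<partial>M) = (\<integral>\<omega>. h' \<omega> \<bullet> grad (x n \<omega>) - h' \<omega> \<bullet> H n \<omega> \<partial>M)"
      by (rule Bochner_Integration.integral_cong) (auto simp: X_def h'_def inner_diff_right algebra_simps)
    also have "\<dots> = (\<integral>\<omega>. h' \<omega> \<bullet> grad (x n \<omega>) \<partial>M) - (\<integral>\<omega>. h' \<omega> \<bullet> H n \<omega> \<partial>M)"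
      by (rule Bochner_Integration.integral_diff[OF i2 i1])
    also have "\<dots> = 0" using unbiased[OF h' bound H_integrable] by simp
    finally show "(\<integral>\<omega>. f \<omega> * X n \<omega> \<partial>M) = 0" .
  qed (use subalg filtration in auto)
  obtain C1 where C1: "\<And>n. (\<Sum>k<n. \<integral>\<omega>. level_weight \<nu> k \<omega> * (norm (H k \<omega>))\<^sup>2 \<partial>M) \<le> C1"
    using expected_level_noise_sum[OF assms(1)] by blast
  obtain C2 where C2: "\<And>n. (\<Sum>k<n. \<integral>\<omega>. descent k \<omega> \<partial>M) \<le> C2"
    using expected_descent_sum by blast
  have "summable (\<lambda>n. \<integral>\<omega>. (X n \<omega>)\<^sup>2 \<partial>M)"
  proof (rule summableI_nonneg_bounded)
    fix n
    have "(\<Sum>k<n. \<integral>\<omega>. (X k \<omega>)\<^sup>2 \<partial>M) \<le> (\<Sum>k<n. \<integral>\<omega>. Y k \<omega> \<partial>M)"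
      by (intro sum_mono integral_mono int_X2 int_Y XY)
    also have "\<dots> = (\<Sum>k<n. 2 * A * ((\<integral>\<omega>. descent k \<omega> \<partial>M) + (\<integral>\<omega>. level_weight \<nu> k \<omega> * (norm (H k \<omega>))\<^sup>2 \<partial>M)))"
      using integrable_descent integrable_level_noise by (simp add: Y_def[abs_def])
    also have "\<dots> = 2 * A * ((\<Sum>k<n. \<integral>\<omega>. descent k \<omega> \<partial>M) + (\<Sum>k<n. \<integral>\<omega>. level_weight \<nu> k \<omega> * (norm (H k \<omega>))\<^sup>2 \<partial>M))"
      by (simp add: sum.distrib sum_distrib_left distrib_left)
    also have "\<dots> \<le> 2 * A * (C2 + C1)"
      using A C1 C2 by (intro mult_left_mono add_mono) auto
    finally show "(\<Sum>k<n. \<integral>\<omega>. (X k \<omega>)\<^sup>2 \<partial>M) \<le> 2 * A * (C2 + C1)" .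
  qed auto
  from martingale_increments.martingale_AE_summable[OF mart this]
  show ?thesis by (simp add: X_def)
qed

lemma level_scaled_measurable:
  "(\<lambda>\<omega>. of_bool (\<nu> \<le> (norm (grad (x n \<omega>)))\<^sup>2) / sqrt (S n \<omega>) :: real) \<in> borel_measurable (F n)"
  using bounded_rv_mult[OF bounded_rv_level[of n \<nu>] bounded_rv_inverse_sqrt_S[of n]]
  by (simp add: bounded_rv_def)

lemma level_scaled_square:
  assumes "\<omega> \<in> space M"
  shows "(of_bool (\<nu> \<le> (norm (grad (x n \<omega>)))\<^sup>2) / sqrt (S n \<omega>) :: real)\<^sup>2 * w (x n \<omega>) \<le> level_weight \<nu> n \<omega>"
proof -
  have "w (x n \<omega>) \<le> (w (x n \<omega>))\<^sup>2" using w_ge_1[of "x n \<omega>"] self_le_power[of "w (x n \<omega>)" 2] by simp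
  then have "w (x n \<omega>) / S n \<omega> \<le> (w (x n \<omega>))\<^sup>2 / S n \<omega>"
    using S_pos[OF assms, of n] by (intro divide_right_mono) auto
  then show ?thesis
    using S_pos[OF assms, of n] by (simp add: level_weight_def power_divide less_imp_le)
qed

lemma AE_scalar_martingale:
  assumes "\<nu> > 0"
  shows "AE \<omega> in M. summable (\<lambda>n. of_bool (\<nu> \<le> (norm (grad (x n \<omega>)))\<^sup>2)
    * (1 / sqrt (S n \<omega>) * (grad (x n \<omega>) \<bullet> (grad (x n \<omega>) - H n \<omega>))))"
proof -
  define h where "h n \<omega> = (of_bool (\<nu> \<le> (norm (grad (x n \<omega>)))\<^sup>2) / sqrt (S n \<omega>)) *\<^sub>R grad (x n \<omega>)" for n \<omega>
  have "AE \<omega> in M. summable (\<lambda>n. h n \<omega> \<bullet> (grad (x n \<omega>) - H n \<omega>))"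
  proof (rule AE_martingale_summable[OF assms, where A="2 * L"])
    show "h n \<in> borel_measurable (F n)" for n
      unfolding h_def[abs_def] by (intro borel_measurable_scaleR level_scaled_measurable grad_x_adapted)
    fix n \<omega> assume \<omega>: "\<omega> \<in> space M"
    define t :: real where "t = of_bool (\<nu> \<le> (norm (grad (x n \<omega>)))\<^sup>2) / sqrt (S n \<omega>)"
    have "(norm (grad (x n \<omega>)))\<^sup>2 \<le> 2 * L * w (x n \<omega>)"
      using norm_grad_sq_le[of "x n \<omega>"] L_pos by (simp add: w_def algebra_simps)
    then have "t\<^sup>2 * (norm (grad (x n \<omega>)))\<^sup>2 \<le> t\<^sup>2 * (2 * L * w (x n \<omega>))"
      by (intro mult_left_mono) auto
    also have "\<dots> = 2 * L * (t\<^sup>2 * w (x n \<omega>))" by simp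
    also have "\<dots> \<le> 2 * L * level_weight \<nu> n \<omega>"
      using L_pos level_scaled_square[OF \<omega>, of \<nu> n] by (intro mult_left_mono) (auto simp: t_def)
    finally show "(norm (h n \<omega>))\<^sup>2 \<le> 2 * L * level_weight \<nu> n \<omega>"
      unfolding h_def t_def[symmetric] by (simp add: power_mult_distrib)
  qed (use L_pos in simp)
  then show ?thesis by (simp add: h_def)
qed

lemma AE_vector_martingale:
  assumes "\<nu> > 0"
  shows "AE \<omega> in M. summable (\<lambda>n. (of_bool (\<nu> \<le> (norm (grad (x n \<omega>)))\<^sup>2) / sqrt (S n \<omega>)) *\<^sub>R (grad (x n \<omega>) - H n \<omega>))"
proof -
  define Z where "Z n \<omega> = (of_bool (\<nu> \<le> (norm (grad (x n \<omega>)))\<^sup>2) / sqrt (S n \<omega>)) *\<^sub>R (grad (x n \<omega>) - H n \<omega>)" for n \<omega>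
  have comp: "AE \<omega> in M. summable (\<lambda>n. Z n \<omega> \<bullet> b)" if b: "b \<in> Basis" for b
  proof -
    define h where "h n \<omega> = (of_bool (\<nu> \<le> (norm (grad (x n \<omega>)))\<^sup>2) / sqrt (S n \<omega>)) *\<^sub>R b" for n \<omega>
    have "AE \<omega> in M. summable (\<lambda>n. h n \<omega> \<bullet> (grad (x n \<omega>) - H n \<omega>))"
    proof (rule AE_martingale_summable[OF assms, where A=1])
      show "h n \<in> borel_measurable (F n)" for n
        unfolding h_def[abs_def] by (intro borel_measurable_scaleR level_scaled_measurable borel_measurable_const)
      fix n \<omega> assume \<omega>: "\<omega> \<in> space M"
      define t :: real where "t = of_bool (\<nu> \<le> (norm (grad (x n \<omega>)))\<^sup>2) / sqrt (S n \<omega>)"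
      have "t\<^sup>2 * 1 \<le> t\<^sup>2 * w (x n \<omega>)" by (intro mult_left_mono w_ge_1) auto
      also have "\<dots> \<le> level_weight \<nu> n \<omega>" unfolding t_def by (rule level_scaled_square[OF \<omega>])
      finally show "(norm (h n \<omega>))\<^sup>2 \<le> 1 * level_weight \<nu> n \<omega>"
        unfolding h_def t_def[symmetric] using b by (simp add: power_mult_distrib)
    qed simp
    then show ?thesis by (simp add: h_def Z_def inner_commute)
  qed
  have "AE \<omega> in M. \<forall>b\<in>Basis. summable (\<lambda>n. Z n \<omega> \<bullet> b)"
    by (rule AE_finite_allI[OF finite_Basis comp])
  then show ?thesis
    unfolding Z_def[symmetric]
  proof eventually_elim
    case (elim \<omega>)
    then have "summable (\<lambda>n. \<Sum>b\<in>Basis. (Z n \<omega> \<bullet> b) *\<^sub>R b)"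
      by (intro summable_sum summable_scaleR_left) auto
    then show ?case by (simp add: euclidean_representation)
  qed
qed

lemma AE_grad_tendsto_zero: "AE \<omega> in M. (\<lambda>n. (norm (grad (x n \<omega>)))\<^sup>2) \<longlonglongrightarrow> 0"
proof -
  have "AE \<omega> in M. \<forall>n. (norm (grad (x n \<omega>)))\<^sup>2 < D0 \<longrightarrow> (norm (H n \<omega>))\<^sup>2 < D1"
    using bounded_noise by (simp add: AE_all_countable)
  moreover have "AE \<omega> in M. \<forall>k. summable (\<lambda>n. level_weight (inverse (real (Suc k))) n \<omega> * (norm (H n \<omega>))\<^sup>2)"
    unfolding AE_all_countable by (intro allI AE_level_noise_summable) simp
  moreover have "AE \<omega> in M. \<forall>k. summable (\<lambda>n. of_bool (inverse (real (Suc k)) \<le> (norm (grad (x n \<omega>)))\<^sup>2)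
    * (1 / sqrt (S n \<omega>) * (grad (x n \<omega>) \<bullet> (grad (x n \<omega>) - H n \<omega>))))"
    unfolding AE_all_countable by (intro allI AE_scalar_martingale) simp
  moreover have "AE \<omega> in M. \<forall>k. summable (\<lambda>n. (of_bool (inverse (real (Suc k)) \<le> (norm (grad (x n \<omega>)))\<^sup>2)
    / sqrt (S n \<omega>)) *\<^sub>R (grad (x n \<omega>) - H n \<omega>))"
    unfolding AE_all_countable by (intro allI AE_vector_martingale) simp
  ultimately show ?thesis
    using AE_descent_summable AE_space
  proof eventually_elim
    case (elim \<omega>)
    note \<omega> = elim(6)
    have w2: "1 \<le> (w (x n \<omega>))\<^sup>2" "w (x n \<omega>) \<le> (w (x n \<omega>))\<^sup>2" for n
      using w_ge_1[of "x n \<omega>"] self_le_power[of "w (x n \<omega>)" 2] one_le_power[of "w (x n \<omega>)" 2] by auto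
    have "adagrad_trajectory g grad L \<alpha> S0 (\<lambda>n. x n \<omega>) (\<lambda>n. H n \<omega>) (\<lambda>n. S n \<omega>) D0 D1"
    proof unfold_locales
      show "summable (\<lambda>n. (norm (grad (x n \<omega>)))\<^sup>2 / S n \<omega>)"
      proof (rule summable_comparison_test'[OF elim(5), of 0])
        fix n
        have "1 * ((norm (grad (x n \<omega>)))\<^sup>2 / S n \<omega>) \<le> (w (x n \<omega>))\<^sup>2 * ((norm (grad (x n \<omega>)))\<^sup>2 / S n \<omega>)"
          using S_pos[OF \<omega>, of n] w2 by (intro mult_right_mono) auto
        then show "norm ((norm (grad (x n \<omega>)))\<^sup>2 / S n \<omega>) \<le> descent n \<omega>"
          using S_pos[OF \<omega>, of n] by (simp add: descent_def)
      qed
      fix k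
      show "summable (\<lambda>n. of_bool (inverse (real (Suc k)) \<le> (norm (grad (x n \<omega>)))\<^sup>2)
          * (w (x n \<omega>) * (norm (H n \<omega>))\<^sup>2 / S n \<omega>))"
      proof (rule summable_comparison_test'[of "\<lambda>n. level_weight (inverse (real (Suc k))) n \<omega> * (norm (H n \<omega>))\<^sup>2" 0])
        show "summable (\<lambda>n. level_weight (inverse (real (Suc k))) n \<omega> * (norm (H n \<omega>))\<^sup>2)"
          using elim(2) by blast
        fix n
        define I :: real where "I = of_bool (inverse (real (Suc k)) \<le> (norm (grad (x n \<omega>)))\<^sup>2)"
        have "I * (w (x n \<omega>) * ((norm (H n \<omega>))\<^sup>2 / S n \<omega>)) \<le> I * ((w (x n \<omega>))\<^sup>2 * ((norm (H n \<omega>))\<^sup>2 / S n \<omega>))"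
          using S_pos[OF \<omega>, of n] w2[of n] by (intro mult_left_mono mult_right_mono) (auto simp: I_def)
        moreover have "0 \<le> I * (w (x n \<omega>) * ((norm (H n \<omega>))\<^sup>2 / S n \<omega>))"
          using S_pos[OF \<omega>, of n] w_ge_1[of "x n \<omega>"] by (simp add: I_def)
        ultimately show "norm (of_bool (inverse (real (Suc k)) \<le> (norm (grad (x n \<omega>)))\<^sup>2)
            * (w (x n \<omega>) * (norm (H n \<omega>))\<^sup>2 / S n \<omega>))
            \<le> level_weight (inverse (real (Suc k))) n \<omega> * (norm (H n \<omega>))\<^sup>2"
          unfolding level_weight_def I_def[symmetric] by simp
      qed
      show "summable (\<lambda>n. of_bool (inverse (real (Suc k)) \<le> (norm (grad (x n \<omega>)))\<^sup>2)
          * (1 / sqrt (S n \<omega>) * (grad (x n \<omega>) \<bullet> (grad (x n \<omega>) - H n \<omega>))))"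
        using elim(3) by blast
      show "summable (\<lambda>n. (of_bool (inverse (real (Suc k)) \<le> (norm (grad (x n \<omega>)))\<^sup>2)
          / sqrt (S n \<omega>)) *\<^sub>R (grad (x n \<omega>) - H n \<omega>))"
        using elim(4) by blast
    qed (use elim(1) x_Suc[OF \<omega>] S_Suc[OF \<omega>] S_0[OF \<omega>] D0_pos coercive nowhere small_grad_bounded in auto)
    then show ?case by (rule adagrad_trajectory.grad_tendsto_zero)
  qed
qed

section \<open>Convergence in mean square\<close>

text \<open>
Splitting \<open>v\<^sup>2 \<le> min v\<^sup>2 R + v ^ 4 / R\<close>, dominated convergence takes care of the first part, and the uniform
bound on fourth moments of the second.
\<close>

theorem expected_grad_tendsto_zero:
  "(\<lambda>n. \<integral>\<^sup>+\<omega>. ennreal ((norm (grad (x n \<omega>)))\<^sup>2) \<partial>M) \<longlonglongrightarrow> 0"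
proof -
  obtain C where C: "\<And>n. (\<integral>\<omega>. (norm (grad (x n \<omega>))) ^ 4 \<partial>M) \<le> C"
    using expected_grad_fourth_bounded by blast
  define V where "V n = (\<integral>\<omega>. (norm (grad (x n \<omega>)))\<^sup>2 \<partial>M)" for n
  have int2: "integrable M (\<lambda>\<omega>. (norm (grad (x n \<omega>)))\<^sup>2)" and int4: "integrable M (\<lambda>\<omega>. (norm (grad (x n \<omega>))) ^ 4)" for n
    by (intro bounded_rv_integrable[of n] bounded_rv_power bounded_rv_grad)+
  have V0: "0 \<le> V n" for n unfolding V_def by (rule integral_nonneg_AE) auto
  have "V \<longlonglongrightarrow> 0"
    unfolding lim_sequentially
  proof (intro allI impI)
    fix e :: real assume "e > 0"
    define R where "R = 2 * (\<bar>C\<bar> + 1) / e"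
    have R: "R > 0" using \<open>e > 0\<close> by (simp add: R_def)
    have "(\<lambda>n. \<integral>\<omega>. min ((norm (grad (x n \<omega>)))\<^sup>2) R \<partial>M) \<longlonglongrightarrow> (\<integral>\<omega>. 0 \<partial>M)"
    proof (rule integral_dominated_convergence[where w="\<lambda>_. R"])
      show "AE \<omega> in M. (\<lambda>n. min ((norm (grad (x n \<omega>)))\<^sup>2) R) \<longlonglongrightarrow> 0"
        using AE_grad_tendsto_zero
      proof eventually_elim
        case (elim \<omega>)
        from tendsto_min[OF this tendsto_const[of R]] show ?case using R by (simp add: min_def)
      qed
    qed (use R in auto)
    then have "eventually (\<lambda>n. (\<integral>\<omega>. min ((norm (grad (x n \<omega>)))\<^sup>2) R \<partial>M) < e / 2) sequentially"
      using \<open>e > 0\<close> by (intro order_tendstoD(2)) auto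
    then obtain N where N: "\<And>n. n \<ge> N \<Longrightarrow> (\<integral>\<omega>. min ((norm (grad (x n \<omega>)))\<^sup>2) R \<partial>M) < e / 2"
      by (auto simp: eventually_sequentially)
    have "dist (V n) 0 < e" if "n \<ge> N" for n
    proof -
      have int_min: "integrable M (\<lambda>\<omega>. min ((norm (grad (x n \<omega>)))\<^sup>2) R)"
        by (rule integrable_const_bound[where B=R]) (use R in auto)
      have "V n \<le> (\<integral>\<omega>. min ((norm (grad (x n \<omega>)))\<^sup>2) R + (norm (grad (x n \<omega>))) ^ 4 / R \<partial>M)"
        unfolding V_def
      proof (rule integral_mono)
        show "integrable M (\<lambda>\<omega>. min ((norm (grad (x n \<omega>)))\<^sup>2) R + (norm (grad (x n \<omega>))) ^ 4 / R)"
          by (intro Bochner_Integration.integrable_add int_min integrable_divide int4)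
        fix \<omega>
        define t where "t = (norm (grad (x n \<omega>)))\<^sup>2"
        have t: "0 \<le> t" "(norm (grad (x n \<omega>))) ^ 4 = t * t"
          by (auto simp: t_def simp flip: power_add)
        have "t \<le> min t R + t * t / R"
        proof (cases "t \<le> R")
          case False
          then have "t * R \<le> t * t" using t by (intro mult_left_mono) auto
          then have "t \<le> t * t / R" using R by (simp add: le_divide_eq)
          then show ?thesis using R False by (simp add: min_def)
        qed (use t R in simp)
        then show "(norm (grad (x n \<omega>)))\<^sup>2 \<le> min ((norm (grad (x n \<omega>)))\<^sup>2) R + (norm (grad (x n \<omega>))) ^ 4 / R"
          unfolding t(2) t_def .
      qed (rule int2)
      also have "\<dots> = (\<integral>\<omega>. min ((norm (grad (x n \<omega>)))\<^sup>2) R \<partial>M) + (\<integral>\<omega>. (norm (grad (x n \<omega>))) ^ 4 \<partial>M) / R"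
        using int_min int4[of n] by simp
      also have "\<dots> < e / 2 + e / 2"
      proof (rule add_less_le_mono[OF N[OF that]])
        have "(\<integral>\<omega>. (norm (grad (x n \<omega>))) ^ 4 \<partial>M) / R \<le> (\<bar>C\<bar> + 1) / R"
          using C[of n] R by (intro divide_right_mono) auto
        also have "\<dots> = e / 2" using \<open>e > 0\<close> by (simp add: R_def field_simps)
        finally show "(\<integral>\<omega>. (norm (grad (x n \<omega>))) ^ 4 \<partial>M) / R \<le> e / 2" .
      qed
      finally show ?thesis using V0[of n] by (simp add: dist_real_def)
    qed
    then show "\<exists>N. \<forall>n\<ge>N. dist (V n) 0 < e" by blast
  qed
  then have "(\<lambda>n. ennreal (V n)) \<longlonglongrightarrow> ennreal 0" by (rule tendsto_ennrealI)
  moreover have "(\<integral>\<^sup>+\<omega>. ennreal ((norm (grad (x n \<omega>)))\<^sup>2) \<partial>M) = ennreal (V n)" for n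
    unfolding V_def by (rule nn_integral_eq_integral[OF int2]) auto
  ultimately show ?thesis by simp
qed

end

section \<open>The filtration of the oracle\<close>

lemma space_oracle_filtration: "space (oracle_filtration M N \<theta>\<^sub>1 \<xi> n) = space M"
  unfolding oracle_filtration_def by (rule space_measure_of) auto

lemma sets_oracle_filtration:
  "sets (oracle_filtration M N \<theta>\<^sub>1 \<xi> n) = sigma_sets (space M)
     ({(\<lambda>_. \<theta>\<^sub>1) -` B \<inter> space M | B. B \<in> sets borel} \<union>
      (\<Union>i\<in>{1..n}. {\<xi> i -` A \<inter> space M | A. A \<in> sets N}))"
  unfolding oracle_filtration_def by (rule sets_measure_of) auto

lemma oracle_filtration_mono:
  "m \<le> n \<Longrightarrow> sets (oracle_filtration M N \<theta>\<^sub>1 \<xi> m) \<subseteq> sets (oracle_filtration M N \<theta>\<^sub>1 \<xi> n)"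
  unfolding sets_oracle_filtration by (rule sigma_sets_mono') fastforce

lemma subalgebra_oracle_filtration:
  assumes "\<And>i. i \<ge> 1 \<Longrightarrow> \<xi> i \<in> measurable M N"
  shows "subalgebra M (oracle_filtration M N \<theta>\<^sub>1 \<xi> n)"
proof -
  have "sets (oracle_filtration M N \<theta>\<^sub>1 \<xi> n) \<subseteq> sets M"
    unfolding sets_oracle_filtration
  proof (rule sets.sigma_sets_subset, rule Un_least)
    show "{(\<lambda>_. \<theta>\<^sub>1) -` B \<inter> space M | B. B \<in> sets borel} \<subseteq> sets M"
      by (auto simp: vimage_const)
    show "(\<Union>i\<in>{1..n}. {\<xi> i -` A \<inter> space M | A. A \<in> sets N}) \<subseteq> sets M"
      using measurable_sets[OF assms] by auto
  qed
  then show ?thesis by (simp add: subalgebra_def space_oracle_filtration)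
qed

lemma measurable_oracle_filtration:
  assumes "\<xi> i \<in> measurable M N" "1 \<le> i" "i \<le> n"
  shows "\<xi> i \<in> measurable (oracle_filtration M N \<theta>\<^sub>1 \<xi> n) N"
proof (rule measurableI)
  fix A assume "A \<in> sets N"
  then have "\<xi> i -` A \<inter> space M \<in> (\<Union>i\<in>{1..n}. {\<xi> i -` A \<inter> space M | A. A \<in> sets N})"
    using assms by (intro UN_I[of i]) auto
  then show "\<xi> i -` A \<inter> space (oracle_filtration M N \<theta>\<^sub>1 \<xi> n) \<in> sets (oracle_filtration M N \<theta>\<^sub>1 \<xi> n)"
    unfolding space_oracle_filtration sets_oracle_filtration by (intro sigma_sets.Basic UnI2)
qed (use measurable_space[OF assms(1)] in \<open>simp add: space_oracle_filtration\<close>)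

lemma vec_nth_borel [measurable]: "(\<lambda>v :: real ^ 'd. v $ i) \<in> borel_measurable borel"
  by (intro borel_measurable_continuous_onI continuous_on_component continuous_on_id)

lemma (in smooth_nonneg) small_gradient_bounded_values:
  assumes "Liminf at_infinity (\<lambda>x. ereal ((norm (grad x))\<^sup>2)) > ereal \<eta>"
  shows "\<exists>B. \<forall>y. (norm (grad y))\<^sup>2 < \<eta> \<longrightarrow> g y \<le> B"
proof -
  have "eventually (\<lambda>x. ereal \<eta> < ereal ((norm (grad x))\<^sup>2)) at_infinity"
    by (rule less_LiminfD[OF assms])
  then obtain R where R: "\<And>y. R \<le> norm y \<Longrightarrow> \<eta> < (norm (grad y))\<^sup>2"
    by (auto simp: eventually_at_infinity)
  have "bounded (g ` cball 0 R)"
    by (intro compact_imp_bounded compact_continuous_image continuous_on_subset[OF continuous_on_g]) auto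
  then obtain B where "\<forall>z\<in>g ` cball 0 R. norm z \<le> B"
    using bounded_iff by blast
  then have B: "\<bar>g y\<bar> \<le> B" if "y \<in> cball 0 R" for y
    using that by auto
  have "g y \<le> B" if "(norm (grad y))\<^sup>2 < \<eta>" for y
  proof -
    have "\<not> R \<le> norm y" using R[of y] that by linarith
    then show ?thesis using B[of y] by simp
  qed
  then show ?thesis by blast
qed

text \<open>
Testing a coordinatewise conditional expectation against a bounded vector weight amounts to the scalar statement in
each coordinate.
\<close>

lemma expectation_inner_vec_cond_exp:
  fixes X Y :: "'w \<Rightarrow> real ^ 'd"
  assumes "sigma_finite_subalgebra M F" and X: "integrable M X"
    and eq: "AE \<omega> in M. vec_cond_exp M F X \<omega> = Y \<omega>"
    and Y: "Y \<in> borel_measurable M"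
    and h: "h \<in> borel_measurable F" and bound: "\<And>\<omega>. \<omega> \<in> space M \<Longrightarrow> norm (h \<omega>) \<le> c"
  shows "(\<integral>\<omega>. h \<omega> \<bullet> X \<omega> \<partial>M) = (\<integral>\<omega>. h \<omega> \<bullet> Y \<omega> \<partial>M)"
proof -
  interpret sigma_finite_subalgebra M F by fact
  have hM [measurable]: "h \<in> borel_measurable M" by (rule measurable_from_subalg[OF subalg h])
  have [measurable]: "X \<in> borel_measurable M" using X by (rule borel_measurable_integrable)
  note Y [measurable]
  have int: "integrable M (\<lambda>\<omega>. h \<omega> $ i * X \<omega> $ i)" for i
  proof (rule Bochner_Integration.integrable_bound[OF integrable_mult_right[OF integrable_norm[OF X], of c]])
    show "AE \<omega> in M. norm (h \<omega> $ i * X \<omega> $ i) \<le> norm (c * norm (X \<omega>))"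
    proof (rule AE_I2)
      fix \<omega> assume \<omega>: "\<omega> \<in> space M"
      have "norm (h \<omega> $ i * X \<omega> $ i) = \<bar>h \<omega> $ i\<bar> * \<bar>X \<omega> $ i\<bar>" by (simp add: abs_mult)
      also have "\<dots> \<le> c * norm (X \<omega>)"
        using order_trans[OF component_le_norm_cart bound[OF \<omega>]] component_le_norm_cart[of "X \<omega>" i]
        by (intro mult_mono) (auto intro: order_trans[OF norm_ge_zero bound[OF \<omega>]])
      finally show "norm (h \<omega> $ i * X \<omega> $ i) \<le> norm (c * norm (X \<omega>))" by simp
    qed
  qed measurable
  have h_i: "(\<lambda>\<omega>. h \<omega> $ i) \<in> borel_measurable F" for i
    by (rule measurable_compose[OF h vec_nth_borel])
  have X_i: "(\<lambda>\<omega>. X \<omega> $ i) \<in> borel_measurable M" for i by measurable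
  have ae: "AE \<omega> in M. h \<omega> $ i * real_cond_exp M F (\<lambda>\<omega>'. X \<omega>' $ i) \<omega> = h \<omega> $ i * Y \<omega> $ i" for i
    using eq by eventually_elim (auto simp: vec_cond_exp_def vec_eq_iff)
  have int_Y: "integrable M (\<lambda>\<omega>. h \<omega> $ i * Y \<omega> $ i)" for i
    using real_cond_exp_intg(1)[OF int h_i X_i, of i] ae[of i]
    by (subst (asm) integrable_cong_AE[OF _ _ ae]) (auto intro: borel_measurable_integrable)
  have comp: "(\<integral>\<omega>. h \<omega> $ i * X \<omega> $ i \<partial>M) = (\<integral>\<omega>. h \<omega> $ i * Y \<omega> $ i \<partial>M)" for i
  proof -
    have "(\<integral>\<omega>. h \<omega> $ i * X \<omega> $ i \<partial>M) = (\<integral>\<omega>. h \<omega> $ i * real_cond_exp M F (\<lambda>\<omega>'. X \<omega>' $ i) \<omega> \<partial>M)"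
      by (rule real_cond_exp_intg(2)[OF int h_i X_i, symmetric])
    also have "\<dots> = (\<integral>\<omega>. h \<omega> $ i * Y \<omega> $ i \<partial>M)"
      using real_cond_exp_intg(1)[OF int h_i X_i, of i] int_Y[of i]
      by (intro integral_cong_AE ae borel_measurable_integrable)
    finally show ?thesis .
  qed
  show ?thesis
    unfolding inner_vec_def using int int_Y by (simp add: comp)
qed

section \<open>Mean-square convergence of AdaGrad-Norm\<close>

theorem theorem3p5:
  fixes M :: "'w measure" and N :: "'e measure"
    and g :: "real ^ 'd \<Rightarrow> real" and grad_g :: "real ^ 'd \<Rightarrow> real ^ 'd"
    and G :: "real ^ 'd \<Rightarrow> 'e \<Rightarrow> real ^ 'd"
    and \<xi> :: "nat \<Rightarrow> 'w \<Rightarrow> 'e"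
    and \<theta> :: "nat \<Rightarrow> 'w \<Rightarrow> real ^ 'd" and S :: "nat \<Rightarrow> 'w \<Rightarrow> real"
    and \<theta>\<^sub>1 :: "real ^ 'd"
    and S\<^sub>0 \<alpha>\<^sub>0 L \<sigma>\<^sub>0 \<sigma>\<^sub>1 D\<^sub>0 D\<^sub>1 :: real
  assumes "prob_space M"
    and "prob_space.indep_vars M (\<lambda>_. N) \<xi> {1..}"
    and "(\<lambda>(x, e). G x e) \<in> borel_measurable (borel \<Otimes>\<^sub>M N)"
    and "\<And>x. GDERIV g x :> grad_g x" and "continuous_on UNIV grad_g" and "\<And>x. 0 \<le> g x"
    and "\<And>x y. norm (grad_g x - grad_g y) \<le> L * norm (x - y)"
    and "\<exists>\<eta>>0. Liminf at_infinity (\<lambda>x. ereal ((norm (grad_g x))\<^sup>2)) > ereal \<eta>"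
    and "filterlim g at_top at_infinity"
    and "nowhere_dense {g x | x. grad_g x = 0}"
    and "S\<^sub>0 > 0" and "\<alpha>\<^sub>0 > 0"
    and "\<And>\<omega>. \<omega> \<in> space M \<Longrightarrow>
           adagrad_norm G \<alpha>\<^sub>0 S\<^sub>0 \<theta>\<^sub>1 (\<lambda>n. \<xi> n \<omega>) (\<lambda>n. S n \<omega>) (\<lambda>n. \<theta> n \<omega>)"
    and "\<And>n. n \<ge> 1 \<Longrightarrow> AE \<omega> in M.
           vec_cond_exp M (oracle_filtration M N \<theta>\<^sub>1 \<xi> (n - 1)) (\<lambda>\<omega>. G (\<theta> n \<omega>) (\<xi> n \<omega>)) \<omega>
             = grad_g (\<theta> n \<omega>)"
    and "\<sigma>\<^sub>0 \<ge> 0" and "\<sigma>\<^sub>1 \<ge> 0"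
    and "\<And>n. n \<ge> 1 \<Longrightarrow> AE \<omega> in M.
           nn_cond_exp M (oracle_filtration M N \<theta>\<^sub>1 \<xi> (n - 1))
               (\<lambda>\<omega>. ennreal ((norm (G (\<theta> n \<omega>) (\<xi> n \<omega>)))\<^sup>2)) \<omega>
             \<le> ennreal (\<sigma>\<^sub>0 * (norm (grad_g (\<theta> n \<omega>)))\<^sup>2 + \<sigma>\<^sub>1)"
    and "D\<^sub>0 > 0" and "D\<^sub>1 > 0"
    and "\<And>n. n \<ge> 1 \<Longrightarrow> AE \<omega> in M.
           (norm (grad_g (\<theta> n \<omega>)))\<^sup>2 < D\<^sub>0 \<longrightarrow> (norm (G (\<theta> n \<omega>) (\<xi> n \<omega>)))\<^sup>2 < D\<^sub>1"
  shows "(\<lambda>n. \<integral>\<^sup>+\<omega>. ennreal ((norm (grad_g (\<theta> n \<omega>)))\<^sup>2) \<partial>M) \<longlonglongrightarrow> 0"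
proof -
  interpret prob_space M by fact
  define F where "F n = oracle_filtration M N \<theta>\<^sub>1 \<xi> n" for n
  define x where "x n = \<theta> (Suc n)" for n
  define H where "H n \<omega> = G (\<theta> (Suc n) \<omega>) (\<xi> (Suc n) \<omega>)" for n \<omega>
  \<comment> \<open>Estimates divide by the Lipschitz constant, and \<open>L\<close> may be zero.\<close>
  define L' where "L' = max L 1"
  have \<xi>: "\<xi> i \<in> measurable M N" if "i \<ge> 1" for i
    using assms(2) that by (auto simp: indep_vars_def)
  have subalg: "subalgebra M (F n)" for n
    unfolding F_def by (rule subalgebra_oracle_filtration[OF \<xi>])
  have space_F: "space (F n) = space M" for n
    unfolding F_def by (rule space_oracle_filtration)
  have mono: "sets (F m) \<subseteq> sets (F n)" if "m \<le> n" for m n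
    unfolding F_def by (rule oracle_filtration_mono[OF that])
  have subalg_F: "subalgebra (F (Suc n)) (F n)" for n
    using mono[of n "Suc n"] by (simp add: subalgebra_def space_F)
  have S_Suc: "S (Suc n) \<omega> = S n \<omega> + (norm (H n \<omega>))\<^sup>2"
    and x_Suc: "x (Suc n) \<omega> = x n \<omega> - (\<alpha>\<^sub>0 / sqrt (S n \<omega> + (norm (H n \<omega>))\<^sup>2)) *\<^sub>R H n \<omega>"
    and x_0: "x 0 \<omega> = \<theta>\<^sub>1" and S_0: "S 0 \<omega> = S\<^sub>0" if "\<omega> \<in> space M" for \<omega> n
  proof -
    have ag: "adagrad_norm G \<alpha>\<^sub>0 S\<^sub>0 \<theta>\<^sub>1 (\<lambda>n. \<xi> n \<omega>) (\<lambda>n. S n \<omega>) (\<lambda>n. \<theta> n \<omega>)" by (rule assms(13)[OF that])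
    then have rec: "\<And>n. n \<ge> 1 \<Longrightarrow> S n \<omega> = S (n - 1) \<omega> + (norm (G (\<theta> n \<omega>) (\<xi> n \<omega>)))\<^sup>2 \<and>
        \<theta> (n + 1) \<omega> = \<theta> n \<omega> - (\<alpha>\<^sub>0 / sqrt (S n \<omega>)) *\<^sub>R G (\<theta> n \<omega>) (\<xi> n \<omega>)"
      by (simp add: adagrad_norm_def)
    show S: "S (Suc n) \<omega> = S n \<omega> + (norm (H n \<omega>))\<^sup>2" using rec[of "Suc n"] by (simp add: H_def)
    show "x (Suc n) \<omega> = x n \<omega> - (\<alpha>\<^sub>0 / sqrt (S n \<omega> + (norm (H n \<omega>))\<^sup>2)) *\<^sub>R H n \<omega>"
      using rec[of "Suc n"] S by (simp add: x_def H_def)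
    show "x 0 \<omega> = \<theta>\<^sub>1" "S 0 \<omega> = S\<^sub>0" using ag by (simp_all add: adagrad_norm_def x_def)
  qed
  have H_adapted_if: "H n \<in> borel_measurable (F (Suc n))" if x: "x n \<in> borel_measurable (F n)" for n
  proof -
    have "x n \<in> borel_measurable (F (Suc n))" by (rule measurable_from_subalg[OF subalg_F x])
    moreover have "\<xi> (Suc n) \<in> measurable (F (Suc n)) N"
      unfolding F_def by (rule measurable_oracle_filtration[OF \<xi>]) auto
    ultimately have "(\<lambda>\<omega>. (x n \<omega>, \<xi> (Suc n) \<omega>)) \<in> measurable (F (Suc n)) (borel \<Otimes>\<^sub>M N)"
      by (rule measurable_Pair)
    from measurable_compose[OF this assms(3)] show ?thesis
      by (simp add: H_def[abs_def] x_def)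
  qed
  have adapted: "x n \<in> borel_measurable (F n) \<and> S n \<in> borel_measurable (F n)" for n
  proof (induction n)
    case 0
    have "x 0 \<in> borel_measurable (F 0) \<longleftrightarrow> (\<lambda>_. \<theta>\<^sub>1) \<in> borel_measurable (F 0)"
      by (rule measurable_cong) (simp add: space_F x_0)
    moreover have "S 0 \<in> borel_measurable (F 0) \<longleftrightarrow> (\<lambda>_. S\<^sub>0) \<in> borel_measurable (F 0)"
      by (rule measurable_cong) (simp add: space_F S_0)
    ultimately show ?case by simp
  next
    case (Suc n)
    have [measurable]: "x n \<in> borel_measurable (F (Suc n))" "S n \<in> borel_measurable (F (Suc n))"
      "H n \<in> borel_measurable (F (Suc n))"
      using measurable_from_subalg[OF subalg_F] H_adapted_if Suc by auto
    have "x (Suc n) \<in> borel_measurable (F (Suc n)) \<longleftrightarrow>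
        (\<lambda>\<omega>. x n \<omega> - (\<alpha>\<^sub>0 / sqrt (S n \<omega> + (norm (H n \<omega>))\<^sup>2)) *\<^sub>R H n \<omega>) \<in> borel_measurable (F (Suc n))"
      by (rule measurable_cong) (simp add: space_F x_Suc)
    moreover have "S (Suc n) \<in> borel_measurable (F (Suc n)) \<longleftrightarrow>
        (\<lambda>\<omega>. S n \<omega> + (norm (H n \<omega>))\<^sup>2) \<in> borel_measurable (F (Suc n))"
      by (rule measurable_cong) (simp add: space_F S_Suc)
    ultimately show ?case by simp
  qed
  have H_adapted: "H n \<in> borel_measurable (F (Suc n))" for n
    by (rule H_adapted_if) (use adapted in blast)
  have sf: "sigma_finite_subalgebra M (F n)" for n
    by (rule finite_measure_subalgebra_is_sigma_finite)
       (simp add: finite_measure_subalgebra_def finite_measure_subalgebra_axioms_def finite_measure_axioms subalg)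
  interpret smooth_nonneg g grad_g L'
  proof
    show "norm (grad_g x - grad_g y) \<le> L' * norm (x - y)" for x y
      using order_trans[OF assms(7) mult_right_mono[of L L']] by (simp add: L'_def)
  qed (use assms(4,6) in \<open>auto simp: L'_def\<close>)
  interpret adagrad_noise g grad_g L' \<alpha>\<^sub>0 S\<^sub>0 \<sigma>\<^sub>0 \<sigma>\<^sub>1
    by unfold_locales (use assms in auto)
  interpret adagrad_process g grad_g L' \<alpha>\<^sub>0 S\<^sub>0 \<sigma>\<^sub>0 \<sigma>\<^sub>1 M F x H S \<theta>\<^sub>1 D\<^sub>0 D\<^sub>1
  proof unfold_locales
    fix n
    have xM [measurable]: "x n \<in> borel_measurable M"
      using measurable_from_subalg[OF subalg] adapted by blast
    have HM [measurable]: "H n \<in> borel_measurable M"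
      by (rule measurable_from_subalg[OF subalg H_adapted])
    show "(\<integral>\<omega>. h \<omega> \<bullet> H n \<omega> \<partial>M) = (\<integral>\<omega>. h \<omega> \<bullet> grad_g (x n \<omega>) \<partial>M)"
      if "h \<in> borel_measurable (F n)" "\<And>\<omega>. \<omega> \<in> space M \<Longrightarrow> norm (h \<omega>) \<le> c" "integrable M (H n)" for h c
    proof (rule expectation_inner_vec_cond_exp[OF sf that(3) _ _ that(1,2)])
      show "AE \<omega> in M. vec_cond_exp M (F n) (H n) \<omega> = grad_g (x n \<omega>)"
        using assms(14)[of "Suc n"] by (simp add: F_def x_def H_def[abs_def])
    qed measurable
    show "(\<integral>\<^sup>+\<omega>. f \<omega> * ennreal ((norm (H n \<omega>))\<^sup>2) \<partial>M)
        \<le> (\<integral>\<^sup>+\<omega>. f \<omega> * ennreal (\<sigma>\<^sub>0 * (norm (grad_g (x n \<omega>)))\<^sup>2 + \<sigma>\<^sub>1) \<partial>M)"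
      if f: "f \<in> borel_measurable (F n)" for f
    proof -
      interpret sigma_finite_subalgebra M "F n" by (rule sf)
      have "(\<integral>\<^sup>+\<omega>. f \<omega> * ennreal ((norm (H n \<omega>))\<^sup>2) \<partial>M)
          = (\<integral>\<^sup>+\<omega>. f \<omega> * nn_cond_exp M (F n) (\<lambda>\<omega>. ennreal ((norm (H n \<omega>))\<^sup>2)) \<omega> \<partial>M)"
        by (rule nn_cond_exp_intg[OF f, symmetric]) measurable
      also have "\<dots> \<le> (\<integral>\<^sup>+\<omega>. f \<omega> * ennreal (\<sigma>\<^sub>0 * (norm (grad_g (x n \<omega>)))\<^sup>2 + \<sigma>\<^sub>1) \<partial>M)"
      proof (rule nn_integral_mono_AE)
        have "AE \<omega> in M. nn_cond_exp M (F n) (\<lambda>\<omega>. ennreal ((norm (H n \<omega>))\<^sup>2)) \<omega>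
            \<le> ennreal (\<sigma>\<^sub>0 * (norm (grad_g (x n \<omega>)))\<^sup>2 + \<sigma>\<^sub>1)"
          using assms(17)[of "Suc n"] by (simp add: F_def x_def H_def)
        then show "AE \<omega> in M. f \<omega> * nn_cond_exp M (F n) (\<lambda>\<omega>. ennreal ((norm (H n \<omega>))\<^sup>2)) \<omega>
            \<le> f \<omega> * ennreal (\<sigma>\<^sub>0 * (norm (grad_g (x n \<omega>)))\<^sup>2 + \<sigma>\<^sub>1)"
          by eventually_elim (rule mult_left_mono, auto)
      qed
      finally show ?thesis .
    qed
    show "AE \<omega> in M. (norm (grad_g (x n \<omega>)))\<^sup>2 < D\<^sub>0 \<longrightarrow> (norm (H n \<omega>))\<^sup>2 < D\<^sub>1"
      using assms(20)[of "Suc n"] by (simp add: x_def H_def)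
    show "x (Suc n) \<omega> = step (x n \<omega>) (H n \<omega>) (S n \<omega>)" if "\<omega> \<in> space M" for \<omega>
      unfolding step_def by (rule x_Suc[OF that])
    show "\<exists>\<eta>>0. \<exists>B. \<forall>y. (norm (grad_g y))\<^sup>2 < \<eta> \<longrightarrow> g y \<le> B"
      using assms(8) small_gradient_bounded_values by blast
    show "interior (closure {g x |x. grad_g x = 0}) = {}"
      using assms(10) by (simp add: nowhere_dense_def)
  qed (use subalg mono adapted H_adapted x_0 S_0 S_Suc assms(9,18) in auto)
  have "(\<lambda>n. \<integral>\<^sup>+\<omega>. ennreal ((norm (grad_g (\<theta> (Suc n) \<omega>)))\<^sup>2) \<partial>M) \<longlonglongrightarrow> 0"
    using expected_grad_tendsto_zero by (simp add: x_def)
  then show ?thesis by (rule LIMSEQ_imp_Suc)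
qed

end
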